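(* Let $a,b$ be nonzero complex numbers and let $H$ be the operator generated in $L_2(-\infty,\infty)$ by $-y''+qy$ with $q(x)=ae^{-i2\pi x}+be^{i2\pi x}$. If $|a|\ne|b|$, then $H$ has a spectral singularity at infinity and hence is not an asymptotically spectral operator.
   Context: For $t\in(-\pi,\pi]$, $H_t$ is the operator generated in $L_2[0,1]$ by $-y''+qy$ and the boundary conditions $y(1)=e^{it}y(0)$, $y'(1)=e^{it}y'(0)$. The spectrum of $H$ is the union of the spectra of the $H_t$; the eigenvalues of $H_t$ are the roots of $F(\lambda)=2\cos t$, where $F(\lambda)=\varphi'(1,\lambda)+\theta(1,\lambda)$ and $\varphi,\theta$ solve $-y''+qy=\lambda y$ with $\theta(0,\lambda)=\varphi'(0,\lambda)=1$, $\theta'(0,\lambda)=\varphi(0,\lambda)=0$. Regular spectral arc: a closed arc $\gamma=\{\lambda(t):t\in[\alpha_0,\beta_0]\}$ with $\lambda$ continuous on $[\alpha_0,\beta_0]$, analytic in an open neighborhood of $[\alpha_0,\beta_0]$, $F(\lambda(t))=2\cos t$, $\frac{\partial F}{\partial\lambda}(\lambda(t))\ne0$ for all $t\in[\alpha_0,\beta_0]$ and $\lambda'(t)\neq0$ for all $t\in(\alpha_0,\beta_0)$. The projection corresponding to $\gamma$ is $$P(\gamma)f=\frac1{2\pi}\int_\gamma\big(\Phi_+(x,\lambda)F_-(\lambda,f)+\Phi_-(x,\lambda)F_+(\lambda,f)\big)\frac{\varphi(1,\lambda)}{p(\lambda)}d\lambda,$$ where $\Phi_\pm(x,\lambda)=\theta(x,\lambda)+(\varphi(1,\lambda))^{-1}(e^{\pm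 it}-\theta(1,\lambda))\varphi(x,\lambda)$, $F_\pm(\lambda,f)=\int_{\mathbb R}f(x)\Phi_\pm(x,\lambda)dx$ and $p(\lambda)=\sqrt{4-F^2(\lambda)}$. It is known that $\|P(\gamma)\|=\sup_{t\in[\alpha_0,\beta_0]}|d(\lambda(t))|^{-1}$ with $d(\lambda(t))=(\Psi_{\lambda(t)},\Psi^*_{\lambda(t)})$, where $\Psi_{\lambda(t)}$, $\Psi^*_{\lambda(t)}$ are normalized eigenfunctions of $H_t$, $H_t^*$ corresponding to $\lambda(t)$, $\overline{\lambda(t)}$. $H$ has a spectral singularity at infinity if there is a sequence $\{\gamma_n\}$ of regular spectral arcs whose distance from $0$ tends to $\infty$ and with $\lim_{n\to\infty}\|P(\gamma_n)\|=\infty$. $H$ is an asymptotically spectral operator if there is a constant $C>0$ such that $$\sup_{\sigma\in R(C)}\Big(\operatorname{ess\,sup}_{t\in(-\pi,\pi]}\|e(t,\sigma)\|\Big)<\infty,$$ where $R(C)$ is the ring of all finite unions of half-closed rectangles lying in $\{\lambda\in\mathbb C:|\lambda|>C\}$ and $e(t,\sigma)$ is the spectral projection of $H_t$ defined by contour integration of the resolvent of $H_t$ over $\sigma$. *)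

theory Defs
  imports "HOL-Complex_Analysis.Complex_Analysis"
begin

section \<open>Square-integrable functions and operator norms\<close>

definition L2 :: "real measure \<Rightarrow> (real \<Rightarrow> complex) set" where
  "L2 M = {f. f \<in> borel_measurable M \<and> integrable M (\<lambda>x. (cmod (f x))\<^sup>2)}"

definition sq_norm :: "real measure \<Rightarrow> (real \<Rightarrow> complex) \<Rightarrow> ennreal" where
  "sq_norm M f = (\<integral>\<^sup>+x. ennreal ((cmod (f x))\<^sup>2) \<partial>M)"

text \<open>The operator norm on \<open>L\<^sub>2(M)\<close> of \<open>T\<close>, given on the subspace \<open>D\<close>. If \<open>D\<close> is dense and the
  value is finite, it is also the norm of the continuous extension of \<open>T\<close> to the whole space.\<close>

definition op_norm ::
  "real measure \<Rightarrow> (real \<Rightarrow> complex) set \<Rightarrow> ((real \<Rightarrow> complex) \<Rightarrow> real \<Rightarrow> complex) \<Rightarrow> ennreal" where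
  "op_norm M D T = Inf {K. \<forall>f\<in>D. sq_norm M (T f) \<le> K\<^sup>2 * sq_norm M f}"

section \<open>The Hill equation\<close>

text \<open>Throughout, \<open>q\<close> is a continuous potential of period 1, so solutions of \<open>-y'' + q y = \<lambda> y\<close>
  are classical.\<close>

definition hill_solution ::
  "(real \<Rightarrow> complex) \<Rightarrow> complex \<Rightarrow> complex \<Rightarrow> complex \<Rightarrow> real \<Rightarrow> complex" where
  "hill_solution q lam c d = (THE y. \<exists>dy.
     (\<forall>x. (y has_vector_derivative dy x) (at x) \<and>
          (dy has_vector_derivative (q x - lam) * y x) (at x)) \<and>
     y 0 = c \<and> dy 0 = d)"

definition theta :: "(real \<Rightarrow> complex) \<Rightarrow> complex \<Rightarrow> real \<Rightarrow> complex" where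
  "theta q lam = hill_solution q lam 1 0"

definition phi :: "(real \<Rightarrow> complex) \<Rightarrow> complex \<Rightarrow> real \<Rightarrow> complex" where
  "phi q lam = hill_solution q lam 0 1"

definition hill_F :: "(real \<Rightarrow> complex) \<Rightarrow> complex \<Rightarrow> complex" where
  "hill_F q lam = vector_derivative (phi q lam) (at 1) + theta q lam 1"

section \<open>Spectral arcs and their projections\<close>

text \<open>The arc is \<open>{lam (of_real t) | t. \<alpha> \<le> t \<le> \<beta>}\<close>; \<open>lam\<close> is the analytic continuation of the
  parametrization to a complex neighbourhood of the parameter interval.\<close>

definition regular_spectral_arc ::
  "(real \<Rightarrow> complex) \<Rightarrow> (complex \<Rightarrow> complex) \<Rightarrow> real \<Rightarrow> real \<Rightarrow> bool" where
  "regular_spectral_arc q lam \<alpha> \<beta> \<longleftrightarrow>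
     \<alpha> < \<beta> \<and>
     continuous_on (complex_of_real ` {\<alpha>..\<beta>}) lam \<and>
     lam analytic_on (complex_of_real ` {\<alpha>..\<beta>}) \<and>
     (\<forall>t\<in>{\<alpha>..\<beta>}. hill_F q (lam (of_real t)) = 2 * of_real (cos t)) \<and>
     (\<forall>t\<in>{\<alpha>..\<beta>}. deriv (hill_F q) (lam (of_real t)) \<noteq> 0) \<and>
     (\<forall>t\<in>{\<alpha><..<\<beta>}. deriv lam (of_real t) \<noteq> 0)"

text \<open>With \<open>hill_F q lam = 2 cos t\<close>, the functions \<open>\<Phi>\<^sub>+\<close> and \<open>\<Phi>\<^sub>-\<close> are \<open>Phi q t lam\<close> and
  \<open>Phi q (-t) lam\<close>.\<close>

definition Phi :: "(real \<Rightarrow> complex) \<Rightarrow> real \<Rightarrow> complex \<Rightarrow> real \<Rightarrow> complex" where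
  "Phi q t lam x = theta q lam x + (cis t - theta q lam 1) / phi q lam 1 * phi q lam x"

definition Phi_transform ::
  "(real \<Rightarrow> complex) \<Rightarrow> real \<Rightarrow> complex \<Rightarrow> (real \<Rightarrow> complex) \<Rightarrow> complex" where
  "Phi_transform q t lam f = (LINT x|lebesgue. f x * Phi q t lam x)"

text \<open>On a regular spectral arc \<open>4 - F\<^sup>2 = 4 sin\<^sup>2 t\<close>, where \<open>sin t\<close> has no zero for \<open>\<alpha> < t < \<beta>\<close>, so
  the choice of the branch of the square root affects at most the sign of the projection.\<close>

definition hill_p :: "(real \<Rightarrow> complex) \<Rightarrow> complex \<Rightarrow> complex" where
  "hill_p q lam = csqrt (4 - (hill_F q lam)\<^sup>2)"

text \<open>The integral over the arc, written in the parameter \<open>t\<close>. The integrand extends continuously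
  to the finitely many \<open>t\<close> at which \<open>phi q lam 1\<close> or \<open>hill_p q lam\<close> vanishes.\<close>

definition arc_projection ::
  "(real \<Rightarrow> complex) \<Rightarrow> (complex \<Rightarrow> complex) \<Rightarrow> real \<Rightarrow> real \<Rightarrow> (real \<Rightarrow> complex) \<Rightarrow> real \<Rightarrow> complex"
where
  "arc_projection q lam \<alpha> \<beta> f x =
     1 / (2 * of_real pi) * integral {\<alpha>..\<beta>} (\<lambda>t. let l = lam (of_real t) in
       (Phi q t l x * Phi_transform q (- t) l f + Phi q (- t) l x * Phi_transform q t l f)
       * (phi q l 1 / hill_p q l) * deriv lam (of_real t))"

text \<open>The transforms \<open>F\<^sub>\<plusminus>(\<lambda>, f)\<close> converge absolutely on the dense subspace of square-integrable
  functions of bounded support; the projection is the continuous extension from there.\<close>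

definition L2_bounded_support :: "(real \<Rightarrow> complex) set" where
  "L2_bounded_support = {f \<in> L2 lebesgue. bounded {x. f x \<noteq> 0}}"

definition arc_projection_norm ::
  "(real \<Rightarrow> complex) \<Rightarrow> (complex \<Rightarrow> complex) \<Rightarrow> real \<Rightarrow> real \<Rightarrow> ennreal" where
  "arc_projection_norm q lam \<alpha> \<beta> =
     op_norm lebesgue L2_bounded_support (arc_projection q lam \<alpha> \<beta>)"

definition spectral_singularity_at_infinity :: "(real \<Rightarrow> complex) \<Rightarrow> bool" where
  "spectral_singularity_at_infinity q \<longleftrightarrow>
     (\<exists>(lam :: nat \<Rightarrow> complex \<Rightarrow> complex) \<alpha> \<beta>.
        (\<forall>n. regular_spectral_arc q (lam n) (\<alpha> n) (\<beta> n)) \<and>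
        filterlim (\<lambda>n. infdist 0 ((\<lambda>t. lam n (of_real t)) ` {\<alpha> n..\<beta> n})) at_top sequentially \<and>
        (\<lambda>n. arc_projection_norm q (lam n) (\<alpha> n) (\<beta> n)) \<longlonglongrightarrow> \<infinity>)"

section \<open>The operators on the period interval\<close>

text \<open>The graph of the operator \<open>H\<^sub>t\<close> in \<open>L\<^sub>2[0,1]\<close>: \<open>u\<close> lies in its domain, that is, \<open>u\<close> and \<open>u'\<close> are
  absolutely continuous on \<open>[0,1]\<close>, \<open>u''\<close> is square-integrable and \<open>u\<close> satisfies the
  quasi-periodic boundary conditions; and \<open>h = -u'' + q u\<close> almost everywhere. Values
  of \<open>u\<close> and \<open>h\<close> outside \<open>[0,1]\<close> are irrelevant.\<close>

definition bloch_op ::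
  "(real \<Rightarrow> complex) \<Rightarrow> real \<Rightarrow> (real \<Rightarrow> complex) \<Rightarrow> (real \<Rightarrow> complex) \<Rightarrow> bool" where
  "bloch_op q t u h \<longleftrightarrow> (\<exists>du ddu.
     ddu \<in> L2 (lebesgue_on {0..1}) \<and>
     (\<forall>x\<in>{0..1}. (du has_integral (u x - u 0)) {0..x} \<and> (ddu has_integral (du x - du 0)) {0..x}) \<and>
     u 1 = cis t * u 0 \<and> du 1 = cis t * du 0 \<and>
     (AE x in lebesgue_on {0..1}. h x = - ddu x + q x * u x))"

text \<open>\<open>(H\<^sub>t - z) u = f\<close> is expressed as \<open>H\<^sub>t u = f + z u\<close>.\<close>

definition bloch_spectrum :: "(real \<Rightarrow> complex) \<Rightarrow> real \<Rightarrow> complex set" where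
  "bloch_spectrum q t = - {z.
     (\<forall>f\<in>L2 (lebesgue_on {0..1}). \<exists>u. bloch_op q t u (\<lambda>x. f x + z * u x)) \<and>
     (\<exists>K<\<infinity>. \<forall>f\<in>L2 (lebesgue_on {0..1}). \<forall>u. bloch_op q t u (\<lambda>x. f x + z * u x) \<longrightarrow>
        sq_norm (lebesgue_on {0..1}) u \<le> K * sq_norm (lebesgue_on {0..1}) f)}"

text \<open>The resolvent \<open>(H\<^sub>t - z)\<inverse> f\<close>; for \<open>z\<close> outside the spectrum its values on \<open>[0,1]\<close> are uniquely
  determined, being those of a continuous function.\<close>

definition bloch_resolvent ::
  "(real \<Rightarrow> complex) \<Rightarrow> real \<Rightarrow> complex \<Rightarrow> (real \<Rightarrow> complex) \<Rightarrow> real \<Rightarrow> complex" where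
  "bloch_resolvent q t z f = (SOME u. bloch_op q t u (\<lambda>x. f x + z * u x))"

definition isolating_radius :: "(real \<Rightarrow> complex) \<Rightarrow> real \<Rightarrow> complex \<Rightarrow> real" where
  "isolating_radius q t \<mu> = (SOME r. r > 0 \<and> cball \<mu> r \<inter> bloch_spectrum q t = {\<mu>})"

text \<open>The spectral projection \<open>e(t,\<sigma>)\<close> of a bounded set \<open>\<sigma>\<close>: the resolvent is integrated over a cycle
  of circles winding once around the finitely many eigenvalues in \<open>\<sigma>\<close> and not around any other.
  If the boundary of \<open>\<sigma>\<close> does not meet the spectrum, this is the integral over that boundary;
  otherwise the eigenvalues on the boundary count precisely when they belong to \<open>\<sigma>\<close>.\<close>

definition spectral_projection ::
  "(real \<Rightarrow> complex) \<Rightarrow> real \<Rightarrow> complex set \<Rightarrow> (real \<Rightarrow> complex) \<Rightarrow> real \<Rightarrow> complex" where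
  "spectral_projection q t \<sigma> f x =
     - 1 / (2 * of_real pi * \<i>) * (\<Sum>\<mu>\<in>\<sigma> \<inter> bloch_spectrum q t.
         contour_integral (circlepath \<mu> (isolating_radius q t \<mu>)) (\<lambda>z. bloch_resolvent q t z f x))"

definition spectral_projection_norm :: "(real \<Rightarrow> complex) \<Rightarrow> real \<Rightarrow> complex set \<Rightarrow> ennreal" where
  "spectral_projection_norm q t \<sigma> =
     op_norm (lebesgue_on {0..1}) (L2 (lebesgue_on {0..1})) (spectral_projection q t \<sigma>)"

definition half_closed_rectangles :: "complex set set" where
  "half_closed_rectangles = {{z. a < Re z \<and> Re z \<le> b \<and> c < Im z \<and> Im z \<le> d} | a b c d. True}"

definition rectangle_ring :: "real \<Rightarrow> complex set set" where
  "rectangle_ring C = {\<Union>S | S. finite S \<and> S \<subseteq> half_closed_rectangles \<and>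
     (\<forall>Q\<in>S. Q \<subseteq> {z. cmod z > C})}"

text \<open>The inner infimum is the essential supremum over \<open>t\<close>. The constant \<open>esssup\<close> of the probability
  library is avoided because it is infinite by convention on non-measurable functions.\<close>

definition asymptotically_spectral :: "(real \<Rightarrow> complex) \<Rightarrow> bool" where
  "asymptotically_spectral q \<longleftrightarrow> (\<exists>C>0.
     (SUP \<sigma>\<in>rectangle_ring C.
        Inf {m. AE t in lebesgue_on {-pi<..pi}. spectral_projection_norm q t \<sigma> \<le> m}) < \<infinity>)"

end

theory Submission
  imports Defs
begin

text \<open>
  The discriminant \<open>F\<close> is entire, bounded along the positive real axis and unbounded along the negative one,
  so by the great Picard theorem it takes the value \<open>2\<close> or \<open>-2\<close> at points \<open>l0\<close> of arbitrarily large modulus.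
  The Fourier coefficients of the (anti)periodic solution at such a point satisfy a three-term recurrence, which
  becomes symmetric after dividing the \<open>k\<close>-th coefficient by \<open>s\<^sup>k\<close> with \<open>s\<^sup>2 = b / a\<close>. The space of decaying solutions of the
  symmetric recurrence is one-dimensional, so the symmetrized coefficients are even or odd and concentrate
  equally near two frequencies \<open>\<plusminus>n\<close>. Undoing the symmetrization multiplies the two peaks by \<open>s\<^sup>n\<close> and \<open>s\<^sup>-\<^sup>n\<close>: as
  \<open>\<bar>s\<bar> \<noteq> 1\<close>, the norm of the solution \<open>\<Psi>\<close> grows exponentially in \<open>n\<close>, whereas \<open>\<integral>\<Psi>\<^sup>2\<close> grows only polynomially. By
  continuity the eigenfunctions of \<open>H\<^sub>t\<close> and of its adjoint are nearly orthogonal for the eigenvalues close to \<open>l0\<close>, and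
  \<open>F' \<noteq> 0\<close> at these. Both the projection of an arc of such eigenvalues and the spectral projections of the
  eigenvalues themselves have norm at least \<open>\<parallel>\<Phi>\<^sub>+\<parallel> \<parallel>\<Phi>\<^sub>-\<parallel> / \<bar>\<integral>\<Phi>\<^sub>+ \<Phi>\<^sub>-\<bar>\<close>: the former by testing with long wave packets, the latter
  by computing the residue of the resolvent.
\<close>


section \<open>Solutions as entire functions of the spectral parameter\<close>

section \<open>Power series whose coefficients depend on a parameter\<close>

text \<open>The eigenfunction of the adjoint of \<open>H_t\<close> is the conjugate of
  \<open>Phi q (- t) l\<close>, so the pairing that must be small is the integral of
  \<open>Phi q t l x * Phi q (- t) l x\<close>, without conjugation. When \<open>F\<close> is 2 or
  -2 the multipliers \<open>cis t\<close> and \<open>cis (- t)\<close> coincide, both factors become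
  one periodic or antiperiodic solution, and the pairing becomes the integral of its square.

  The obstacle is that such a point may be unusable on an arc: \<open>F'\<close> may vanish there,
  and so may \<open>phi q l 1\<close>, the denominator in \<open>Phi\<close>. The estimate is
  therefore proved for an unnormalized Floquet solution without denominators, depending continuously
  on the spectral parameter and on \<open>t\<close>. It is an open condition, and being homogeneous
  in both factors it passes to \<open>Phi\<close> at nearby points.

  No asymptotic formula for \<open>F\<close> is used. Its place is taken by a localization: if
  \<open>F l = 2 * cos t\<close> with complex \<open>t\<close>, then \<open>l\<close> lies within
  \<open>cmod a + cmod b\<close> of the square of some \<open>2 pi n + t\<close>. This yields the
  two bounds on the real axis on which the appeal to Picard rests.\<close>

definition rapidly_decreasing :: "(complex \<Rightarrow> nat \<Rightarrow> complex) \<Rightarrow> bool" where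
  "rapidly_decreasing k \<longleftrightarrow>
     (\<forall>r\<ge>1. \<forall>L. \<exists>C. \<forall>l m. cmod l \<le> L \<longrightarrow> cmod (k l m) * r ^ m \<le> C)"

text \<open>The bound at radius \<open>2 * R\<close> gains a factor \<open>(1/2) ^ m\<close> on the
  disc of radius \<open>R\<close>, uniformly for \<open>cmod l \<le> L\<close>. This one majorant
  serves the M-test behind joint continuity and holomorphy.\<close>

lemma rapidly_decreasing_dominated:
  assumes "rapidly_decreasing k" "R > 0"
  obtains C where "\<And>l x m. cmod l \<le> L \<Longrightarrow> cmod x \<le> R \<Longrightarrow> cmod (k l m * x ^ m) \<le> C * (1/2) ^ m"
proof -
  define r where "r = max 1 (2 * R)"
  obtain C where C: "\<And>l m. cmod l \<le> L \<Longrightarrow> cmod (k l m) * r ^ m \<le> C"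
    using assms(1) unfolding rapidly_decreasing_def r_def by (meson max.cobounded1)
  show thesis
  proof (rule that)
    fix l x m assume *: "cmod l \<le> L" "cmod x \<le> R"
    have "cmod x \<le> r * (1/2)" using *(2) unfolding r_def by auto
    then have "cmod x ^ m \<le> (r * (1/2)) ^ m" by (intro power_mono) auto
    then have "cmod (k l m) * cmod x ^ m \<le> cmod (k l m) * (r * (1/2)) ^ m"
      by (intro mult_left_mono) auto
    also have "\<dots> = (cmod (k l m) * r ^ m) * (1/2) ^ m" by (simp only: power_mult_distrib mult.assoc)
    also have "\<dots> \<le> C * (1/2) ^ m" using C[OF *(1)] by (intro mult_right_mono) auto
    finally show "cmod (k l m * x ^ m) \<le> C * (1/2) ^ m" by (simp add: norm_mult norm_power)
  qed
qed

lemma rapidly_decreasing_summable_norm: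
  assumes "rapidly_decreasing k"
  shows "summable (\<lambda>m. cmod (k l m * x ^ m))"
proof -
  obtain C where C: "\<And>l' x' m. cmod l' \<le> cmod l \<Longrightarrow> cmod x' \<le> cmod x + 1
      \<Longrightarrow> cmod (k l' m * x' ^ m) \<le> C * (1/2) ^ m"
    using rapidly_decreasing_dominated[OF assms, of "cmod x + 1" "cmod l"] by (metis add.commute add_pos_nonneg less_numeral_extra(1) norm_ge_zero)
  show ?thesis
  proof (rule summable_comparison_test')
    show "summable (\<lambda>m. C * (1/2) ^ m)" by (intro summable_mult summable_geometric) auto
  qed (use C[of l x] in auto)
qed

lemma rapidly_decreasing_summable:
  assumes "rapidly_decreasing k"
  shows "summable (\<lambda>m. k l m * x ^ m)"
  using rapidly_decreasing_summable_norm[OF assms] by (rule summable_norm_cancel)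

lemma rapidly_decreasing_diffs:
  assumes "rapidly_decreasing k"
  shows "rapidly_decreasing (\<lambda>l. diffs (k l))"
  unfolding rapidly_decreasing_def
proof (intro allI impI)
  fix r L :: real assume r: "1 \<le> r"
  \<comment> \<open>The doubled radius absorbs the factor \<open>Suc m\<close> of differentiation,
    since \<open>Suc m \<le> 2 ^ Suc m\<close>.\<close>
  obtain C where C: "\<And>l m. cmod l \<le> L \<Longrightarrow> cmod (k l m) * (2 * r) ^ m \<le> C"
    using assms r unfolding rapidly_decreasing_def by (meson mult_le_cancel_left1 order_trans zero_le_one one_le_numeral mult_left_mono mult_ge1_I)
  have "cmod (diffs (k l) m) * r ^ m \<le> C" if l: "cmod l \<le> L" for l m
  proof -
    have "real (Suc m) \<le> 2 ^ Suc m"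
      by (metis less_exp of_nat_le_iff of_nat_numeral of_nat_power less_imp_le)
    moreover have "r ^ m \<le> r ^ Suc m" using r by (intro power_increasing) auto
    ultimately have "real (Suc m) * r ^ m \<le> 2 ^ Suc m * r ^ Suc m" using r by (intro mult_mono) auto
    then have "cmod (k l (Suc m)) * (real (Suc m) * r ^ m) \<le> cmod (k l (Suc m)) * (2 * r) ^ Suc m"
      by (intro mult_left_mono) (simp_all only: power_mult_distrib norm_ge_zero)
    also have "\<dots> \<le> C" using C[OF l] .
    finally show ?thesis unfolding diffs_def norm_mult norm_of_nat by (simp only: mult.assoc mult.left_commute mult.commute)
  qed
  then show "\<exists>C. \<forall>l m. cmod l \<le> L \<longrightarrow> cmod (diffs (k l) m) * r ^ m \<le> C" by blast
qed

lemma rapidly_decreasing_uniform_limit: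
  assumes "rapidly_decreasing k" "R > 0"
  shows "uniform_limit (cball 0 L \<times> cball 0 R) (\<lambda>n p. \<Sum>m<n. k (fst p) m * snd p ^ m)
           (\<lambda>p. \<Sum>m. k (fst p) m * snd p ^ m) sequentially"
proof -
  obtain C where C: "\<And>l x m. cmod l \<le> L \<Longrightarrow> cmod x \<le> R \<Longrightarrow> cmod (k l m * x ^ m) \<le> C * (1/2) ^ m"
    using rapidly_decreasing_dominated[OF assms] by metis
  show ?thesis
  proof (rule Weierstrass_m_test)
    show "summable (\<lambda>m. C * (1/2) ^ m)" by (intro summable_mult summable_geometric) auto
  qed (use C in auto)
qed

lemma rapidly_decreasing_continuous:
  assumes k: "rapidly_decreasing k" and c: "\<And>m. continuous_on UNIV (\<lambda>l. k l m)"
  shows "continuous_on UNIV (\<lambda>p. \<Sum>m. k (fst p) m * snd p ^ m)"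
proof -
  have "isCont (\<lambda>p. \<Sum>m. k (fst p) m * snd p ^ m) p0" for p0
  proof -
    define R where "R = cmod (snd p0) + 1"
    define L where "L = cmod (fst p0) + 1"
    have R: "R > 0" unfolding R_def by (simp add: add_nonneg_pos)
    have "continuous_on (cball 0 L \<times> cball 0 R) (\<lambda>p. \<Sum>m. k (fst p) m * snd p ^ m)"
    proof (rule uniform_limit_theorem[OF _ rapidly_decreasing_uniform_limit[OF k R]])
      show "\<forall>\<^sub>F n in sequentially. continuous_on (cball 0 L \<times> cball 0 R) (\<lambda>p. \<Sum>m<n. k (fst p) m * snd p ^ m)"
        by (intro always_eventually allI continuous_intros
              continuous_on_compose2[OF c]) auto
    qed auto
    then have "continuous_on (ball 0 L \<times> ball 0 R) (\<lambda>p. \<Sum>m. k (fst p) m * snd p ^ m)"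
      by (rule continuous_on_subset) auto
    moreover have "open (ball (0::complex) L \<times> ball (0::complex) R)" by (intro open_Times) auto
    moreover have "p0 \<in> ball 0 L \<times> ball 0 R" unfolding L_def R_def by (cases p0) auto
    ultimately show ?thesis using continuous_on_eq_continuous_at by blast
  qed
  then show ?thesis by (simp add: continuous_at_imp_continuous_on)
qed

lemma rapidly_decreasing_holomorphic:
  assumes k: "rapidly_decreasing k" and c: "\<And>m. (\<lambda>l. k l m) holomorphic_on UNIV"
  shows "(\<lambda>l. \<Sum>m. k l m * x ^ m) holomorphic_on UNIV"
proof (rule holomorphic_uniform_sequence[where f = "\<lambda>n l. \<Sum>m<n. k l m * x ^ m"])
  fix l0 :: complex
  define R where "R = cmod x + 1"
  define L where "L = cmod l0 + 1"
  have R: "R > 0" unfolding R_def by (simp add: add_nonneg_pos)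
  have *: "cmod l \<le> L" if "dist l0 l \<le> 1" for l
    using that norm_triangle_sub[of l l0] unfolding L_def by (simp add: dist_norm norm_minus_commute)
  have "uniform_limit (cball l0 1) (\<lambda>n l. \<Sum>m<n. k l m * x ^ m) (\<lambda>l. \<Sum>m. k l m * x ^ m) sequentially"
    using uniform_limit_compose'[OF rapidly_decreasing_uniform_limit[OF k R, of L], of "\<lambda>l. (l, x)" "cball l0 1"] *
    by (auto simp: R_def)
  then show "\<exists>d>0. cball l0 d \<subseteq> UNIV \<and> uniform_limit (cball l0 d) (\<lambda>n l. \<Sum>m<n. k l m * x ^ m) (\<lambda>l. \<Sum>m. k l m * x ^ m) sequentially"
    by (intro exI[of _ 1]) auto
qed (auto intro!: holomorphic_intros c)

text \<open>Morera: the integral over a triangle is exchanged with the integral over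
  \<open>s\<close>, and for each fixed \<open>s\<close> it vanishes by Cauchy's theorem.\<close>

lemma holomorphic_integral_parameter:
  fixes f :: "complex \<Rightarrow> real \<Rightarrow> complex"
  assumes cont: "continuous_on (UNIV \<times> {c..d}) (\<lambda>p. f (fst p) (snd p))"
    and hol: "\<And>s. s \<in> {c..d} \<Longrightarrow> (\<lambda>z. f z s) holomorphic_on UNIV"
  shows "(\<lambda>z. integral {c..d} (f z)) holomorphic_on UNIV"
proof -
  have cz: "continuous_on {c..d} (f z)" for z
    by (rule continuous_on_compose2[OF cont, of _ "\<lambda>s. (z, s)", simplified]) (auto intro!: continuous_intros)
  have ci: "continuous_on UNIV (\<lambda>z. integral {c..d} (f z))"
    using integral_continuous_on_param[of UNIV c d f] cont by (simp add: split_def)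
  have swap: "contour_integral (linepath a b) (\<lambda>z. integral {c..d} (f z))
      = integral {c..d} (\<lambda>s. contour_integral (linepath a b) (\<lambda>z. f z s))" for a b
  proof -
    have "continuous_on (cbox (0, c) (1, d)) (\<lambda>(x, s). f (linepath a b x) s)"
      unfolding split_def
      by (rule continuous_on_compose2[OF cont, of _ "\<lambda>p. (linepath a b (fst p), snd p)", simplified])
         (auto intro!: continuous_intros simp: cbox_Pair_eq linepath_def)
    then have "continuous_on (cbox (0, c) (1, d)) (\<lambda>(x, s). f (linepath a b x) s * (b - a))"
      by (auto simp: split_def intro!: continuous_intros)
    from integral_swap_continuous[OF this]
    have "integral {0..1} (\<lambda>x. integral {c..d} (\<lambda>s. f (linepath a b x) s * (b - a)))
        = integral {c..d} (\<lambda>s. integral {0..1} (\<lambda>x. f (linepath a b x) s * (b - a)))" by simp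
    then show ?thesis
      by (simp add: contour_integral_integral)
  qed
  have "(\<lambda>z. integral {c..d} (f z)) analytic_on UNIV"
  proof (rule Morera_triangle[OF ci open_UNIV], intro impI)
    fix x y w :: complex
    have int: "(\<lambda>s. contour_integral (linepath a b) (\<lambda>z. f z s)) integrable_on {c..d}" for a b
    proof -
      have "continuous_on ({c..d} \<times> cbox 0 1) (\<lambda>(s, x). f (linepath a b x) s * (b - a))"
        unfolding split_def
        by (rule continuous_on_mult[OF continuous_on_compose2[OF cont, of _ "\<lambda>p. (linepath a b (snd p), fst p)", simplified]])
           (auto intro!: continuous_intros simp: linepath_def)
      then have "continuous_on {c..d} (\<lambda>s. integral (cbox 0 1) (\<lambda>x. f (linepath a b x) s * (b - a)))"
        by (rule integral_continuous_on_param)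
      then show ?thesis by (intro integrable_continuous_real) (simp add: contour_integral_integral)
    qed
    have *: "contour_integral (linepath x y) (\<lambda>z. f z s) + contour_integral (linepath y w) (\<lambda>z. f z s)
        + contour_integral (linepath w x) (\<lambda>z. f z s) = 0" if "s \<in> {c..d}" for s
    proof -
      have h: "(\<lambda>z. f z s) holomorphic_on UNIV" by (rule hol[OF that])
      have "((\<lambda>z. f z s) has_contour_integral 0) (linepath x y +++ linepath y w +++ linepath w x)"
        by (rule Cauchy_theorem_triangle) (use h holomorphic_on_subset in blast)
      moreover have "(\<lambda>z. f z s) contour_integrable_on linepath a b" for a b
        by (intro contour_integrable_continuous_linepath holomorphic_on_imp_continuous_on holomorphic_on_subset[OF h]) auto
      ultimately show ?thesis
        by (auto dest!: contour_integral_unique simp: contour_integral_join valid_path_join contour_integrable_join add.assoc)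
    qed
    have "integral {c..d} (\<lambda>s. contour_integral (linepath x y) (\<lambda>z. f z s) + contour_integral (linepath y w) (\<lambda>z. f z s)
        + contour_integral (linepath w x) (\<lambda>z. f z s)) = integral {c..d} (\<lambda>s. 0)"
      by (intro integral_cong *)
    then show "contour_integral (linepath x y) (\<lambda>z. integral {c..d} (f z)) + contour_integral (linepath y w) (\<lambda>z. integral {c..d} (f z))
        + contour_integral (linepath w x) (\<lambda>z. integral {c..d} (f z)) = 0"
      unfolding swap by (simp add: integral_add int integrable_add)
  qed
  then show ?thesis by (rule analytic_imp_holomorphic)
qed

section \<open>The fundamental solutions\<close>

text \<open>Comparison of the coefficients of \<open>x ^ m\<close> in
  \<open>y'' = (q - l) y\<close>, where \<open>qc\<close> are the Taylor coefficients of
  \<open>q\<close> at 0 and \<open>c\<close>, \<open>d\<close> the initial values.\<close>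

fun hill_coeff :: "(nat \<Rightarrow> complex) \<Rightarrow> complex \<Rightarrow> complex \<Rightarrow> complex \<Rightarrow> nat \<Rightarrow> complex" where
  "hill_coeff qc c d l 0 = c"
| "hill_coeff qc c d l (Suc 0) = d"
| "hill_coeff qc c d l (Suc (Suc m)) =
     ((\<Sum>j\<le>m. qc j * hill_coeff qc c d l (m - j)) - l * hill_coeff qc c d l m)
       / (of_nat (Suc m) * of_nat (Suc (Suc m)))"

lemma hill_coeff_holomorphic: "(\<lambda>l. hill_coeff qc c d l m) holomorphic_on UNIV"
proof (induction m rule: less_induct)
  case (less m)
  consider "m = 0" | "m = Suc 0" | n where "m = Suc (Suc n)" by (metis not0_implies_Suc)
  then show ?case
  proof cases
    case 3
    have "(\<lambda>l. ((\<Sum>j\<le>n. qc j * hill_coeff qc c d l (n - j)) - l * hill_coeff qc c d l n)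
       / (of_nat (Suc n) * of_nat (Suc (Suc n)))) holomorphic_on UNIV"
      by (intro holomorphic_intros less) (auto simp: 3 simp del: of_nat_Suc)
    then show ?thesis by (simp add: 3)
  qed auto
qed

text \<open>In the weight \<open>r ^ m\<close> one step of the recurrence multiplies the running
  bound by at most \<open>B / ((n + 1) * (n + 2))\<close>. From \<open>n = N\<close> on, with
  \<open>B \<le> N\<close>, this is at most 1, so the bound grows during the first \<open>N\<close>
  steps only; hence the exponent \<open>min m N\<close>.\<close>

lemma hill_coeff_rapidly_decreasing:
  assumes qc: "\<And>r::real. summable (\<lambda>m. cmod (qc m) * r ^ m)"
  shows "rapidly_decreasing (hill_coeff qc c d)"
  unfolding rapidly_decreasing_def
proof (intro allI impI)
  fix r L :: real assume r: "1 \<le> r"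
  define Q where "Q = (\<Sum>m. cmod (qc m) * r ^ m)"
  define B where "B = r^2 * (Q + \<bar>L\<bar>)"
  have Q: "0 \<le> Q" unfolding Q_def using r by (intro suminf_nonneg qc) auto
  have B: "0 \<le> B" unfolding B_def using Q by auto
  obtain N where N: "B \<le> real N" using real_arch_simple by blast
  define C0 where "C0 = cmod c + cmod d * r"
  have C0: "0 \<le> C0" unfolding C0_def using r by auto
  have *: "cmod (hill_coeff qc c d l m) * r ^ m \<le> C0 * (1 + B) ^ min m N" if l: "cmod l \<le> L" for l m
  proof (induction m rule: less_induct)
    case (less m)
    consider "m = 0" | "m = Suc 0" | n where "m = Suc (Suc n)" by (metis not0_implies_Suc)
    then show ?case
    proof cases
      case 1
      then show ?thesis using r by (simp add: C0_def)
    next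
      case 2
      have "1 \<le> (1 + B) ^ min m N" using B by (intro one_le_power) auto
      then have "C0 * 1 \<le> C0 * (1 + B) ^ min m N" using C0 by (intro mult_left_mono)
      moreover have "cmod d * r \<le> C0" unfolding C0_def by simp
      ultimately show ?thesis using 2 by simp
    next
      case 3
      let ?h = "hill_coeff qc c d l" and ?K = "C0 * (1 + B) ^ min n N"
      have K: "0 \<le> ?K" using C0 B by auto
      have IH: "cmod (?h k) * r ^ k \<le> ?K" if "k \<le> n" for k
      proof -
        have "cmod (?h k) * r ^ k \<le> C0 * (1 + B) ^ min k N" using less that 3 by auto
        also have "\<dots> \<le> ?K" using that B C0 by (intro mult_left_mono power_increasing) auto
        finally show ?thesis .
      qed
      have "cmod (\<Sum>j\<le>n. qc j * ?h (n - j)) * r ^ n \<le> (\<Sum>j\<le>n. cmod (qc j) * cmod (?h (n - j))) * r ^ n"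
        using r by (intro mult_right_mono order_trans[OF norm_sum]) (auto simp: norm_mult)
      also have "\<dots> = (\<Sum>j\<le>n. (cmod (qc j) * r ^ j) * (cmod (?h (n - j)) * r ^ (n - j)))"
        unfolding sum_distrib_right
      proof (intro sum.cong refl)
        fix j assume "j \<in> {..n}"
        then have "r ^ n = r ^ j * r ^ (n - j)" by (simp add: power_add[symmetric])
        then show "cmod (qc j) * cmod (?h (n - j)) * r ^ n = (cmod (qc j) * r ^ j) * (cmod (?h (n - j)) * r ^ (n - j))"
          by simp
      qed
      also have "\<dots> \<le> (\<Sum>j\<le>n. (cmod (qc j) * r ^ j) * ?K)"
        using r by (intro sum_mono mult_left_mono IH) auto
      also have "\<dots> = (\<Sum>j\<le>n. cmod (qc j) * r ^ j) * ?K" by (simp add: sum_distrib_right)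
      also have "\<dots> \<le> Q * ?K" unfolding Q_def
        using r K by (intro mult_right_mono sum_le_suminf qc) auto
      finally have 1: "cmod (\<Sum>j\<le>n. qc j * ?h (n - j)) * r ^ n \<le> Q * ?K" .
      have 2: "cmod (l * ?h n) * r ^ n \<le> \<bar>L\<bar> * ?K"
        unfolding norm_mult mult.assoc
        using l r by (intro mult_mono[OF _ IH]) auto
      have "cmod ((\<Sum>j\<le>n. qc j * ?h (n - j)) - l * ?h n) * r ^ n \<le> (Q + \<bar>L\<bar>) * ?K"
        using mult_right_mono[OF norm_triangle_ineq4[of "(\<Sum>j\<le>n. qc j * ?h (n - j))" "l * ?h n"], of "r ^ n"] 1 2 r
        by (simp add: algebra_simps)
      then have "r^2 * (cmod ((\<Sum>j\<le>n. qc j * ?h (n - j)) - l * ?h n) * r ^ n) \<le> r^2 * ((Q + \<bar>L\<bar>) * ?K)"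
        by (intro mult_left_mono) auto
      then have "cmod ((\<Sum>j\<le>n. qc j * ?h (n - j)) - l * ?h n) * r ^ m \<le> B * ?K"
        by (simp add: 3 B_def power2_eq_square mult_ac)
      then have "cmod (?h m) * r ^ m \<le> B * ?K / (real (Suc n) * real (Suc (Suc n)))"
        unfolding 3 by (simp add: norm_divide norm_mult divide_right_mono del: of_nat_Suc)
      also have "\<dots> \<le> C0 * (1 + B) ^ min m N"
      proof (cases "n < N")
        case True
        have "B * ?K / (real (Suc n) * real (Suc (Suc n))) \<le> B * ?K"
        proof -
          have "1 \<le> real (Suc n) * real (Suc (Suc n))" by (intro mult_ge1_I) auto
          then have "B * ?K * 1 \<le> B * ?K * (real (Suc n) * real (Suc (Suc n)))"
            using B K by (intro mult_left_mono) auto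
          then show ?thesis by (simp add: divide_le_eq del: of_nat_Suc)
        qed
        also have "\<dots> \<le> (1 + B) * ?K" using K by (intro mult_right_mono) auto
        also have "\<dots> = C0 * (1 + B) ^ Suc n" using True by (simp add: min_def)
        also have "\<dots> \<le> C0 * (1 + B) ^ min m N"
          using True B C0 3 by (intro mult_left_mono power_increasing) auto
        finally show ?thesis .
      next
        case False
        have "B \<le> real (Suc n) * real (Suc (Suc n))"
        proof -
          have "B \<le> real (Suc n)" using N False by auto
          also have "\<dots> \<le> real (Suc n) * real (Suc (Suc n))"
            by (simp add: mult_le_cancel_left1 del: of_nat_Suc) 
          finally show ?thesis .
        qed
        then have "B * ?K / (real (Suc n) * real (Suc (Suc n))) \<le> ?K"
          using K by (simp add: divide_le_eq mult_right_mono mult.commute[of ?K] del: of_nat_Suc)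
        then show ?thesis using False 3 by (simp add: min_def split: if_splits)
      qed
      finally show ?thesis .
    qed
  qed
  show "\<exists>C. \<forall>l m. cmod l \<le> L \<longrightarrow> cmod (hill_coeff qc c d l m) * r ^ m \<le> C"
  proof (intro exI allI impI)
    fix l m assume "cmod l \<le> L"
    then have "cmod (hill_coeff qc c d l m) * r ^ m \<le> C0 * (1 + B) ^ min m N" by (rule *)
    also have "\<dots> \<le> C0 * (1 + B) ^ N" using B C0 by (intro mult_left_mono power_increasing) auto
    finally show "cmod (hill_coeff qc c d l m) * r ^ m \<le> C0 * (1 + B) ^ N" .
  qed
qed

definition hill_sol :: "(real \<Rightarrow> complex) \<Rightarrow> complex \<Rightarrow> (real \<Rightarrow> complex) \<Rightarrow> (real \<Rightarrow> complex) \<Rightarrow> bool" where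
  "hill_sol q lam y dy \<longleftrightarrow> (\<forall>x. (y has_vector_derivative dy x) (at x) \<and>
          (dy has_vector_derivative (q x - lam) * y x) (at x))"

text \<open>Summability for all real \<open>r\<close> makes \<open>q\<close> entire, so that
  solutions are everywhere convergent power series with coefficients polynomial in
  \<open>l\<close>.\<close>

locale hill_potential =
  fixes q :: "real \<Rightarrow> complex" and qc :: "nat \<Rightarrow> complex"
  assumes q_sums: "\<And>x. (\<lambda>m. qc m * of_real x ^ m) sums q x"
    and qc_summable: "\<And>r::real. summable (\<lambda>m. cmod (qc m) * r ^ m)"
    and q_periodic: "\<And>x. q (x + 1) = q x"
begin

definition ysol :: "complex \<Rightarrow> complex \<Rightarrow> complex \<Rightarrow> real \<Rightarrow> complex" where
  "ysol c d l x = (\<Sum>m. hill_coeff qc c d l m * of_real x ^ m)"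

definition dysol :: "complex \<Rightarrow> complex \<Rightarrow> complex \<Rightarrow> real \<Rightarrow> complex" where
  "dysol c d l x = (\<Sum>m. diffs (hill_coeff qc c d l) m * of_real x ^ m)"

lemma rapid: "rapidly_decreasing (hill_coeff qc c d)"
  by (rule hill_coeff_rapidly_decreasing[OF qc_summable])

lemma rapid_diffs: "rapidly_decreasing (\<lambda>l. diffs (hill_coeff qc c d l))"
  by (rule rapidly_decreasing_diffs[OF rapid])

lemma ysol_sol: "hill_sol q l (ysol c d l) (dysol c d l)"
  unfolding hill_sol_def
proof (intro allI conjI)
  fix x
  let ?h = "hill_coeff qc c d l"
  show "(ysol c d l has_vector_derivative dysol c d l x) (at x)"
    unfolding ysol_def dysol_def
    by (rule has_vector_derivative_real_field
        [OF termdiffs_strong_converges_everywhere[OF rapidly_decreasing_summable[OF rapid]]])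
  have "(dysol c d l has_vector_derivative (\<Sum>m. diffs (diffs ?h) m * of_real x ^ m)) (at x)"
    unfolding dysol_def
    by (rule has_vector_derivative_real_field
        [OF termdiffs_strong_converges_everywhere[OF rapidly_decreasing_summable[OF rapid_diffs]]])
  moreover have "(\<lambda>m. diffs (diffs ?h) m * of_real x ^ m) sums ((q x - l) * ysol c d l x)"
  proof -
    have "summable (\<lambda>m. cmod (qc m * of_real x ^ m))"
      using qc_summable[of "\<bar>x\<bar>"] by (simp add: norm_mult norm_power)
    from Cauchy_product_sums[OF this rapidly_decreasing_summable_norm[OF rapid, of c d l "of_real x"]]
    have "(\<lambda>k. \<Sum>i\<le>k. qc i * of_real x ^ i * (?h (k - i) * of_real x ^ (k - i))) sums (q x * ysol c d l x)"
      using sums_unique[OF q_sums] by (simp add: ysol_def)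
    moreover have "(\<lambda>m. ?h m * of_real x ^ m) sums ysol c d l x"
      unfolding ysol_def by (rule summable_sums[OF rapidly_decreasing_summable[OF rapid]])
    ultimately have "(\<lambda>k. (\<Sum>i\<le>k. qc i * of_real x ^ i * (?h (k - i) * of_real x ^ (k - i))) - l * (?h k * of_real x ^ k))
        sums (q x * ysol c d l x - l * ysol c d l x)"
      by (intro sums_diff sums_mult)
    moreover have "diffs (diffs ?h) k * of_real x ^ k
       = (\<Sum>i\<le>k. qc i * of_real x ^ i * (?h (k - i) * of_real x ^ (k - i))) - l * (?h k * of_real x ^ k)" for k
    proof -
      have "(\<Sum>i\<le>k. qc i * of_real x ^ i * (?h (k - i) * of_real x ^ (k - i))) = (\<Sum>i\<le>k. qc i * ?h (k - i)) * of_real x ^ k"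
        unfolding sum_distrib_right
      proof (intro sum.cong refl)
        fix i assume "i \<in> {..k}"
        then have "(of_real x :: complex) ^ k = of_real x ^ i * of_real x ^ (k - i)" by (simp add: power_add[symmetric])
        then show "qc i * of_real x ^ i * (?h (k - i) * of_real x ^ (k - i)) = qc i * ?h (k - i) * of_real x ^ k"
          by simp
      qed
      moreover have "diffs (diffs ?h) k = (\<Sum>i\<le>k. qc i * ?h (k - i)) - l * ?h k"
        by (simp add: diffs_def del: of_nat_Suc)
      ultimately show ?thesis by (simp only: left_diff_distrib mult.assoc)
    qed
    ultimately show ?thesis by (simp only: left_diff_distrib)
  qed
  ultimately show "(dysol c d l has_vector_derivative (q x - l) * ysol c d l x) (at x)"
    by (simp add: sums_iff)
qed

lemma ysol_0 [simp]: "ysol c d l 0 = c" and dysol_0 [simp]: "dysol c d l 0 = d"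
  using powser_zero[of "hill_coeff qc c d l"] powser_zero[of "diffs (hill_coeff qc c d l)"]
  by (simp_all add: ysol_def dysol_def diffs_def)

lemma ysol_holomorphic: "(\<lambda>l. ysol c d l x) holomorphic_on UNIV"
  unfolding ysol_def by (rule rapidly_decreasing_holomorphic[OF rapid hill_coeff_holomorphic])

lemma diffs_hill_coeff_holomorphic: "(\<lambda>l. diffs (hill_coeff qc c d l) m) holomorphic_on UNIV"
  unfolding diffs_def by (intro holomorphic_intros hill_coeff_holomorphic)

lemma dysol_holomorphic: "(\<lambda>l. dysol c d l x) holomorphic_on UNIV"
  unfolding dysol_def by (rule rapidly_decreasing_holomorphic[OF rapid_diffs diffs_hill_coeff_holomorphic])

lemma ysol_continuous: "continuous_on UNIV (\<lambda>p. ysol c d (fst p) (snd p))"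
  unfolding ysol_def
  by (rule continuous_on_compose2[OF rapidly_decreasing_continuous[OF rapid
        holomorphic_on_imp_continuous_on[OF hill_coeff_holomorphic]], of _ "\<lambda>p. (fst p, of_real (snd p))", simplified])
     (auto intro!: continuous_intros)

lemma dysol_continuous: "continuous_on UNIV (\<lambda>p. dysol c d (fst p) (snd p))"
  unfolding dysol_def
  by (rule continuous_on_compose2[OF rapidly_decreasing_continuous[OF rapid_diffs
        holomorphic_on_imp_continuous_on[OF diffs_hill_coeff_holomorphic]], of _ "\<lambda>p. (fst p, of_real (snd p))", simplified])
     (auto intro!: continuous_intros)

lemma wronskian_const:
  assumes "hill_sol q l y dy" "hill_sol q l z dz"
  shows "y x * dz x - dy x * z x = y 0 * dz 0 - dy 0 * z 0"
proof -
  have "((\<lambda>x. y x * dz x - dy x * z x) has_vector_derivative 0) (at x)" for x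
    using assms unfolding hill_sol_def
    by (auto intro!: derivative_eq_intros simp: algebra_simps)
  then obtain c where "y x * dz x - dy x * z x = c" for x
    using has_vector_derivative_zero_constant[of UNIV "\<lambda>x. y x * dz x - dy x * z x"] by auto
  then show ?thesis by simp
qed

text \<open>The three constant Wronskians among \<open>y\<close> and the two fundamental solutions
  form a linear system of determinant 1, which gives uniqueness without a Gronwall estimate.\<close>

lemma hill_sol_unique:
  assumes "hill_sol q l y dy"
  shows "y x = y 0 * ysol 1 0 l x + dy 0 * ysol 0 1 l x"
    and "dy x = y 0 * dysol 1 0 l x + dy 0 * dysol 0 1 l x"
proof -
  let ?a = "ysol 1 0 l x" and ?b = "ysol 0 1 l x" and ?da = "dysol 1 0 l x" and ?db = "dysol 0 1 l x"
  have 1: "y x * ?db - dy x * ?b = y 0" using wronskian_const[OF assms ysol_sol, of x 0 1] by simp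
  have 2: "?a * dy x - ?da * y x = dy 0" using wronskian_const[OF ysol_sol assms, of 1 0 x] by simp
  have 3: "?a * ?db - ?da * ?b = 1" using wronskian_const[OF ysol_sol ysol_sol, of 1 0 l x 0 1] by simp
  have "y x = y x * (?a * ?db - ?da * ?b)" by (simp add: 3)
  also have "\<dots> = ?a * (y x * ?db - dy x * ?b) + ?b * (?a * dy x - ?da * y x)" by (simp add: algebra_simps)
  finally show "y x = y 0 * ?a + dy 0 * ?b" unfolding 1 2 by (simp add: algebra_simps)
  have "dy x = dy x * (?a * ?db - ?da * ?b)" by (simp add: 3)
  also have "\<dots> = ?da * (y x * ?db - dy x * ?b) + ?db * (?a * dy x - ?da * y x)" by (simp add: algebra_simps)
  finally show "dy x = y 0 * ?da + dy 0 * ?db" unfolding 1 2 by (simp add: algebra_simps)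
qed

lemma hill_sol_add:
  assumes "hill_sol q l y dy" "hill_sol q l z dz"
  shows "hill_sol q l (\<lambda>x. c * y x + d * z x) (\<lambda>x. c * dy x + d * dz x)"
  using assms unfolding hill_sol_def by (auto intro!: derivative_eq_intros simp: algebra_simps)

lemma hill_sol_shift:
  assumes "hill_sol q l y dy"
  shows "hill_sol q l (\<lambda>x. y (x + 1)) (\<lambda>x. dy (x + 1))"
proof -
  have *: "((\<lambda>x. f (x + 1)) has_vector_derivative f') (at x)"
    if "(f has_vector_derivative f') (at (x + 1))" for f :: "real \<Rightarrow> complex" and f' x
  proof -
    have "(f \<circ> (\<lambda>x. x + 1) has_vector_derivative 1 *\<^sub>R f') (at x)"
      by (rule vector_diff_chain_at) (use that in \<open>auto intro!: derivative_eq_intros\<close>)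
    then show ?thesis by (simp add: o_def)
  qed
  show ?thesis using assms unfolding hill_sol_def
  proof (intro allI conjI *)
    fix x
    assume "\<forall>x. (y has_vector_derivative dy x) (at x) \<and> (dy has_vector_derivative (q x - l) * y x) (at x)"
    then have "(dy has_vector_derivative (q (x + 1) - l) * y (x + 1)) (at (x + 1))" by blast
    then show "(dy has_vector_derivative (q x - l) * y (x + 1)) (at (x + 1))" by (simp add: q_periodic)
  qed auto
qed

lemma hill_solution_eq: "hill_solution q l c d = ysol c d l"
  unfolding hill_solution_def
proof (rule the_equality)
  show "\<exists>dy. (\<forall>x. (ysol c d l has_vector_derivative dy x) (at x) \<and>
          (dy has_vector_derivative (q x - l) * ysol c d l x) (at x)) \<and> ysol c d l 0 = c \<and> dy 0 = d"
    using ysol_sol[of l c d] unfolding hill_sol_def by (intro exI[of _ "dysol c d l"]) auto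
next
  fix y assume "\<exists>dy. (\<forall>x. (y has_vector_derivative dy x) (at x) \<and>
          (dy has_vector_derivative (q x - l) * y x) (at x)) \<and> y 0 = c \<and> dy 0 = d"
  then obtain dy where y: "hill_sol q l y dy" "y 0 = c" "dy 0 = d" unfolding hill_sol_def by auto
  show "y = ysol c d l"
  proof
    fix x
    have "ysol c d l x = c * ysol 1 0 l x + d * ysol 0 1 l x"
      using hill_sol_unique(1)[OF ysol_sol, of c d l x] unfolding ysol_0 dysol_0 .
    then show "y x = ysol c d l x" using hill_sol_unique(1)[OF y(1), of x] unfolding y by (rule trans[OF _ sym, rotated])
  qed
qed

definition "dtheta = dysol 1 0"
definition "dphi = dysol 0 1"

lemma theta_eq: "theta q = ysol 1 0" and phi_eq: "phi q = ysol 0 1"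
  by (simp_all add: theta_def phi_def hill_solution_eq fun_eq_iff)

lemmas sol_defs = theta_eq phi_eq dtheta_def dphi_def

lemma theta_sol: "hill_sol q l (theta q l) (dtheta l)" and phi_sol: "hill_sol q l (phi q l) (dphi l)"
  unfolding sol_defs by (rule ysol_sol)+

lemma init [simp]: "theta q l 0 = 1" "phi q l 0 = 0" "dtheta l 0 = 0" "dphi l 0 = 1"
  by (simp_all add: sol_defs)

lemma hill_sol_eq:
  assumes "hill_sol q l y dy"
  shows "y x = y 0 * theta q l x + dy 0 * phi q l x"
    and "dy x = y 0 * dtheta l x + dy 0 * dphi l x"
  unfolding sol_defs using hill_sol_unique[OF assms] .

lemma wronskian: "theta q l x * dphi l x - dtheta l x * phi q l x = 1"
  using wronskian_const[OF theta_sol phi_sol, of l x] by simp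

lemma hill_F_eq: "hill_F q l = theta q l 1 + dphi l 1"
proof -
  have "(phi q l has_vector_derivative dphi l 1) (at 1)"
    using phi_sol[of l] unfolding hill_sol_def by blast
  then show ?thesis unfolding hill_F_def by (simp add: vector_derivative_at)
qed

lemma sol_holomorphic [holomorphic_intros]:
  "(\<lambda>l. theta q l x) holomorphic_on S" "(\<lambda>l. phi q l x) holomorphic_on S"
  "(\<lambda>l. dtheta l x) holomorphic_on S" "(\<lambda>l. dphi l x) holomorphic_on S"
  unfolding sol_defs
  by (rule holomorphic_on_subset[OF ysol_holomorphic subset_UNIV] holomorphic_on_subset[OF dysol_holomorphic subset_UNIV])+

lemma hill_F_holomorphic [holomorphic_intros]: "hill_F q holomorphic_on S"
  unfolding hill_F_eq[abs_def] by (intro holomorphic_intros)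

lemma sol_continuous [continuous_intros]:
  assumes "continuous_on S f" "continuous_on S g"
  shows "continuous_on S (\<lambda>p. theta q (f p) (g p))" "continuous_on S (\<lambda>p. phi q (f p) (g p))"
    "continuous_on S (\<lambda>p. dtheta (f p) (g p))" "continuous_on S (\<lambda>p. dphi (f p) (g p))"
  unfolding sol_defs
  using continuous_on_compose2[OF ysol_continuous continuous_on_Pair[OF assms]]
    continuous_on_compose2[OF dysol_continuous continuous_on_Pair[OF assms]] by simp_all

lemma hill_F_continuous [continuous_intros]:
  assumes "continuous_on S f" shows "continuous_on S (\<lambda>p. hill_F q (f p))"
  unfolding hill_F_eq by (intro continuous_intros assms)

lemma floquet:
  assumes "hill_sol q l y dy" "y 1 = r * y 0" "dy 1 = r * dy 0"
  shows "y (x + 1) = r * y x"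
proof -
  have "y (x + 1) = y 1 * theta q l x + dy 1 * phi q l x"
    using hill_sol_eq(1)[OF hill_sol_shift[OF assms(1)], of x] by simp
  also have "\<dots> = r * (y 0 * theta q l x + dy 0 * phi q l x)" unfolding assms(2,3) by (simp add: algebra_simps)
  finally show ?thesis unfolding hill_sol_eq(1)[OF assms(1), of x, symmetric] .
qed

lemma q_continuous: "continuous_on S q"
proof -
  have "q = (\<lambda>x. \<Sum>m. qc m * of_real x ^ m)" using q_sums by (intro ext sums_unique)
  moreover have "((\<lambda>x. \<Sum>m. qc m * of_real x ^ m) has_vector_derivative (\<Sum>m. diffs qc m * of_real x ^ m)) (at x)" for x
  proof (rule has_vector_derivative_real_field[OF termdiffs_strong_converges_everywhere])
    show "summable (\<lambda>n. qc n * y ^ n)" for y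
      by (rule summable_norm_cancel) (use qc_summable[of "cmod y"] in \<open>simp add: norm_mult norm_power\<close>)
  qed
  ultimately have "(q has_vector_derivative (\<Sum>m. diffs qc m * of_real x ^ m)) (at x)" for x
    by (simp only:)
  then show ?thesis
    by (intro continuous_at_imp_continuous_on ballI has_vector_derivative_continuous)
qed

end

section \<open>Fourier analysis of Floquet solutions and the recurrence for their
  coefficients\<close>

section \<open>The Fejer kernel\<close>

text \<open>The squared modulus of a geometric sum is what later arises when two wave packets of
  \<open>N\<close> periods are paired. The mass over a period is \<open>2 * pi\<close>; for
  \<open>N = 0\<close> division by zero gives the value 0.\<close>

definition fejer :: "nat \<Rightarrow> real \<Rightarrow> real" where
  "fejer N s = (cmod (\<Sum>k<N. cis (real k * s)))\<^sup>2 / real N"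

lemma fejer_nonneg: "0 \<le> fejer N s"
  by (simp add: fejer_def)

lemma fejer_continuous [continuous_intros]:
  "continuous_on S f \<Longrightarrow> continuous_on S (\<lambda>x. fejer N (f x))"
  unfolding fejer_def divide_inverse by (intro continuous_intros)

lemma integral_cis_nat:
  fixes k :: int
  shows "((\<lambda>s. cis (of_int k * s)) has_integral (if k = 0 then 2 * of_real pi else 0)) {-pi..pi}"
proof (cases "k = 0")
  case True
  have "((\<lambda>s::real. 1 :: complex) has_integral (measure lborel {-pi..pi}) *\<^sub>R 1) {-pi..pi}"
    by (rule has_integral_const_real)
  then show ?thesis using True by (simp add: scaleR_conv_of_real)
next
  case False
  have "((\<lambda>s. cis (of_int k * s)) has_integral
      (cis (of_int k * pi) / (\<i> * of_int k) - cis (of_int k * (-pi)) / (\<i> * of_int k))) {-pi..pi}"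
  proof (rule fundamental_theorem_of_calculus)
    fix x :: real
    have "((\<lambda>z. exp (\<i> * of_int k * z) / (\<i> * of_int k)) has_field_derivative exp (\<i> * of_int k * of_real x)) (at (of_real x))"
      using False by (auto intro!: derivative_eq_intros)
    from has_vector_derivative_real_field[OF this]
    show "((\<lambda>x. cis (of_int k * x) / (\<i> * of_int k)) has_vector_derivative cis (of_int k * x)) (at x within {-pi..pi})"
      by (simp add: cis_conv_exp mult_ac has_vector_derivative_at_within)
  qed auto
  moreover have "cis (of_int k * pi) = cis (of_int k * (-pi))"
    by (simp add: complex_eq_iff sin_integer_2pi) (metis mult.commute sin_npi_int)
  ultimately show ?thesis using False by simp
qed

lemma fejer_expand: "of_real (real N * fejer N s) = (\<Sum>j<N. \<Sum>k<N. cis (of_int (int j - int k) * s))"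
proof (cases "N = 0")
  case False
  have "of_real (real N * fejer N s) = (\<Sum>j<N. cis (real j * s)) * cnj (\<Sum>k<N. cis (real k * s))"
    using False complex_norm_square[of "\<Sum>k<N. cis (real k * s)"] by (simp add: fejer_def)
  also have "\<dots> = (\<Sum>j<N. \<Sum>k<N. cis (real j * s) * cis (- (real k * s)))"
    by (simp add: sum_product cis_cnj)
  also have "\<dots> = (\<Sum>j<N. \<Sum>k<N. cis (of_int (int j - int k) * s))"
    by (simp add: cis_mult left_diff_distrib)
  finally show ?thesis .
qed auto

lemma fejer_integral:
  assumes "N > 0"
  shows "(fejer N has_integral 2 * pi) {-pi..pi}"
proof -
  have "((\<lambda>s. \<Sum>j<N. \<Sum>k<N. cis (of_int (int j - int k) * s)) has_integral
      (\<Sum>j<N. \<Sum>k<N. if int j - int k = 0 then 2 * of_real pi else 0)) {-pi..pi}"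
    by (intro has_integral_sum integral_cis_nat) auto
  also have "(\<Sum>j<N. \<Sum>k<N. if int j - int k = 0 then 2 * of_real pi else 0) = of_real (real N * (2 * pi))"
    by (simp add: sum.delta)
  finally have "((\<lambda>s. of_real (real N * fejer N s) :: complex) has_integral of_real (real N * (2 * pi))) {-pi..pi}"
    by (simp only: fejer_expand)
  from has_integral_linear[OF this bounded_linear_Re]
  have "((\<lambda>s. real N * fejer N s) has_integral real N * (2 * pi)) {-pi..pi}" by (simp add: o_def)
  from has_integral_mult_right[OF this, of "1 / real N"] assms show ?thesis by simp
qed

lemma norm_cis_minus_1: "(cmod (cis s - 1))\<^sup>2 = 2 - 2 * cos s"
proof -
  have "(cmod (cis s - 1))\<^sup>2 = (cos s)\<^sup>2 + (sin s)\<^sup>2 + 1 - 2 * cos s"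
    by (simp add: cmod_power2 power2_diff)
  then show ?thesis by simp
qed

lemma fejer_le:
  assumes "cos s \<noteq> 1"
  shows "fejer N s \<le> 4 / (real N * (2 - 2 * cos s))"
proof (cases "N = 0")
  case False
  have p: "0 < 2 - 2 * cos s" using assms cos_le_one[of s] by linarith
  have ne: "cis s \<noteq> 1" using assms by (metis cis.simps(1) one_complex.simps(1))
  have "(\<Sum>k<N. cis (real k * s)) = (\<Sum>k<N. cis s ^ k)" by (intro sum.cong refl) (simp only: Complex.DeMoivre)
  also have "\<dots> = (cis s ^ N - 1) / (cis s - 1)" using ne by (simp add: geometric_sum)
  finally have "(cmod (\<Sum>k<N. cis (real k * s)))\<^sup>2 = (cmod (cis s ^ N - 1))\<^sup>2 / (2 - 2 * cos s)"
    by (simp add: norm_divide power_divide norm_cis_minus_1)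
  also have "\<dots> \<le> 4 / (2 - 2 * cos s)"
  proof (intro divide_right_mono)
    have "cmod (cis s ^ N - 1) \<le> 2"
      using norm_triangle_ineq4[of "cis s ^ N" 1] by (simp add: norm_power)
    from power_mono[OF this, of 2] show "(cmod (cis s ^ N - 1))\<^sup>2 \<le> 4" by simp
  qed (use p in auto)
  finally have "fejer N s \<le> 4 / (2 - 2 * cos s) / real N"
    unfolding fejer_def by (intro divide_right_mono) auto
  then show ?thesis by (simp add: mult.commute)
qed (simp add: fejer_def)

text \<open>Besides integrability, \<open>h\<close> is only bounded and continuous at 0, because in
  one application it is a continuous function cut off to a subinterval.\<close>

lemma fejer_limit:
  fixes h :: "real \<Rightarrow> complex"
  assumes int: "\<And>N. (\<lambda>s. of_real (fejer N s) * h s) integrable_on {-pi..pi}"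
    and cont: "isCont h 0"
    and bdd: "\<And>s. s \<in> {-pi..pi} \<Longrightarrow> cmod (h s) \<le> B"
  shows "(\<lambda>N. integral {-pi..pi} (\<lambda>s. of_real (fejer N s) * h s)) \<longlonglongrightarrow> 2 * of_real pi * h 0"
proof (rule LIMSEQ_I)
  fix e :: real assume e: "0 < e"
  have B: "0 \<le> B" using bdd[of 0] norm_ge_zero[of "h 0"] by (simp add: order_trans[OF norm_ge_zero])
  \<comment> \<open>The mass \<open>2 * pi\<close> of the kernel turns \<open>e'\<close> into
    \<open>e / 2\<close>.\<close>
  define e' where "e' = e / (4 * pi)"
  have e': "0 < e'" using e by (simp add: e'_def)
  obtain d0 where d0: "d0 > 0" "\<And>s. \<bar>s\<bar> < d0 \<Longrightarrow> cmod (h s - h 0) < e'"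
    using cont e' unfolding continuous_at_eps_delta by (metis abs_minus_cancel diff_zero dist_norm dist_real_def minus_diff_eq)
  define d where "d = min d0 pi"
  have d: "0 < d" "d \<le> pi" using d0 by (auto simp: d_def)
  define m where "m = 2 - 2 * cos d"
  have m: "0 < m" using cos_monotone_0_pi[of 0 d] d by (auto simp: m_def)
  define K where "K = 8 * B / m"
  have K: "0 \<le> K" using B m by (auto simp: K_def)
  \<comment> \<open>Near 0 the continuity of \<open>h\<close> gives the first summand; away from 0
    the kernel is of order \<open>1 / N\<close>, which gives the second. Their sum holds everywhere
    and can be integrated at once.\<close>
  have pw: "cmod (of_real (fejer N s) * (h s - h 0)) \<le> e' * fejer N s + K / real N"
    if s: "s \<in> {-pi..pi}" and N: "N > 0" for N s
  proof (cases "\<bar>s\<bar> < d")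
    case True
    then have "cmod (h s - h 0) \<le> e'" using d0(2)[of s] by (auto simp: d_def)
    then have "fejer N s * cmod (h s - h 0) \<le> fejer N s * e'" by (intro mult_left_mono fejer_nonneg)
    moreover have "0 \<le> K / real N" using K by auto
    ultimately show ?thesis using fejer_nonneg[of N s] by (simp add: norm_mult mult.commute)
  next
    case False
    then have "cos \<bar>s\<bar> \<le> cos d" using s d by (intro cos_monotone_0_pi_le) auto
    then have ms: "m \<le> 2 - 2 * cos s" by (simp add: m_def)
    have "fejer N s \<le> 4 / (real N * (2 - 2 * cos s))" using ms m by (intro fejer_le) auto
    also have "\<dots> \<le> 4 / (real N * m)" using ms m N by (intro divide_left_mono mult_left_mono mult_pos_pos) auto
    finally have f: "fejer N s \<le> 4 / (real N * m)" .
    have "cmod (h s - h 0) \<le> 2 * B" using norm_triangle_ineq4[of "h s" "h 0"] bdd[OF s] bdd[of 0] by auto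
    then have "fejer N s * cmod (h s - h 0) \<le> 4 / (real N * m) * (2 * B)"
      using f fejer_nonneg m N B by (intro mult_mono) auto
    also have "\<dots> = K / real N" by (simp add: K_def)
    finally show ?thesis using fejer_nonneg[of N s] e' by (simp add: norm_mult add_increasing)
  qed
  obtain N0 where N0: "2 * pi * K / (e/4) < real N0" using reals_Archimedean2 by blast
  show "\<exists>no. \<forall>N\<ge>no. norm (integral {-pi..pi} (\<lambda>s. of_real (fejer N s) * h s) - 2 * of_real pi * h 0) < e"
  proof (intro exI allI impI)
    fix N assume N: "max N0 1 \<le> N"
    then have Np: "N > 0" by auto
    have c: "((\<lambda>s. of_real (fejer N s) * h 0) has_integral 2 * of_real pi * h 0) {-pi..pi}"
    proof -
      have "((\<lambda>s. of_real (fejer N s) :: complex) has_integral of_real (2 * pi)) {-pi..pi}"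
        using has_integral_linear[OF fejer_integral[OF Np] bounded_linear_of_real] by (simp add: o_def)
      from has_integral_mult_left[OF this, of "h 0"] show ?thesis by simp
    qed
    have "((\<lambda>s. of_real (fejer N s) * h s - of_real (fejer N s) * h 0) has_integral
       (integral {-pi..pi} (\<lambda>s. of_real (fejer N s) * h s) - 2 * of_real pi * h 0)) {-pi..pi}"
      by (intro has_integral_diff integrable_integral int c)
    then have I: "((\<lambda>s. of_real (fejer N s) * (h s - h 0)) has_integral
       (integral {-pi..pi} (\<lambda>s. of_real (fejer N s) * h s) - 2 * of_real pi * h 0)) {-pi..pi}"
      by (simp only: right_diff_distrib)
    have J: "((\<lambda>s. e' * fejer N s + K / real N) has_integral (e' * (2 * pi) + measure lborel {-pi..pi} *\<^sub>R (K / real N))) {-pi..pi}"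
      by (intro has_integral_add has_integral_mult_right fejer_integral Np has_integral_const_real)
    have "norm (integral {-pi..pi} (\<lambda>s. of_real (fejer N s) * h s) - 2 * of_real pi * h 0)
        \<le> e' * (2 * pi) + measure lborel {-pi..pi} *\<^sub>R (K / real N)"
      using integral_norm_bound_integral[OF has_integral_integrable[OF I] has_integral_integrable[OF J]] pw[OF _ Np]
      by (simp add: integral_unique[OF I] integral_unique[OF J])
    also have "\<dots> = e / 2 + 2 * pi * K / real N" by (simp add: e'_def)
    also have "\<dots> < e / 2 + e / 2"
    proof -
      have "2 * pi * K / (e/4) < real N" using N0 N by auto
      then have "2 * pi * K \<le> real N * (e/4)" using e by (simp add: divide_less_eq)
      then have "2 * pi * K / real N \<le> e/4" using Np by (simp add: divide_le_eq mult.commute)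
      then show ?thesis using e by simp
    qed
    finally show "norm (integral {-pi..pi} (\<lambda>s. of_real (fejer N s) * h s) - 2 * of_real pi * h 0) < e" by simp
  qed
qed

section \<open>Completeness of the exponentials\<close>

lemma integral_periodic:
  fixes g :: "real \<Rightarrow> complex"
  assumes cont: "continuous_on UNIV g" and per: "\<And>x. g (x + 1) = g x" and c: "0 \<le> c" "c \<le> 1"
  shows "integral {c..c+1} g = integral {0..1} g"
proof -
  have int: "g integrable_on {u..v}" for u v
    by (rule integrable_continuous_real[OF continuous_on_subset[OF cont]]) auto
  have "integral {0..c} g = integral {0+1..c+1} g"
    using integral_shift_Icc_real[of 0 c g 1] per by (simp add: o_def add.commute)
  moreover have "integral {c..1} g + integral {1..c+1} g = integral {c..c+1} g"
    using c by (intro Henstock_Kurzweil_Integration.integral_combine int) auto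
  moreover have "integral {0..c} g + integral {c..1} g = integral {0..1} g"
    using c by (intro Henstock_Kurzweil_Integration.integral_combine int) auto
  ultimately show ?thesis by (simp add: add.commute)
qed

text \<open>Tested against a Fejer kernel centred at \<open>x0\<close>, a trigonometric polynomial,
  \<open>p\<close> gives 0, while the limit of these integrals is \<open>2 * pi * p x0\<close>. The
  range of \<open>x0\<close> places the left end \<open>x0 - 1/2\<close> of the period window in
  \<open>{0..1}\<close>.\<close>

lemma fourier_complete_aux:
  fixes p :: "real \<Rightarrow> complex"
  assumes cont: "continuous_on UNIV p" and per: "\<And>x. p (x + 1) = p x"
    and zero: "\<And>k::int. integral {0..1} (\<lambda>x. p x * cis (2 * pi * of_int k * x)) = 0"
    and x0: "1/2 \<le> x0" "x0 \<le> 3/2"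
  shows "p x0 = 0"
proof -
  define h where "h s = p (s / (2 * pi) + x0)" for s
  have conth: "continuous_on UNIV h"
    unfolding h_def by (intro continuous_on_compose2[OF cont] continuous_intros) auto
  have coeff: "((\<lambda>s. cis (of_int k * s) * h s) has_integral 0) {-pi..pi}" for k :: int
  proof -
    let ?g = "\<lambda>x. p x * cis (2 * pi * of_int k * x)"
    have per': "?g (x + 1) = ?g x" for x
    proof -
      have "2 * pi * of_int k * (x + 1) = 2 * pi * of_int k * x + 2 * pi * of_int k" by (simp add: algebra_simps)
      moreover have "cis (2 * pi * of_int k) = 1" by (rule cis_multiple_2pi) auto
      ultimately show ?thesis by (simp add: per cis_mult[symmetric])
    qed
    have c: "continuous_on UNIV ?g" by (intro continuous_intros cont)
    have "integral {x0 - 1/2..x0 - 1/2 + 1} ?g = 0"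
      using integral_periodic[OF c per', of "x0 - 1/2"] x0 zero[of k] by (simp add: algebra_simps)
    then have "integral {x0 - 1/2..x0 + 1/2} ?g = 0" by (simp add: algebra_simps)
    moreover have "?g integrable_on {x0 - 1/2..x0 + 1/2}"
      by (rule integrable_continuous_real[OF continuous_on_subset[OF c]]) auto
    ultimately have "(?g has_integral 0) (cbox (x0 - 1/2) (x0 + 1/2))"
      by (simp add: has_integral_iff)
    from has_integral_affinity'[OF this, of "1 / (2 * pi)" x0]
    have "((\<lambda>s. h s * cis (2 * pi * of_int k * (s / (2 * pi) + x0))) has_integral 0) {-pi..pi}"
      by (simp add: h_def)
    from has_integral_mult_right[OF this, of "cis (- (2 * pi * of_int k * x0))"]
    have "((\<lambda>s. cis (- (2 * pi * of_int k * x0)) * (h s * cis (2 * pi * of_int k * (s / (2 * pi) + x0)))) has_integral 0) {-pi..pi}"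
      by simp
    moreover have "cis (- (2 * pi * of_int k * x0)) * (h s * cis (2 * pi * of_int k * (s / (2 * pi) + x0)))
       = cis (of_int k * s) * h s" for s
    proof -
      have "cis (- (2 * pi * of_int k * x0)) * cis (2 * pi * of_int k * (s / (2 * pi) + x0)) = cis (of_int k * s)"
        by (simp add: cis_mult field_simps)
      then show ?thesis by (metis mult.commute mult.left_commute)
    qed
    ultimately show ?thesis by simp
  qed
  have zero': "integral {-pi..pi} (\<lambda>s. of_real (fejer N s) * h s) = 0" for N
  proof (cases "N = 0")
    case False
    have "((\<lambda>s. \<Sum>j<N. \<Sum>k<N. cis (of_int (int j - int k) * s) * h s) has_integral (\<Sum>j<N. \<Sum>k<N. 0)) {-pi..pi}"
      by (intro has_integral_sum coeff) auto
    then have "((\<lambda>s. of_real (real N * fejer N s) * h s) has_integral 0) {-pi..pi}"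
      by (simp only: fejer_expand sum_distrib_right) simp
    from has_integral_mult_right[OF this, of "1 / of_nat N"] False show ?thesis
      by (simp add: has_integral_iff)
  qed (simp add: fejer_def)
  have "compact (h ` {-pi..pi})"
    by (intro compact_continuous_image continuous_on_subset[OF conth]) auto
  then obtain B where B: "\<And>s. s \<in> {-pi..pi} \<Longrightarrow> cmod (h s) \<le> B"
    by (meson bounded_iff compact_imp_bounded image_eqI)
  have "(\<lambda>N. integral {-pi..pi} (\<lambda>s. of_real (fejer N s) * h s)) \<longlonglongrightarrow> 2 * of_real pi * h 0"
  proof (rule fejer_limit[OF _ _ B])
    show "(\<lambda>s. of_real (fejer N s) * h s) integrable_on {-pi..pi}" for N
      by (intro integrable_continuous_real continuous_intros continuous_on_subset[OF conth]) auto
    show "isCont h 0" using conth continuous_on_eq_continuous_at by blast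
  qed
  then have "2 * of_real pi * h 0 = 0" unfolding zero' by (simp add: LIMSEQ_const_iff)
  then show ?thesis by (simp add: h_def)
qed

lemma fourier_complete:
  fixes p :: "real \<Rightarrow> complex"
  assumes cont: "continuous_on UNIV p" and per: "\<And>x. p (x + 1) = p x"
    and zero: "\<And>k::int. integral {0..1} (\<lambda>x. p x * cis (2 * pi * of_int k * x)) = 0"
    and x: "x \<in> {0..1}"
  shows "p x = 0"
proof (cases "x \<ge> 1/2")
  case True
  then show ?thesis using fourier_complete_aux[OF assms(1-3), of x] x by simp
next
  case False
  then show ?thesis using fourier_complete_aux[OF assms(1-3), of "x + 1"] x per[of x] by simp
qed

section \<open>Fourier coefficients of Floquet solutions\<close>

text \<open>The Mathieu equation for a series in the exponentials of frequency
  \<open>2 pi k + t\<close>, compared coefficientwise. The quasimomentum \<open>t\<close> is complex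
  so that every \<open>l\<close> is covered.\<close>

definition floquet_rec :: "complex \<Rightarrow> complex \<Rightarrow> complex \<Rightarrow> complex \<Rightarrow> (int \<Rightarrow> complex) \<Rightarrow> bool" where
  "floquet_rec a b l t c \<longleftrightarrow>
     (\<forall>k. (l - (2 * of_real pi * of_int k + t)\<^sup>2) * c k = a * c (k + 1) + b * c (k - 1))"

text \<open>Beyond \<open>K0\<close> the diagonal factor is at least
  \<open>(cmod a + cmod b) * R\<close>, so a coefficient is at most \<open>1 / R\<close> times the
  common bound of its neighbours, and these lie at most one step nearer to the origin.\<close>

lemma floquet_rec_decay:
  assumes rec: "floquet_rec a b l t c" and bdd: "\<And>k. cmod (c k) \<le> B" and R: "1 \<le> R" and a: "a \<noteq> 0"
  obtains C where "\<And>k. cmod (c k) * R ^ nat \<bar>k\<bar> \<le> C"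
proof -
  let ?A = "cmod a + cmod b"
  let ?w = "\<lambda>k::int. 2 * of_real pi * of_int k + t"
  \<comment> \<open>For \<open>\<bar>k\<bar> \<ge> K0\<close> the frequency has modulus at least
    \<open>\<bar>k\<bar> \<ge> 1\<close>, hence its square also has modulus at least
    \<open>\<bar>k\<bar>\<close>; this linear growth already dominates \<open>cmod l\<close> and the
    required bound.\<close>
  obtain K0 :: nat where K0: "cmod t + cmod l + ?A * R + 1 \<le> real K0" using real_arch_simple by blast
  have B: "0 \<le> B" using bdd[of 0] norm_ge_zero order_trans by blast
  have AR: "0 \<le> ?A * R" using R by auto
  have big: "?A * R \<le> cmod (l - (?w k)\<^sup>2)" if k: "int K0 \<le> \<bar>k\<bar>" for k
  proof -
    have kk: "real K0 \<le> real_of_int \<bar>k\<bar>" using k by linarith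
    have k1: "1 \<le> real_of_int \<bar>k\<bar>" using kk K0 AR norm_ge_zero[of t] norm_ge_zero[of l] by linarith
    have "2 * pi * real_of_int \<bar>k\<bar> - cmod t \<le> cmod (?w k)"
      using norm_triangle_ineq2[of "2 * of_real pi * of_int k" "- t"] by (simp add: norm_mult)
    moreover have "2 * real_of_int \<bar>k\<bar> \<le> 2 * pi * real_of_int \<bar>k\<bar>"
      using k1 pi_gt3 by (intro mult_right_mono) auto
    ultimately have w: "real_of_int \<bar>k\<bar> \<le> cmod (?w k)"
      using K0 kk AR norm_ge_zero[of l] by linarith
    have "real_of_int \<bar>k\<bar> \<le> real_of_int \<bar>k\<bar> * real_of_int \<bar>k\<bar>"
      using mult_right_mono[OF k1, of "real_of_int \<bar>k\<bar>"] by (simp only: mult_1)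
    also have "\<dots> \<le> cmod (?w k) * cmod (?w k)" using w k1 by (intro mult_mono) auto
    finally have "real K0 \<le> cmod ((?w k)\<^sup>2)" using kk by (simp add: norm_power power2_eq_square norm_mult)
    moreover have "cmod ((?w k)\<^sup>2) - cmod l \<le> cmod (l - (?w k)\<^sup>2)"
      using norm_triangle_ineq2[of "(?w k)\<^sup>2" l] by (simp add: norm_minus_commute)
    ultimately show ?thesis using K0 norm_ge_zero[of t] by linarith
  qed
  have dec: "int (K0 + j) \<le> \<bar>k\<bar> \<Longrightarrow> cmod (c k) * R ^ j \<le> B" for j k
  proof (induction j arbitrary: k)
    case 0
    then show ?case using bdd by simp
  next
    case (Suc j)
    show ?case
    proof -
      have A: "0 < ?A" using a by (simp add: add_pos_nonneg)
      have "int (K0 + j) \<le> \<bar>k + 1\<bar>" "int (K0 + j) \<le> \<bar>k - 1\<bar>" using Suc.prems by linarith+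
      then have IH: "cmod (c (k + 1)) * R ^ j \<le> B" "cmod (c (k - 1)) * R ^ j \<le> B" using Suc.IH by auto
      have "?A * R * cmod (c k) \<le> cmod (l - (?w k)\<^sup>2) * cmod (c k)"
        using Suc.prems by (intro mult_right_mono big) auto
      also have "\<dots> = cmod (a * c (k + 1) + b * c (k - 1))"
        using rec unfolding floquet_rec_def by (metis norm_mult)
      also have "\<dots> \<le> cmod a * cmod (c (k + 1)) + cmod b * cmod (c (k - 1))"
        by (metis norm_mult norm_triangle_ineq)
      finally have "?A * R * cmod (c k) * R ^ j \<le> (cmod a * cmod (c (k + 1)) + cmod b * cmod (c (k - 1))) * R ^ j"
        using R by (intro mult_right_mono) auto
      also have "\<dots> = cmod a * (cmod (c (k + 1)) * R ^ j) + cmod b * (cmod (c (k - 1)) * R ^ j)"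
        by (simp add: algebra_simps)
      also have "\<dots> \<le> cmod a * B + cmod b * B" by (intro add_mono mult_left_mono IH) auto
      finally have "?A * (cmod (c k) * R ^ Suc j) \<le> ?A * B" by (simp add: algebra_simps)
      then show ?thesis using A by simp
    qed
  qed
  show thesis
  proof (rule that)
    fix k
    show "cmod (c k) * R ^ nat \<bar>k\<bar> \<le> B * R ^ K0"
    proof (cases "int K0 \<le> \<bar>k\<bar>")
      case True
      define j where "j = nat \<bar>k\<bar> - K0"
      have j: "nat \<bar>k\<bar> = j + K0" using True by (simp add: j_def)
      have "cmod (c k) * R ^ j \<le> B" using True by (intro dec) (simp add: j_def)
      then have "cmod (c k) * R ^ j * R ^ K0 \<le> B * R ^ K0" using R by (intro mult_right_mono) auto
      then show ?thesis by (simp add: j power_add mult.assoc)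
    next
      case False
      then have "R ^ nat \<bar>k\<bar> \<le> R ^ K0" using R by (intro power_increasing) auto
      then show ?thesis using bdd[of k] R B by (intro mult_mono) auto
    qed
  qed
qed

lemma decaying_attains_max:
  fixes c :: "int \<Rightarrow> complex"
  assumes dec: "\<And>k. cmod (c k) * 2 ^ nat \<bar>k\<bar> \<le> C"
  obtains n where "\<And>k. cmod (c k) \<le> cmod (c n)"
proof (cases "\<exists>m. c m \<noteq> 0")
  case True
  then obtain m where m: "c m \<noteq> 0" by blast
  obtain K where K: "C / cmod (c m) < 2 ^ K"
    using real_arch_pow[of 2 "C / cmod (c m)"] by auto
  define S where "S = insert m {- int K..int K}"
  have "finite S" "S \<noteq> {}" by (auto simp: S_def)
  then obtain n where n: "n \<in> S" "\<And>k. k \<in> S \<Longrightarrow> cmod (c k) \<le> cmod (c n)"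
    using obtains_MAX[of S "\<lambda>k. cmod (c k)"] Max_ge[of "(\<lambda>k. cmod (c k)) ` S"]
    by (metis finite_imageI imageI)
  show thesis
  proof (rule that)
    fix k
    show "cmod (c k) \<le> cmod (c n)"
    proof (cases "k \<in> S")
      case False
      then have "K \<le> nat \<bar>k\<bar>" by (auto simp: S_def)
      then have "(2::real) ^ K \<le> 2 ^ nat \<bar>k\<bar>" by (intro power_increasing) auto
      then have "cmod (c k) * 2 ^ K \<le> C" using dec[of k] by (meson mult_left_mono norm_ge_zero order_trans)
      also have "C \<le> cmod (c m) * 2 ^ K" using K m by (simp add: divide_less_eq mult.commute less_imp_le)
      finally have "cmod (c k) \<le> cmod (c m)" by simp
      also have "\<dots> \<le> cmod (c n)" using n(2)[of m] by (simp add: S_def)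
      finally show ?thesis .
    qed (use n in auto)
  qed
qed (use that[of 0] in auto)

text \<open>A Gershgorin estimate: in the row of the largest coefficient the neighbours are no
  larger.\<close>

lemma floquet_rec_frequency:
  assumes rec: "floquet_rec a b l t c" and max: "\<And>k. cmod (c k) \<le> cmod (c n)" and nz: "c n \<noteq> 0"
  shows "cmod (l - (2 * of_real pi * of_int n + t)\<^sup>2) \<le> cmod a + cmod b"
proof -
  have "cmod (l - (2 * of_real pi * of_int n + t)\<^sup>2) * cmod (c n) = cmod (a * c (n + 1) + b * c (n - 1))"
    using rec unfolding floquet_rec_def by (metis norm_mult)
  also have "\<dots> \<le> cmod a * cmod (c (n + 1)) + cmod b * cmod (c (n - 1))"
    by (metis norm_mult norm_triangle_ineq)
  also have "\<dots> \<le> cmod a * cmod (c n) + cmod b * cmod (c n)"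
    by (intro add_mono mult_left_mono max) auto
  finally show ?thesis using nz by (simp add: distrib_right[symmetric])
qed

definition mathieu_potential :: "complex \<Rightarrow> complex \<Rightarrow> real \<Rightarrow> complex" where
  "mathieu_potential a b x = a * exp (- \<i> * 2 * of_real pi * of_real x) + b * exp (\<i> * 2 * of_real pi * of_real x)"

definition mathieu_coeff :: "complex \<Rightarrow> complex \<Rightarrow> nat \<Rightarrow> complex" where
  "mathieu_coeff a b m = a * ((- \<i> * 2 * of_real pi) ^ m / fact m) + b * ((\<i> * 2 * of_real pi) ^ m / fact m)"

interpretation mathieu: hill_potential "mathieu_potential a b" "mathieu_coeff a b" for a b
proof
  fix x :: real
  have e: "(\<lambda>m. (z ^ m / fact m) * of_real x ^ m) sums exp (z * of_real x)" for z :: complex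
    using exp_converges[of "z * of_real x"] by (simp add: power_mult_distrib scaleR_conv_of_real divide_inverse mult_ac)
  have "(\<lambda>m. a * (((- \<i> * 2 * of_real pi) ^ m / fact m) * of_real x ^ m) + b * (((\<i> * 2 * of_real pi) ^ m / fact m) * of_real x ^ m))
      sums (a * exp ((- \<i> * 2 * of_real pi) * of_real x) + b * exp ((\<i> * 2 * of_real pi) * of_real x))"
    by (intro sums_add sums_mult e)
  then show "(\<lambda>m. mathieu_coeff a b m * of_real x ^ m) sums mathieu_potential a b x"
    by (simp add: mathieu_coeff_def mathieu_potential_def algebra_simps)
next
  fix r :: real
  have "summable (\<lambda>m. (cmod a + cmod b) * (inverse (fact m) * (2 * pi * \<bar>r\<bar>) ^ m))"
    by (intro summable_mult summable_exp)
  then show "summable (\<lambda>m. cmod (mathieu_coeff a b m) * r ^ m)"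
  proof (rule summable_comparison_test'[where N = 0])
    fix m :: nat
    have "cmod (mathieu_coeff a b m) \<le> (cmod a + cmod b) * ((2 * pi) ^ m / fact m)"
      unfolding mathieu_coeff_def
      by (rule order_trans[OF norm_triangle_ineq]) (simp add: norm_mult norm_divide norm_power distrib_right add_divide_distrib)
    then have "cmod (mathieu_coeff a b m) * \<bar>r\<bar> ^ m \<le> ((cmod a + cmod b) * ((2 * pi) ^ m / fact m)) * \<bar>r\<bar> ^ m"
      by (rule mult_right_mono) simp
    also have "\<dots> = (cmod a + cmod b) * (inverse (fact m) * (2 * pi * \<bar>r\<bar>) ^ m)"
      unfolding power_mult_distrib divide_inverse by (simp only: mult_ac)
    finally show "norm (cmod (mathieu_coeff a b m) * r ^ m) \<le> (cmod a + cmod b) * (inverse (fact m) * (2 * pi * \<bar>r\<bar>) ^ m)"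
      by (simp add: abs_mult power_abs)
  qed
next
  fix x :: real
  have "exp (\<i> * 2 * of_real pi * of_real (x + 1)) = exp (\<i> * 2 * of_real pi * of_real x) * exp (2 * of_real pi * \<i>)"
    unfolding exp_add[symmetric] by (rule arg_cong[of _ _ exp]) (simp add: algebra_simps)
  moreover have "exp (- \<i> * 2 * of_real pi * of_real (x + 1)) = exp (- \<i> * 2 * of_real pi * of_real x) * exp (- (2 * of_real pi * \<i>))"
    unfolding exp_add[symmetric] by (rule arg_cong[of _ _ exp]) (simp add: algebra_simps)
  ultimately show "mathieu_potential a b (x + 1) = mathieu_potential a b x"
    by (simp only: mathieu_potential_def exp_minus exp_two_pi_i inverse_1 mult_1_right)
qed

text \<open>Explicit eigenvectors of the monodromy matrix \<open>M\<close>: each of the two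
  candidates annihilates one row of \<open>M - r\<close> by its form and the other row by the
  determinant. If both candidates are zero, \<open>M\<close> is \<open>r\<close> times the
  identity.\<close>

lemma (in hill_potential) floquet_solution_exists:
  assumes r: "r\<^sup>2 - hill_F q l * r + 1 = 0"
  obtains y dy where "hill_sol q l y dy" "y 1 = r * y 0" "dy 1 = r * dy 0" "y 0 \<noteq> 0 \<or> dy 0 \<noteq> 0"
proof -
  let ?th = "theta q l 1" and ?ph = "phi q l 1" and ?dth = "dtheta l 1" and ?dph = "dphi l 1"
  have W: "?th * ?dph - ?dth * ?ph = 1" by (rule wronskian)
  have r': "r * r = (?th + ?dph) * r - 1" using r unfolding hill_F_eq power2_eq_square by algebra
  obtain A B where AB: "A \<noteq> 0 \<or> B \<noteq> 0" "A * ?th + B * ?ph = r * A" "A * ?dth + B * ?dph = r * B"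
  proof (cases "?ph = 0 \<and> r = ?th")
    case False
    show thesis
    proof (rule that[of ?ph "r - ?th"])
      show "?ph * ?dth + (r - ?th) * ?dph = r * (r - ?th)" using W r' by algebra
    qed (use False in \<open>auto simp: algebra_simps\<close>)
  next
    case True
    show thesis
    proof (cases "?dth = 0 \<and> r = ?dph")
      case False
      show thesis
      proof (rule that[of "r - ?dph" ?dth])
        show "(r - ?dph) * ?th + ?dth * ?ph = r * (r - ?dph)" using W r' by algebra
      qed (use False in \<open>auto simp: algebra_simps\<close>)
    qed (rule that[of 1 0], use True in auto)
  qed
  let ?y = "\<lambda>x. A * theta q l x + B * phi q l x" and ?dy = "\<lambda>x. A * dtheta l x + B * dphi l x"
  show thesis
    by (rule that[of ?y ?dy]) (use AB hill_sol_add[OF theta_sol phi_sol] in auto)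
qed

lemma (in hill_potential) hill_sol_continuous:
  assumes "hill_sol q l y dy"
  shows "continuous_on S y" "continuous_on S dy"
  using assms unfolding hill_sol_def
  by (auto intro!: continuous_at_imp_continuous_on intro: has_vector_derivative_continuous)

lemma (in hill_potential) hill_sol_nonzero:
  assumes "hill_sol q l y dy" "y 0 \<noteq> 0 \<or> dy 0 \<noteq> 0"
  shows "\<exists>x\<in>{0..1}. y x \<noteq> 0"
proof (rule ccontr)
  assume "\<not> ?thesis"
  then have z: "y x = 0" if "x \<in> {0..1}" for x using that by blast
  have "(y has_vector_derivative dy 0) (at 0 within {0..1})"
    using assms(1) unfolding hill_sol_def by (meson has_vector_derivative_at_within)
  then have "((\<lambda>x. 0) has_vector_derivative dy 0) (at 0 within {0..1})"
    by (rule has_vector_derivative_transform[rotated 2]) (use z in auto)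
  then have "dy 0 = 0"
    using vector_derivative_unique_within[of "0::real" "{0..1}" "\<lambda>x. 0" "dy 0" 0]
    by (simp add: at_within_Icc_at_right)
  then show False using assms(2) z[of 0] by simp
qed

definition fourier_coeff :: "complex \<Rightarrow> (real \<Rightarrow> complex) \<Rightarrow> int \<Rightarrow> complex" where
  "fourier_coeff t y k = integral {0..1} (\<lambda>x. y x * exp (- \<i> * (2 * of_real pi * of_int k + t) * of_real x))"

lemma fourier_coeff_bounded:
  assumes cont: "continuous_on {0..1} y"
  obtains B where "\<And>k. cmod (fourier_coeff t y k) \<le> B"
proof -
  obtain B where B: "\<And>x. x \<in> {0..1} \<Longrightarrow> cmod (y x) \<le> B"
    using compact_imp_bounded[OF compact_continuous_image[OF cont compact_Icc]]
    by (meson bounded_iff image_eqI)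
  have B0: "0 \<le> B" using order_trans[OF norm_ge_zero B[of 0]] by simp
  have "cmod (fourier_coeff t y k) \<le> B * exp \<bar>Im t\<bar>" for k
  proof -
    have "norm (integral {0..1} (\<lambda>x. y x * exp (- \<i> * (2 * of_real pi * of_int k + t) * of_real x))) \<le> (B * exp \<bar>Im t\<bar>) * (1 - 0)"
    proof (rule integral_bound)
      fix x :: real assume x: "x \<in> {0..1}"
      have "Re (- \<i> * (2 * of_real pi * of_int k + t) * of_real x) = Im t * x" by simp
      also have "\<dots> \<le> \<bar>Im t\<bar> * 1" using x by (intro mult_mono) auto
      finally have "cmod (exp (- \<i> * (2 * of_real pi * of_int k + t) * of_real x)) \<le> exp \<bar>Im t\<bar>"
        by (simp add: norm_exp_eq_Re)
      then show "norm (y x * exp (- \<i> * (2 * of_real pi * of_int k + t) * of_real x)) \<le> B * exp \<bar>Im t\<bar>"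
        unfolding norm_mult using B[OF x] B0 by (intro mult_mono) auto
    qed (auto intro!: continuous_intros cont)
    then show ?thesis by (simp add: fourier_coeff_def)
  qed
  then show thesis by (rule that)
qed

lemma exp_frequency_shift:
  "exp (- \<i> * (2 * of_real pi * of_int (k + 1) + t) * of_real x)
     = exp (- \<i> * 2 * of_real pi * of_real x) * exp (- \<i> * (2 * of_real pi * of_int k + t) * of_real x)"
  "exp (- \<i> * (2 * of_real pi * of_int (k - 1) + t) * of_real x)
     = exp (\<i> * 2 * of_real pi * of_real x) * exp (- \<i> * (2 * of_real pi * of_int k + t) * of_real x)"
  unfolding exp_add[symmetric] by (rule arg_cong[of _ _ exp], simp add: algebra_simps)+

lemma exp_frequency_period:
  "exp (- \<i> * (2 * of_real pi * of_int k + t)) = exp (- \<i> * t)"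
proof -
  have "exp (- \<i> * (2 * of_real pi * of_int k + t)) = exp (- \<i> * t) * cis (2 * pi * of_int (- k))"
    unfolding cis_conv_exp exp_add[symmetric] by (rule arg_cong[of _ _ exp]) (simp add: algebra_simps)
  moreover have "cis (2 * pi * of_int (- k)) = 1" by (rule cis_multiple_2pi) auto
  ultimately show ?thesis by simp
qed

lemma mathieu_fourier_rec:
  assumes sol: "hill_sol (mathieu_potential a b) l y dy"
    and fl: "y 1 = exp (\<i> * t) * y 0" "dy 1 = exp (\<i> * t) * dy 0"
  shows "floquet_rec a b l t (fourier_coeff t y)"
  unfolding floquet_rec_def
proof
  fix k :: int
  let ?w = "2 * of_real pi * of_int k + t" and ?q = "mathieu_potential a b"
  define E where "E x = exp (- \<i> * ?w * of_real x)" for x :: real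
  have contE: "continuous_on S E" for S unfolding E_def by (intro continuous_intros)
  have conty: "continuous_on S y" for S by (rule mathieu.hill_sol_continuous[OF sol])
  have contq: "continuous_on S ?q" for S by (rule mathieu.q_continuous)
  have dE: "(E has_vector_derivative (- \<i> * ?w * E x)) (at x within S)" for x S
  proof -
    have "((\<lambda>z. exp (- \<i> * ?w * z)) has_field_derivative (- \<i> * ?w * E x)) (at (of_real x))"
      unfolding E_def by (auto intro!: derivative_eq_intros)
    from has_vector_derivative_real_field[OF this] show ?thesis unfolding E_def .
  qed
  have dy: "(y has_vector_derivative dy x) (at x within S)"
    and ddy: "(dy has_vector_derivative (?q x - l) * y x) (at x within S)" for x S
    using sol unfolding hill_sol_def by (auto intro: has_vector_derivative_at_within)
  \<comment> \<open>The boundary term of two integrations by parts. Over one period \<open>E\<close>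
    has the multiplier inverse to that of \<open>y\<close> and \<open>dy\<close>, so
    \<open>G 1 = G 0\<close>.\<close>
  define G where "G x = dy x * E x + \<i> * ?w * (y x * E x)" for x
  have "((\<lambda>x. (?q x - l + ?w\<^sup>2) * (y x * E x)) has_integral (G 1 - G 0)) {0..1}"
  proof (rule fundamental_theorem_of_calculus)
    fix x :: real
    have "(G has_vector_derivative ((?q x - l) * y x * E x + dy x * (- \<i> * ?w * E x)
        + \<i> * ?w * (dy x * E x + y x * (- \<i> * ?w * E x)))) (at x within {0..1})"
      unfolding G_def by (rule derivative_eq_intros dE dy ddy refl | simp add: algebra_simps)+
    moreover have "(?q x - l) * y x * E x + dy x * (- \<i> * ?w * E x)
        + \<i> * ?w * (dy x * E x + y x * (- \<i> * ?w * E x)) = (?q x - l + ?w\<^sup>2) * (y x * E x)"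
    proof -
      have "(Q - l) * Y * e + Y' * (- \<i> * w * e) + \<i> * w * (Y' * e + Y * (- \<i> * w * e)) = (Q - l + w\<^sup>2) * (Y * e)"
        for Q Y Y' e w :: complex
        by (simp add: power2_eq_square algebra_simps)
      then show ?thesis .
    qed
    ultimately show "(G has_vector_derivative (?q x - l + ?w\<^sup>2) * (y x * E x)) (at x within {0..1})" by simp
  qed auto
  moreover have "G 1 = G 0"
  proof -
    have "exp (\<i> * t) * E 1 = E 0"
      unfolding E_def using exp_frequency_period[of k t] by (simp add: exp_add[symmetric])
    then have "y 1 * E 1 = y 0 * E 0" "dy 1 * E 1 = dy 0 * E 0" unfolding fl by (simp_all add: mult_ac)
    then show ?thesis unfolding G_def by simp
  qed
  ultimately have I0: "((\<lambda>x. (?q x - l + ?w\<^sup>2) * (y x * E x)) has_integral 0) {0..1}" by simp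
  have int: "(\<lambda>x. f x * (y x * E x)) integrable_on {0..1}" if "continuous_on {0..1} f" for f
    by (intro integrable_continuous_real continuous_intros that conty contE)
  have c: "fourier_coeff t y k = integral {0..1} (\<lambda>x. y x * E x)"
    by (simp add: fourier_coeff_def E_def)
  have c1: "fourier_coeff t y (k + 1) = integral {0..1} (\<lambda>x. exp (- \<i> * 2 * of_real pi * of_real x) * (y x * E x))"
    unfolding fourier_coeff_def exp_frequency_shift E_def by (intro integral_cong mult.left_commute)
  have c2: "fourier_coeff t y (k - 1) = integral {0..1} (\<lambda>x. exp (\<i> * 2 * of_real pi * of_real x) * (y x * E x))"
    unfolding fourier_coeff_def exp_frequency_shift E_def by (intro integral_cong mult.left_commute)
  have "a * fourier_coeff t y (k + 1) + b * fourier_coeff t y (k - 1)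
      = integral {0..1} (\<lambda>x. a * (exp (- \<i> * 2 * of_real pi * of_real x) * (y x * E x)))
        + integral {0..1} (\<lambda>x. b * (exp (\<i> * 2 * of_real pi * of_real x) * (y x * E x)))"
    unfolding c1 c2 by simp
  also have "\<dots> = integral {0..1} (\<lambda>x. a * (exp (- \<i> * 2 * of_real pi * of_real x) * (y x * E x))
      + b * (exp (\<i> * 2 * of_real pi * of_real x) * (y x * E x)))"
    by (intro integral_add[symmetric] integrable_on_mult_right int) (auto intro!: continuous_intros)
  also have "\<dots> = integral {0..1} (\<lambda>x. ?q x * (y x * E x))"
    by (intro integral_cong) (simp add: mathieu_potential_def algebra_simps)
  also have "\<dots> = integral {0..1} (\<lambda>x. (?q x - l + ?w\<^sup>2) * (y x * E x) + (l - ?w\<^sup>2) * (y x * E x))"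
    by (intro integral_cong) (simp add: algebra_simps)
  also have "\<dots> = 0 + (l - ?w\<^sup>2) * integral {0..1} (\<lambda>x. y x * E x)"
    using I0 int[of "\<lambda>x. 1"]
    by (subst integral_add) (auto simp: has_integral_iff intro!: integrable_on_mult_right)
  finally show "(l - ?w\<^sup>2) * fourier_coeff t y k = a * fourier_coeff t y (k + 1) + b * fourier_coeff t y (k - 1)"
    by (simp add: c)
qed

lemma floquet_fourier_complete:
  assumes cont: "continuous_on UNIV y" and fl: "\<And>x. y (x + 1) = exp (\<i> * t) * y x"
    and zero: "\<And>k. fourier_coeff t y k = 0" and x: "x \<in> {0..1}"
  shows "y x = 0"
proof -
  define p where "p x = y x * exp (- \<i> * t * of_real x)" for x
  have "p x = 0"
  proof (rule fourier_complete[OF _ _ _ x])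
    show "continuous_on UNIV p" unfolding p_def by (intro continuous_intros cont)
    fix x :: real
    have "exp (- \<i> * t * of_real (x + 1)) * exp (\<i> * t) = exp (- \<i> * t * of_real x)"
      by (simp add: exp_add[symmetric] algebra_simps)
    then show "p (x + 1) = p x" unfolding p_def fl by (metis mult.assoc mult.commute)
  next
    fix k :: int
    have "p x * cis (2 * pi * of_int k * x) = y x * exp (- \<i> * (2 * of_real pi * of_int (- k) + t) * of_real x)" for x
      unfolding p_def cis_conv_exp mult.assoc exp_add[symmetric] by (simp add: algebra_simps)
    then show "integral {0..1} (\<lambda>x. p x * cis (2 * pi * of_int k * x)) = 0"
      using zero[of "- k"] by (simp only: fourier_coeff_def)
  qed
  then show ?thesis by (simp add: p_def)
qed

section \<open>Near-degeneracy of the periodic and antiperiodic eigenfunctions of large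
  index\<close>

section \<open>Large periodic and antiperiodic eigenvalues\<close>

text \<open>A Floquet solution with multiplier \<open>exp (\<i> * t)\<close> has decaying
  coefficients that are not all zero, so a largest one exists and the recurrence is read off
  there.\<close>

lemma mathieu_frequency:
  assumes a: "a \<noteq> 0" and F: "hill_F (mathieu_potential a b) l = 2 * cos t"
  shows "\<exists>n::int. cmod (l - (2 * of_real pi * of_int n + t)\<^sup>2) \<le> cmod a + cmod b"
proof -
  have "(exp (\<i> * t))\<^sup>2 - (2 * cos t) * exp (\<i> * t) + 1 = 0"
    by (simp add: cos_exp_eq power2_eq_square exp_minus algebra_simps)
  then obtain y dy where y: "hill_sol (mathieu_potential a b) l y dy" "y 1 = exp (\<i> * t) * y 0"
      "dy 1 = exp (\<i> * t) * dy 0" "y 0 \<noteq> 0 \<or> dy 0 \<noteq> 0"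
    using mathieu.floquet_solution_exists[of "exp (\<i> * t)" a b l] unfolding F by metis
  have cont: "continuous_on S y" for S by (rule mathieu.hill_sol_continuous[OF y(1)])
  have rec: "floquet_rec a b l t (fourier_coeff t y)" by (rule mathieu_fourier_rec[OF y(1-3)])
  obtain B where B: "\<And>k. cmod (fourier_coeff t y k) \<le> B" using fourier_coeff_bounded[OF cont] by metis
  obtain C where "\<And>k. cmod (fourier_coeff t y k) * 2 ^ nat \<bar>k\<bar> \<le> C"
    using floquet_rec_decay[OF rec B _ a, of 2] by auto
  then obtain n where n: "\<And>k. cmod (fourier_coeff t y k) \<le> cmod (fourier_coeff t y n)"
    using decaying_attains_max by metis
  have "fourier_coeff t y n \<noteq> 0"
  proof
    assume "fourier_coeff t y n = 0"
    then have "\<And>k. fourier_coeff t y k = 0" using n by simp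
    then have "\<And>x. x \<in> {0..1} \<Longrightarrow> y x = 0"
      by (rule floquet_fourier_complete[OF cont mathieu.floquet[OF y(1-3)]])
    then show False using mathieu.hill_sol_nonzero[OF y(1,4)] by blast
  qed
  from floquet_rec_frequency[OF rec n this] show ?thesis by blast
qed

lemma cos_surj: "\<exists>t::complex. z = 2 * cos t"
  by (rule exI[of _ "Arccos (z / 2)"]) simp

text \<open>Write \<open>2 pi n + t = U + \<i> v\<close>. The real part of the localization forces
  \<open>U^2 \<ge> 1\<close>; its imaginary part \<open>2 * U * v\<close> then bounds
  \<open>v = Im t\<close>, and \<open>2 * cos t\<close> can grow only with
  \<open>\<bar>v\<bar>\<close>.\<close>

lemma mathieu_bounded_right:
  assumes a: "a \<noteq> 0" and x: "cmod a + cmod b + 1 \<le> x"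
  shows "cmod (hill_F (mathieu_potential a b) (of_real x)) \<le> 2 * exp (cmod a + cmod b)"
proof -
  let ?A = "cmod a + cmod b"
  obtain t where t: "hill_F (mathieu_potential a b) (of_real x) = 2 * cos t" using cos_surj by blast
  obtain n :: int where n: "cmod (of_real x - (2 * of_real pi * of_int n + t)\<^sup>2) \<le> ?A"
    using mathieu_frequency[OF a t] by blast
  define U where "U = 2 * pi * of_int n + Re t"
  define v where "v = Im t"
  have sq: "of_real x - (2 * of_real pi * of_int n + t)\<^sup>2 = Complex (x - (U\<^sup>2 - v\<^sup>2)) (- (2 * U * v))"
    by (simp add: complex_eq_iff U_def v_def power2_eq_square algebra_simps)
  have "\<bar>x - (U\<^sup>2 - v\<^sup>2)\<bar> \<le> ?A" "\<bar>2 * U * v\<bar> \<le> ?A"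
    using n abs_Re_le_cmod[of "of_real x - (2 * of_real pi * of_int n + t)\<^sup>2"]
      abs_Im_le_cmod[of "of_real x - (2 * of_real pi * of_int n + t)\<^sup>2"] unfolding sq by auto
  then have "1 \<le> U\<^sup>2" using x by (smt (verit) zero_le_power2)
  then have "1 \<le> \<bar>U\<bar>" using abs_le_square_iff[of 1 U] by simp
  then have "1 * \<bar>v\<bar> \<le> (2 * \<bar>U\<bar>) * \<bar>v\<bar>" by (intro mult_right_mono) auto
  then have v: "\<bar>v\<bar> \<le> ?A" using \<open>\<bar>2 * U * v\<bar> \<le> ?A\<close> by (simp add: abs_mult)
  have "cmod (2 * cos t) = cmod (exp (\<i> * t) + exp (- \<i> * t))" by (simp add: cos_exp_eq distrib_left[symmetric] del: distrib_left_numeral)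
  also have "\<dots> \<le> exp (- v) + exp v"
    by (rule order_trans[OF norm_triangle_ineq]) (simp add: norm_exp_eq_Re v_def)
  also have "\<dots> \<le> exp ?A + exp ?A" using v by (intro add_mono) auto
  finally show ?thesis by (simp add: t)
qed

text \<open>Here the real part \<open>U^2 - v^2\<close> must be close to a large negative number, so
  \<open>\<bar>v\<bar> \<ge> n\<close>, and \<open>cmod (2 * cos t)\<close> is at least \<open>exp
  \<bar>v\<bar> - exp (- \<bar>v\<bar>) \<ge> \<bar>v\<bar>\<close>.\<close>

lemma mathieu_unbounded_left:
  assumes a: "a \<noteq> 0" and x: "x \<le> - (cmod a + cmod b) - n\<^sup>2" and n: "0 \<le> n"
  shows "n \<le> cmod (hill_F (mathieu_potential a b) (of_real x))"
proof -
  let ?A = "cmod a + cmod b"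
  obtain t where t: "hill_F (mathieu_potential a b) (of_real x) = 2 * cos t" using cos_surj by blast
  obtain k :: int where k: "cmod (of_real x - (2 * of_real pi * of_int k + t)\<^sup>2) \<le> ?A"
    using mathieu_frequency[OF a t] by blast
  define U where "U = 2 * pi * of_int k + Re t"
  define v where "v = Im t"
  have sq: "of_real x - (2 * of_real pi * of_int k + t)\<^sup>2 = Complex (x - (U\<^sup>2 - v\<^sup>2)) (- (2 * U * v))"
    by (simp add: complex_eq_iff U_def v_def power2_eq_square algebra_simps)
  have "\<bar>x - (U\<^sup>2 - v\<^sup>2)\<bar> \<le> ?A"
    using k abs_Re_le_cmod[of "of_real x - (2 * of_real pi * of_int k + t)\<^sup>2"] unfolding sq by auto
  then have "n\<^sup>2 \<le> v\<^sup>2" using x by (smt (verit) zero_le_power2)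
  then have v: "n \<le> \<bar>v\<bar>" using n abs_le_square_iff[of n v] by simp
  have "cmod (exp (- \<i> * t) + exp (\<i> * t)) \<ge> exp v - exp (- v)"
    using norm_triangle_ineq2[of "exp (- \<i> * t)" "- exp (\<i> * t)"] by (simp add: norm_exp_eq_Re v_def)
  moreover have "cmod (exp (\<i> * t) + exp (- \<i> * t)) \<ge> exp (- v) - exp v"
    using norm_triangle_ineq2[of "exp (\<i> * t)" "- exp (- \<i> * t)"] by (simp add: norm_exp_eq_Re v_def)
  moreover have "exp \<bar>v\<bar> - exp (- \<bar>v\<bar>) \<ge> \<bar>v\<bar>"
  proof -
    have "exp (- \<bar>v\<bar>) \<le> 1" by simp
    then show ?thesis using exp_ge_add_one_self[of "\<bar>v\<bar>"] by linarith
  qed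
  moreover have "cmod (2 * cos t) = cmod (exp (\<i> * t) + exp (- \<i> * t))" by (simp add: cos_exp_eq distrib_left[symmetric] del: distrib_left_numeral)
  ultimately have "\<bar>v\<bar> \<le> cmod (2 * cos t)" by (cases "v \<ge> 0") (auto simp: add.commute)
  then show ?thesis using v by (simp add: t)
qed

lemma mathieu_large_eigenvalue:
  assumes a: "a \<noteq> 0"
  shows "\<exists>l. R < cmod l \<and> (hill_F (mathieu_potential a b) l = 2 \<or> hill_F (mathieu_potential a b) l = -2)"
proof (rule ccontr)
  assume non: "\<not> ?thesis"
  let ?F = "hill_F (mathieu_potential a b)" and ?A = "cmod a + cmod b"
  define R' where "R' = max R 1"
  have R': "0 < R'" by (simp add: R'_def)
  \<comment> \<open>If \<open>F\<close> omits 2 and -2 near infinity, this function omits 0 and -4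
    in a punctured disc around 0.\<close>
  define f where "f w = ?F (inverse w) - 2" for w
  have big: "R < cmod (inverse w)" if w: "w \<in> ball 0 (1 / R') - {0}" for w :: complex
  proof -
    have "cmod w < 1 / R'" "0 < cmod w" using w by auto
    then have "cmod w * R' < 1" using R' by (simp add: pos_less_divide_eq)
    then have "R' < 1 / cmod w" using \<open>0 < cmod w\<close> by (simp add: pos_less_divide_eq mult.commute)
    then show ?thesis by (simp add: R'_def norm_inverse divide_inverse)
  qed
  have hol: "f holomorphic_on ball 0 (1 / R') - {0}"
  proof -
    have "?F \<circ> inverse holomorphic_on ball 0 (1 / R') - {0}"
      by (rule holomorphic_on_compose_gen[OF _ mathieu.hill_F_holomorphic[of a b UNIV]])
         (auto intro!: holomorphic_intros)
    then show ?thesis unfolding f_def[abs_def] by (auto simp: o_def intro!: holomorphic_intros)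
  qed
  have fab: "f w \<noteq> 0 \<and> f w \<noteq> -4" if "w \<in> ball 0 (1 / R') - {0}" for w
    using non big[OF that] by (auto simp: f_def algebra_simps)
  \<comment> \<open>A limit of \<open>f\<close> contradicts its growth along \<open>w\<close>
    (negative axis). A limit of \<open>1 / f\<close> must be 0 because of \<open>w\<close>, and then
    contradicts the boundedness of \<open>f\<close> along \<open>u\<close> (positive axis).\<close>
  obtain l where l: "(f \<longlongrightarrow> l) (at 0) \<or> ((inverse \<circ> f) \<longlongrightarrow> l) (at 0)"
    by (rule great_Picard[OF _ _ _ hol fab]) (use R' in auto)
  define u where "u n = inverse (of_real (?A + 1 + real n + R') :: complex)" for n :: nat
  define w where "w n = inverse (of_real (- ?A - (real n)\<^sup>2 - 1) :: complex)" for n :: nat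
  have u: "filterlim u (at 0) sequentially"
  proof -
    have "filterlim (\<lambda>n. ?A + 1 + real n + R') at_top sequentially" by real_asymp
    then have "filterlim (\<lambda>n. of_real (?A + 1 + real n + R') :: complex) at_infinity sequentially"
      by (intro filterlim_compose[OF filterlim_of_real_at_infinity] filterlim_at_top_imp_at_infinity)
    then show ?thesis unfolding u_def[abs_def] by (subst filterlim_inverse_at_iff)
  qed
  have w: "filterlim w (at 0) sequentially"
  proof -
    have "cmod (of_real (- ?A - (real n)\<^sup>2 - 1)) = ?A + (real n)\<^sup>2 + 1" for n
      unfolding norm_of_real
      using norm_ge_zero[of a] norm_ge_zero[of b] zero_le_power2[of "real n"] by linarith
    moreover have "filterlim (\<lambda>n. ?A + (real n)\<^sup>2 + 1) at_top sequentially" by real_asymp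
    ultimately have "filterlim (\<lambda>n. of_real (- ?A - (real n)\<^sup>2 - 1) :: complex) at_infinity sequentially"
      by (intro filterlim_norm_at_top_imp_at_infinity) simp
    then show ?thesis unfolding w_def[abs_def] by (subst filterlim_inverse_at_iff)
  qed
  have fw: "real n \<le> cmod (f (w n)) + 2" for n
  proof -
    have "real n \<le> cmod (?F (of_real (- ?A - (real n)\<^sup>2 - 1)))"
      by (rule mathieu_unbounded_left[OF a]) auto
    also have "\<dots> \<le> cmod (f (w n)) + 2"
      using norm_triangle_ineq[of "f (w n)" 2] by (simp add: f_def w_def)
    finally show ?thesis .
  qed
  have fu: "cmod (f (u n)) \<le> 2 * exp ?A + 2" for n
  proof -
    have "cmod (f (u n)) \<le> cmod (?F (of_real (?A + 1 + real n + R'))) + 2"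
      using norm_triangle_ineq4[of "?F (of_real (?A + 1 + real n + R'))" 2] by (simp add: f_def u_def)
    also have "\<dots> \<le> 2 * exp ?A + 2" using mathieu_bounded_right[OF a, of b "?A + 1 + real n + R'"] R' by simp
    finally show ?thesis .
  qed
  from l show False
  proof
    assume "(f \<longlongrightarrow> l) (at 0)"
    from filterlim_compose[OF this w] have "Bseq (\<lambda>n. f (w n))" by (rule convergent_imp_Bseq[OF convergentI])
    then obtain K where K: "\<And>n. cmod (f (w n)) \<le> K" unfolding Bseq_def by auto
    obtain n where "K + 2 < real n" using reals_Archimedean2 by blast
    then show False using fw[of n] K[of n] by linarith
  next
    assume lim: "((inverse \<circ> f) \<longlongrightarrow> l) (at 0)"
    have "filterlim (\<lambda>n. f (w n)) at_infinity sequentially"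
    proof -
      have "filterlim (\<lambda>n. real n - 2) at_top sequentially" by real_asymp
      then have "filterlim (\<lambda>n. cmod (f (w n))) at_top sequentially"
        by (rule filterlim_at_top_mono) (use fw in \<open>auto intro!: always_eventually simp: algebra_simps\<close>)
      then show ?thesis by (simp add: filterlim_at_infinity_conv_norm_at_top)
    qed
    then have "(\<lambda>n. inverse (f (w n))) \<longlonglongrightarrow> 0"
      by (rule filterlim_compose[OF tendsto_inverse_0])
    moreover have "(\<lambda>n. inverse (f (w n))) \<longlonglongrightarrow> l" using filterlim_compose[OF lim w] by (simp add: o_def)
    ultimately have "l = 0" by (metis LIMSEQ_unique)
    then have "(\<lambda>n. inverse (f (u n))) \<longlonglongrightarrow> 0" using filterlim_compose[OF lim u] by (simp add: o_def)
    then have "(\<lambda>n. cmod (inverse (f (u n)))) \<longlonglongrightarrow> 0" by (rule tendsto_norm_zero)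
    moreover have "0 < 1 / (2 * exp ?A + 2)" by (simp add: add_pos_pos)
    ultimately have "\<forall>\<^sub>F n in sequentially. cmod (inverse (f (u n))) < 1 / (2 * exp ?A + 2)"
      by (rule order_tendstoD(2))
    moreover have "\<forall>\<^sub>F n in sequentially. u n \<in> ball 0 (1 / R') - {0}"
    proof -
      have "\<forall>\<^sub>F x in at (0::complex). x \<in> ball 0 (1 / R') - {0}"
        using R' by (intro eventually_at_in_open) auto
      then show ?thesis using u unfolding filterlim_iff by blast
    qed
    ultimately have "\<forall>\<^sub>F n in sequentially. False"
    proof eventually_elim
      case (elim n)
      then have nz: "f (u n) \<noteq> 0" using fab by blast
      then have "1 / (2 * exp ?A + 2) \<le> 1 / cmod (f (u n))"
        using fu[of n] by (intro divide_left_mono) (auto simp: add_pos_pos)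
      then show ?case using elim by (simp add: norm_inverse divide_inverse)
    qed
    then show False by simp
  qed
qed

section \<open>The Cauchy-Schwarz inequality\<close>

text \<open>Stated for the bilinear pairing; a conjugate, where wanted, is part of
  \<open>g\<close>.\<close>

lemma cauchy_schwarz_integral:
  fixes f g :: "real \<Rightarrow> complex"
  assumes f: "continuous_on {u..v} f" and g: "continuous_on {u..v} g"
  shows "(cmod (integral {u..v} (\<lambda>x. f x * g x)))\<^sup>2
     \<le> integral {u..v} (\<lambda>x. (cmod (f x))\<^sup>2) * integral {u..v} (\<lambda>x. (cmod (g x))\<^sup>2)"
proof -
  let ?I = "integral {u..v} (\<lambda>x. f x * g x)"
  define A where "A = integral {u..v} (\<lambda>x. (cmod (f x))\<^sup>2)"
  define B where "B = integral {u..v} (\<lambda>x. (cmod (g x))\<^sup>2)"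
  \<comment> \<open>The integral of the squared modulus of \<open>f - r * I * cnj g\<close>, with
    \<open>I\<close> the pairing. The choice \<open>r = 1 / B\<close> is optimal, and for
    \<open>B = 0\<close> a large \<open>r\<close> forces \<open>I = 0\<close>.\<close>
  have quad: "0 \<le> A - 2 * r * (cmod ?I)\<^sup>2 + r\<^sup>2 * (cmod ?I)\<^sup>2 * B" for r :: real
  proof -
    have "(cmod (w - of_real r * I * cnj z))\<^sup>2
        = (cmod w)\<^sup>2 - 2 * r * Re (cnj I * (w * z)) + r\<^sup>2 * (cmod I)\<^sup>2 * (cmod z)\<^sup>2" for w z I
      unfolding cmod_power2 by (simp add: power2_eq_square algebra_simps)
    note e = this[of _ "?I"]
    have iA: "((\<lambda>x. (cmod (f x))\<^sup>2) has_integral A) {u..v}" and iB: "((\<lambda>x. (cmod (g x))\<^sup>2) has_integral B) {u..v}"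
      unfolding A_def B_def
      by (rule integrable_integral, rule integrable_continuous_real, intro continuous_intros f g)+
    have iI: "((\<lambda>x. f x * g x) has_integral ?I) {u..v}"
      by (rule integrable_integral, rule integrable_continuous_real, intro continuous_intros f g)
    have "((\<lambda>x. Re (cnj ?I * (f x * g x))) has_integral Re (cnj ?I * ?I)) {u..v}"
      using has_integral_linear[OF has_integral_mult_right[OF iI, of "cnj ?I"] bounded_linear_Re] by (simp add: o_def)
    moreover have "Re (cnj ?I * ?I) = (cmod ?I)\<^sup>2" unfolding cmod_power2 by (simp add: power2_eq_square)
    ultimately have iR: "((\<lambda>x. Re (cnj ?I * (f x * g x))) has_integral (cmod ?I)\<^sup>2) {u..v}" by simp
    have "((\<lambda>x. (cmod (f x - of_real r * ?I * cnj (g x)))\<^sup>2) has_integral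
        (A - 2 * r * (cmod ?I)\<^sup>2 + r\<^sup>2 * (cmod ?I)\<^sup>2 * B)) {u..v}"
      unfolding e by (intro has_integral_add has_integral_diff has_integral_mult_right iA iB iR)
    then show ?thesis by (rule has_integral_nonneg) auto
  qed
  have B: "0 \<le> B" unfolding B_def by (intro integral_nonneg integrable_continuous_real continuous_intros g) auto
  show ?thesis
  proof (cases "B = 0")
    case True
    have "(cmod ?I)\<^sup>2 \<le> 0"
    proof (rule ccontr)
      assume "\<not> ?thesis"
      then have p: "0 < (cmod ?I)\<^sup>2" by simp
      have "0 \<le> A - 2 * ((A + 1) / (cmod ?I)\<^sup>2) * (cmod ?I)\<^sup>2" using quad[of "(A + 1) / (cmod ?I)\<^sup>2"] True by simp
      also have "\<dots> = A - 2 * (A + 1)" using p by simp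
      finally show False using quad[of 0] by simp
    qed
    then show ?thesis by (simp add: A_def[symmetric] B_def[symmetric] True)
  next
    case False
    then have Bp: "0 < B" using B by simp
    have "0 \<le> A - 2 * (1 / B) * (cmod ?I)\<^sup>2 + (1 / B)\<^sup>2 * (cmod ?I)\<^sup>2 * B" by (rule quad)
    also have "\<dots> = A - (cmod ?I)\<^sup>2 / B" using Bp by (simp add: power2_eq_square field_simps)
    finally have "(cmod ?I)\<^sup>2 / B \<le> A" by simp
    then show ?thesis using Bp by (simp add: A_def[symmetric] B_def[symmetric] divide_le_eq)
  qed
qed

section \<open>The symmetrized recurrence\<close>

text \<open>Conjugation of the tridiagonal matrix by the diagonal matrix of the
  \<open>s powi k\<close>; the hypotheses on \<open>s\<close> and \<open>g\<close> amount to
  \<open>s^2 = b / a\<close> and \<open>g^2 = a * b\<close>.\<close>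

lemma floquet_rec_symmetrize:
  assumes rec: "floquet_rec a b l t c" and s: "s \<noteq> 0" "a * s = g" "b = g * s"
  shows "floquet_rec g g l t (\<lambda>k. c k * s powi (- k))"
  unfolding floquet_rec_def
proof
  fix k
  have "s powi (- k) = s powi (- (k + 1)) * s" "s powi (- (k - 1)) = s powi (- k) * s"
    using s(1) by (simp_all add: power_int_add[symmetric] power_int_minus power_int_add field_simps power_int_diff)
  then have p: "a * s powi (- k) = g * s powi (- (k + 1))" "b * s powi (- k) = g * s powi (- (k - 1))"
    unfolding s(2)[symmetric] s(3) using s by (simp_all add: mult_ac)
  have "(l - (2 * of_real pi * of_int k + t)\<^sup>2) * (c k * s powi (- k)) = (a * c (k + 1) + b * c (k - 1)) * s powi (- k)"
    using rec unfolding floquet_rec_def by (metis mult.assoc)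
  also have "\<dots> = c (k + 1) * (a * s powi (- k)) + c (k - 1) * (b * s powi (- k))" by (simp add: algebra_simps)
  also have "\<dots> = g * (c (k + 1) * s powi (- (k + 1))) + g * (c (k - 1) * s powi (- (k - 1)))" unfolding p by (simp add: algebra_simps)
  finally show "(l - (2 * of_real pi * of_int k + t)\<^sup>2) * (c k * s powi (- k))
      = g * (c (k + 1) * s powi (- (k + 1))) + g * (c (k - 1) * s powi (- (k - 1)))" .
qed

lemma floquet_rec_zero:
  assumes rec: "floquet_rec g g l t d" and g: "g \<noteq> 0" and 0: "d 0 = 0" "d 1 = 0"
  shows "d k = 0"
proof -
  have up: "d (int n) = 0 \<and> d (int n + 1) = 0" for n
  proof (induction n)
    case (Suc n)
    have "g * d (int n + 1 + 1) + g * d (int n + 1 - 1) = (l - (2 * of_real pi * of_int (int n + 1) + t)\<^sup>2) * d (int n + 1)"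
      using rec unfolding floquet_rec_def by metis
    then show ?case using Suc g by (simp add: add.commute add.assoc)
  qed (use 0 in auto)
  have down: "d (- int n) = 0 \<and> d (- int n + 1) = 0" for n
  proof (induction n)
    case (Suc n)
    have "g * d (- int n + 1) + g * d (- int n - 1) = (l - (2 * of_real pi * of_int (- int n) + t)\<^sup>2) * d (- int n)"
      using rec unfolding floquet_rec_def by metis
    then have "d (- int n - 1) = 0" using Suc g by simp
    moreover have "- int (Suc n) = - int n - 1" by simp
    ultimately show ?case using Suc by (metis diff_add_cancel)
  qed (use 0 in auto)
  show ?thesis
  proof (cases "k \<ge> 0")
    case True
    then show ?thesis using up[of "nat k"] by simp
  next
    case False
    then show ?thesis using down[of "nat (- k)"] by simp
  qed
qed

text \<open>The discrete Wronskian \<open>W\<close> does not depend on the index, and it tends to 0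
  because \<open>e\<close> decays while \<open>f\<close> stays bounded. Hence it vanishes, and some
  multiple of \<open>e\<close> agrees with \<open>f\<close> at 0 and 1, which determines a
  solution.\<close>

lemma floquet_rec_unique:
  assumes e: "floquet_rec g g l t e" and f: "floquet_rec g g l t f" and g: "g \<noteq> 0"
    and be: "\<And>k. cmod (e k) \<le> B" and bf: "\<And>k. cmod (f k) \<le> B" and nz: "e k0 \<noteq> 0"
  shows "\<exists>\<tau>. \<forall>k. f k = \<tau> * e k"
proof -
  define W where "W k = e k * f (k + 1) - e (k + 1) * f k" for k
  have step: "W (k + 1) = W k" for k
  proof -
    define \<mu> where "\<mu> = l - (2 * of_real pi * of_int (k + 1) + t)\<^sup>2"
    have "\<mu> * e (k + 1) = g * e (k + 1 + 1) + g * e (k + 1 - 1)" "\<mu> * f (k + 1) = g * f (k + 1 + 1) + g * f (k + 1 - 1)"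
      using e f unfolding floquet_rec_def \<mu>_def by metis+
    then have "g * e (k + 1 + 1) = \<mu> * e (k + 1) - g * e k" "g * f (k + 1 + 1) = \<mu> * f (k + 1) - g * f k" by simp_all
    then have "g * W (k + 1) = g * W k" unfolding W_def by algebra
    then show ?thesis using g by simp
  qed
  have Wn: "W (int n) = W 0" for n
    by (induction n) (use step[of "int _"] in \<open>auto simp: add.commute\<close>)
  obtain C where C: "\<And>k. cmod (e k) * 2 ^ nat \<bar>k\<bar> \<le> C"
    using floquet_rec_decay[OF e be _ g, of 2] by auto
  have B: "0 \<le> B" using order_trans[OF norm_ge_zero be[of 0]] .
  have bound: "cmod (W 0) * 2 ^ n \<le> 2 * C * B" for n
  proof -
    have C2: "cmod (e (int n)) * 2 ^ n \<le> C" using C[of "int n"] by simp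
    have "cmod (e (int n + 1)) * 2 ^ n \<le> cmod (e (int n + 1)) * 2 ^ nat \<bar>int n + 1\<bar>"
      by (intro mult_left_mono power_increasing) auto
    then have C3: "cmod (e (int n + 1)) * 2 ^ n \<le> C" using C[of "int n + 1"] by linarith
    have "W 0 = e (int n) * f (int n + 1) - e (int n + 1) * f (int n)"
      using Wn[of n] unfolding W_def[of "int n"] by (rule sym)
    then have "cmod (W 0) \<le> cmod (e (int n)) * cmod (f (int n + 1)) + cmod (e (int n + 1)) * cmod (f (int n))"
      using norm_triangle_ineq4[of "e (int n) * f (int n + 1)" "e (int n + 1) * f (int n)"] by (simp only: norm_mult)
    also have "\<dots> \<le> cmod (e (int n)) * B + cmod (e (int n + 1)) * B"
      by (intro add_mono mult_left_mono bf) auto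
    finally have "cmod (W 0) * 2 ^ n \<le> (cmod (e (int n)) * B + cmod (e (int n + 1)) * B) * 2 ^ n"
      by (intro mult_right_mono) auto
    also have "\<dots> = (cmod (e (int n)) * 2 ^ n) * B + (cmod (e (int n + 1)) * 2 ^ n) * B"
      by (simp add: algebra_simps)
    also have "\<dots> \<le> C * B + C * B" using B by (intro add_mono mult_right_mono C2 C3) auto
    finally show ?thesis by (simp add: mult_ac)
  qed
  have W0: "W 0 = 0"
  proof (rule ccontr)
    assume "W 0 \<noteq> 0"
    then have p: "0 < cmod (W 0)" by simp
    obtain n where "2 * C * B / cmod (W 0) < 2 ^ n" using real_arch_pow[of 2] by auto
    then have "2 * C * B < cmod (W 0) * 2 ^ n" using p by (simp add: divide_less_eq mult.commute)
    then show False using bound[of n] by linarith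
  qed
  have ne: "e 0 \<noteq> 0 \<or> e 1 \<noteq> 0" using floquet_rec_zero[OF e g, of k0] nz by blast
  define \<tau> where "\<tau> = (if e 0 \<noteq> 0 then f 0 / e 0 else f 1 / e 1)"
  have 01: "f 0 = \<tau> * e 0" "f 1 = \<tau> * e 1"
    using W0 ne unfolding W_def \<tau>_def by (auto simp: field_simps)
  have rec: "floquet_rec g g l t (\<lambda>k. f k - \<tau> * e k)"
    using e f unfolding floquet_rec_def by (simp add: algebra_simps)
  have "f k - \<tau> * e k = 0" for k
    by (rule floquet_rec_zero[OF rec g]) (simp_all add: 01)
  then show ?thesis by auto
qed

lemma powi_norm_le:
  fixes s :: complex
  assumes "cmod s \<le> R" "inverse (cmod s) \<le> R" "s \<noteq> 0"
  shows "cmod (s powi k) \<le> R ^ nat \<bar>k\<bar>"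
proof (cases "k \<ge> 0")
  case True
  then show ?thesis using assms by (simp add: power_int_def norm_power power_mono)
next
  case False
  then show ?thesis using assms by (simp add: power_int_def norm_power power_mono norm_inverse)
qed

text \<open>Since \<open>(cmod s)^2 = cmod b / cmod a\<close>, the hypothesis on the moduli of
  \<open>a\<close> and \<open>b\<close> enters the proof as
  \<open>cmod s \<noteq> 1\<close>.\<close>

lemma ex_symmetrizer:
  assumes "a \<noteq> 0" "b \<noteq> (0::complex)"
  obtains s g where "s \<noteq> 0" "a * s = g" "b = g * s" "g \<noteq> 0" "cmod s = 1 \<longleftrightarrow> cmod a = cmod b"
proof (rule that[of "csqrt (b / a)" "a * csqrt (b / a)"])
  have "a * csqrt (b / a) * csqrt (b / a) = a * (csqrt (b / a))\<^sup>2" by (simp only: power2_eq_square mult.assoc)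
  then show "b = a * csqrt (b / a) * csqrt (b / a)" using assms by simp
  have "(cmod (csqrt (b / a)))\<^sup>2 = cmod b / cmod a" by (simp add: norm_power[symmetric] norm_divide)
  then show "cmod (csqrt (b / a)) = 1 \<longleftrightarrow> cmod a = cmod b"
    using assms by (metis abs_norm_cancel divide_eq_1_iff norm_eq_zero one_power2 power2_eq_1_iff abs_1 abs_minus_cancel)
qed (use assms in auto)

text \<open>The coefficients decay faster than any geometric sequence, so they absorb the growth of
  \<open>s powi (- k)\<close> on either side.\<close>

lemma symmetrized_bounded:
  assumes rec: "floquet_rec a b l t c" and bdd: "\<And>k. cmod (c k) \<le> B" and a: "a \<noteq> 0" and s: "s \<noteq> 0"
  obtains B' where "\<And>k. cmod (c k * s powi (- k)) \<le> B'"
proof -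
  define R where "R = max 1 (max (cmod s) (inverse (cmod s)))"
  obtain C where C: "\<And>k. cmod (c k) * R ^ nat \<bar>k\<bar> \<le> C"
    using floquet_rec_decay[OF rec bdd _ a, of R] unfolding R_def by (metis max.cobounded1)
  show thesis
  proof (rule that)
    fix k
    have "cmod (s powi (- k)) \<le> R ^ nat \<bar>- k\<bar>" by (rule powi_norm_le) (use s in \<open>auto simp: R_def\<close>)
    then have "cmod (c k * s powi (- k)) \<le> cmod (c k) * R ^ nat \<bar>k\<bar>" by (simp add: norm_mult mult_left_mono)
    then show "cmod (c k * s powi (- k)) \<le> C" using C[of k] by linarith
  qed
qed

text \<open>Ince's theorem: two independent Floquet solutions with the same multiplier would give two
  decaying solutions of the three-term recurrence, and their Casorati determinant is constant.\<close>

lemma mathieu_no_coexistence: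
  assumes a: "a \<noteq> 0" and b: "b \<noteq> 0" and r: "r \<noteq> 0"
  shows "\<not> (theta (mathieu_potential a b) l 1 = r \<and> phi (mathieu_potential a b) l 1 = 0
          \<and> mathieu.dtheta a b l 1 = 0 \<and> mathieu.dphi a b l 1 = r)"
proof
  let ?th = "theta (mathieu_potential a b) l" and ?ph = "phi (mathieu_potential a b) l"
  assume *: "?th 1 = r \<and> ?ph 1 = 0 \<and> mathieu.dtheta a b l 1 = 0 \<and> mathieu.dphi a b l 1 = r"
  define t where "t = - \<i> * Ln r"
  have et: "exp (\<i> * t) = r" using r by (simp add: t_def)
  have th: "hill_sol (mathieu_potential a b) l ?th (mathieu.dtheta a b l)" by (rule mathieu.theta_sol)
  have ph: "hill_sol (mathieu_potential a b) l ?ph (mathieu.dphi a b l)" by (rule mathieu.phi_sol)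
  have ct: "continuous_on S ?th" and cp: "continuous_on S ?ph" for S
    by (rule mathieu.hill_sol_continuous[OF th] mathieu.hill_sol_continuous[OF ph])+
  let ?c = "fourier_coeff t ?th" and ?d = "fourier_coeff t ?ph"
  have rc: "floquet_rec a b l t ?c" by (rule mathieu_fourier_rec[OF th]) (use * et in auto)
  have rd: "floquet_rec a b l t ?d" by (rule mathieu_fourier_rec[OF ph]) (use * et in auto)
  obtain s g where s: "s \<noteq> 0" "a * s = g" "b = g * s" "g \<noteq> 0" using ex_symmetrizer[OF a b] by metis
  obtain B1 where "\<And>k. cmod (?c k) \<le> B1" using fourier_coeff_bounded[OF ct] by metis
  then obtain B2 where B2: "\<And>k. cmod (?c k * s powi (- k)) \<le> B2" using symmetrized_bounded[OF rc _ a s(1)] by metis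
  obtain B3 where "\<And>k. cmod (?d k) \<le> B3" using fourier_coeff_bounded[OF cp] by metis
  then obtain B4 where B4: "\<And>k. cmod (?d k * s powi (- k)) \<le> B4" using symmetrized_bounded[OF rd _ a s(1)] by metis
  have fl: "?th (x + 1) = exp (\<i> * t) * ?th x" "?ph (x + 1) = exp (\<i> * t) * ?ph x" for x
    by (rule mathieu.floquet[OF th] mathieu.floquet[OF ph], use * et in auto)+
  obtain k0 where k0: "?c k0 \<noteq> 0"
    using floquet_fourier_complete[OF ct fl(1)] mathieu.hill_sol_nonzero[OF th] by fastforce
  have "\<exists>\<tau>. \<forall>k. ?d k * s powi (- k) = \<tau> * (?c k * s powi (- k))"
  proof (rule floquet_rec_unique[OF floquet_rec_symmetrize[OF rc s(1-3)] floquet_rec_symmetrize[OF rd s(1-3)] s(4)])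
    show "cmod (?c k * s powi (- k)) \<le> max B2 B4" for k using B2[of k] by simp
    show "cmod (?d k * s powi (- k)) \<le> max B2 B4" for k using B4[of k] by simp
    show "?c k0 * s powi (- k0) \<noteq> 0" using k0 s by simp
  qed
  then obtain \<tau> where \<tau>: "\<And>k. ?d k = \<tau> * ?c k" using s(1) by auto
  \<comment> \<open>A nonzero solution, as the coefficient of \<open>?ph\<close> is 1, all of whose
    Fourier coefficients vanish.\<close>
  define z where "z x = 1 * ?ph x + (- \<tau>) * ?th x" for x
  have zs: "hill_sol (mathieu_potential a b) l z (\<lambda>x. 1 * mathieu.dphi a b l x + (- \<tau>) * mathieu.dtheta a b l x)"
    unfolding z_def by (rule mathieu.hill_sol_add[OF ph th])
  have cz: "continuous_on S z" for S by (rule mathieu.hill_sol_continuous[OF zs])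
  have "fourier_coeff t z k = 0" for k
  proof -
    have "fourier_coeff t z k = ?d k - \<tau> * ?c k"
      unfolding fourier_coeff_def z_def
      by (subst integral_mult_right[symmetric], subst integral_diff[symmetric])
         (auto intro!: integrable_continuous_real continuous_intros ct cp simp: algebra_simps)
    then show ?thesis by (simp add: \<tau>)
  qed
  moreover have "z (x + 1) = exp (\<i> * t) * z x" for x unfolding z_def fl by (simp add: algebra_simps)
  ultimately have "\<And>x. x \<in> {0..1} \<Longrightarrow> z x = 0" using floquet_fourier_complete[OF cz] by blast
  then show False using mathieu.hill_sol_nonzero[OF zs] by (auto simp: z_def)
qed

section \<open>Fourier expansion of Floquet solutions\<close>

definition fexp :: "real \<Rightarrow> int \<Rightarrow> real \<Rightarrow> complex" where
  "fexp t k x = exp (\<i> * (2 * of_real pi * of_int k + of_real t) * of_real x)"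

lemma norm_fexp [simp]: "cmod (fexp t k x) = 1"
  by (simp add: fexp_def norm_exp_eq_Re)

lemma continuous_fexp [continuous_intros]:
  "continuous_on S f \<Longrightarrow> continuous_on S (\<lambda>x. fexp t k (f x))"
  unfolding fexp_def by (intro continuous_intros)

lemma fexp_floquet: "fexp t k (x + 1) = exp (\<i> * of_real t) * fexp t k x"
proof -
  have "fexp t k (x + 1) = fexp t k x * exp (\<i> * of_real t) * cis (2 * pi * of_int k)"
    unfolding fexp_def cis_conv_exp exp_add[symmetric] by (rule arg_cong[of _ _ exp]) (simp add: algebra_simps)
  moreover have "cis (2 * pi * of_int k) = 1" by (rule cis_multiple_2pi) auto
  ultimately show ?thesis by simp
qed

lemma fourier_coeff_fexp: "fourier_coeff (of_real t) (fexp t j) k = (if j = k then 1 else 0)"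
proof -
  have e: "fexp t j x * exp (- \<i> * (2 * of_real pi * of_int k + of_real t) * of_real x)
      = cis (of_int (j - k) * (2 * pi * x))" for x
    unfolding fexp_def cis_conv_exp exp_add[symmetric] by (rule arg_cong[of _ _ exp]) (simp add: algebra_simps)
  have "((\<lambda>s. cis (of_int (j - k) * s)) has_integral (if j - k = 0 then 2 * of_real pi else 0)) {-pi..pi}"
    by (rule integral_cis_nat)
  from has_integral_affinity'[of _ _ "-pi" pi "2 * pi" "- pi", unfolded cbox_interval, OF this]
  have "((\<lambda>x. cis (of_int (j - k) * (2 * pi * x - pi))) has_integral
      (if j - k = 0 then 2 * of_real pi else 0) /\<^sub>R (2 * pi)) {0..1}" by simp
  from has_integral_mult_right[OF this, of "cis (of_int (j - k) * pi)"]
  have "((\<lambda>x. cis (of_int (j - k) * pi) * cis (of_int (j - k) * (2 * pi * x - pi))) has_integral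
      (if j = k then 1 else 0)) {0..1}" by (auto simp: scaleR_conv_of_real split: if_splits)
  moreover have "cis (of_int (j - k) * pi) * cis (of_int (j - k) * (2 * pi * x - pi)) = cis (of_int (j - k) * (2 * pi * x))" for x
    by (simp add: cis_mult algebra_simps)
  ultimately show ?thesis unfolding fourier_coeff_def e by (simp add: integral_unique)
qed

lemma sum_int_interval:
  fixes f :: "int \<Rightarrow> 'a::comm_monoid_add"
  shows "(\<Sum>k\<in>{- int N..int N}. f k) = f 0 + (\<Sum>j<N. f (int j + 1) + f (- (int j + 1)))"
proof (induction N)
  case (Suc N)
  have "{- int (Suc N)..int (Suc N)} = insert (int N + 1) (insert (- (int N + 1)) {- int N..int N})" by auto
  then show ?case using Suc by (simp add: add_ac)
qed auto

text \<open>By the decay the partial sums converge uniformly to a continuous \<open>Y\<close> with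
  the same multiplier and, by termwise integration, the same coefficients; completeness identifies
  \<open>Y\<close> with \<open>y\<close>.\<close>

lemma fourier_expansion:
  assumes cont: "continuous_on UNIV y" and fl: "\<And>x. y (x + 1) = exp (\<i> * of_real t) * y x"
    and dec: "\<And>k. cmod (fourier_coeff (of_real t) y k) * 2 ^ nat \<bar>k\<bar> \<le> C"
  shows "uniform_limit {0..1} (\<lambda>N x. \<Sum>k\<in>{- int N..int N}. fourier_coeff (of_real t) y k * fexp t k x) y sequentially"
proof -
  let ?c = "fourier_coeff (of_real t) y"
  define S where "S N x = (\<Sum>k\<in>{- int N..int N}. ?c k * fexp t k x)" for N x
  define u where "u j x = ?c (int j + 1) * fexp t (int j + 1) x + ?c (- (int j + 1)) * fexp t (- (int j + 1)) x" for j x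
  define Y where "Y x = ?c 0 * fexp t 0 x + (\<Sum>j. u j x)" for x
  have S: "S N x = ?c 0 * fexp t 0 x + (\<Sum>j<N. u j x)" for N x
    unfolding S_def u_def by (rule sum_int_interval)
  have C: "0 \<le> C" by (rule order_trans[OF _ dec[of 0]]) simp
  have ub: "cmod (u j x) \<le> C * (1/2) ^ j" for j x
  proof -
    have "cmod (?c k) \<le> C * (1/2) ^ j / 2" if "nat \<bar>k\<bar> = Suc j" for k
      using dec[of k] that by (simp add: field_simps)
    from this[of "int j + 1"] this[of "- (int j + 1)"]
    have "cmod (?c (int j + 1)) \<le> C * (1/2) ^ j / 2" "cmod (?c (- (int j + 1))) \<le> C * (1/2) ^ j / 2" by auto
    then show ?thesis unfolding u_def
      by (intro order_trans[OF norm_triangle_ineq]) (simp add: norm_mult)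
  qed
  have "uniform_limit UNIV (\<lambda>N x. \<Sum>j<N. u j x) (\<lambda>x. \<Sum>j. u j x) sequentially"
    by (rule Weierstrass_m_test[OF ub]) (intro summable_mult summable_geometric, simp)
  then have lim: "uniform_limit UNIV S Y sequentially"
    unfolding S[abs_def] Y_def[abs_def] by (intro uniform_limit_add uniform_limit_const)
  have contS: "continuous_on A (S N)" for A N
    unfolding S_def by (intro continuous_intros)
  have contY: "continuous_on UNIV Y"
    by (rule uniform_limit_theorem[OF _ lim]) (auto intro!: always_eventually contS)
  have flS: "S N (x + 1) = exp (\<i> * of_real t) * S N x" for N x
    unfolding S_def fexp_floquet sum_distrib_left by (simp add: mult_ac)
  have pt: "(\<lambda>N. S N x) \<longlonglongrightarrow> Y x" for x
    by (rule tendsto_uniform_limitI[OF lim]) auto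
  have flY: "Y (x + 1) = exp (\<i> * of_real t) * Y x" for x
  proof (rule LIMSEQ_unique[OF pt])
    show "(\<lambda>N. S N (x + 1)) \<longlonglongrightarrow> exp (\<i> * of_real t) * Y x"
      unfolding flS by (intro tendsto_intros pt)
  qed
  have coeffY: "fourier_coeff (of_real t) Y k = ?c k" for k
  proof -
    let ?E = "\<lambda>x::real. exp (- \<i> * (2 * of_real pi * of_int k + of_real t) * of_real x)"
    have "compact (?E ` {0..1})" by (intro compact_continuous_image continuous_intros) auto
    then have bE: "bounded (?E ` {0..1})" by (rule compact_imp_bounded)
    have "compact (Y ` {0..1})" by (intro compact_continuous_image continuous_on_subset[OF contY]) auto
    then have bY: "bounded (Y ` {0..1})" by (rule compact_imp_bounded)
    have "uniform_limit {0..1} S Y sequentially" by (rule uniform_limit_on_subset[OF lim]) auto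
    then have ul: "uniform_limit {0..1} (\<lambda>N x. S N x * ?E x) (\<lambda>x. Y x * ?E x) sequentially"
      by (rule bounded_bilinear.bounded_uniform_limit[OF bounded_bilinear_mult _ uniform_limit_const bE bY])
    have cS: "continuous_on {0..1} (\<lambda>x. S N x * ?E x)" for N by (intro continuous_intros contS)
    obtain I J where IJ: "\<And>N. ((\<lambda>x. S N x * ?E x) has_integral I N) {0..1}"
        "((\<lambda>x. Y x * ?E x) has_integral J) {0..1}" "I \<longlonglongrightarrow> J"
      by (rule uniform_limit_integral[OF ul cS]) auto
    have "I N = ?c k" if N: "nat \<bar>k\<bar> \<le> N" for N
    proof -
      have "I N = integral {0..1} (\<lambda>x. \<Sum>j\<in>{- int N..int N}. ?c j * (fexp t j x * ?E x))"
        using IJ(1)[of N] unfolding S_def by (simp add: integral_unique sum_distrib_right mult.assoc)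
      also have "\<dots> = (\<Sum>j\<in>{- int N..int N}. integral {0..1} (\<lambda>x. ?c j * (fexp t j x * ?E x)))"
        by (intro integral_sum integrable_continuous_real continuous_intros) auto
      also have "\<dots> = (\<Sum>j\<in>{- int N..int N}. ?c j * fourier_coeff (of_real t) (fexp t j) k)"
        by (simp only: integral_mult_right fourier_coeff_def)
      also have "\<dots> = ?c k"
      proof -
        have "k \<in> {- int N..int N}" using N by auto
        then show ?thesis by (simp add: fourier_coeff_fexp if_distrib cong: if_cong)
      qed
      finally show ?thesis .
    qed
    then have "\<forall>\<^sub>F N in sequentially. I N = ?c k" unfolding eventually_sequentially by blast
    then have "I \<longlonglongrightarrow> ?c k" by (rule tendsto_eventually)
    then have "J = ?c k" using IJ(3) LIMSEQ_unique by blast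
    then show ?thesis using IJ(2) by (simp add: fourier_coeff_def integral_unique)
  qed
  have "y x = Y x" if "x \<in> {0..1}" for x
  proof -
    have "y x - Y x = 0"
    proof (rule floquet_fourier_complete[OF _ _ _ that, where y = "\<lambda>x. y x - Y x"])
      show "continuous_on UNIV (\<lambda>x. y x - Y x)" by (intro continuous_intros cont contY)
      show "y (x + 1) - Y (x + 1) = exp (\<i> * of_real t) * (y x - Y x)" for x
        unfolding fl flY by (simp add: algebra_simps)
      fix k
      have "fourier_coeff (of_real t) (\<lambda>x. y x - Y x) k = ?c k - fourier_coeff (of_real t) Y k"
        unfolding fourier_coeff_def left_diff_distrib
        by (intro integral_diff integrable_continuous_real continuous_intros continuous_on_subset[OF cont] continuous_on_subset[OF contY]) auto
      then show "fourier_coeff (of_real t) (\<lambda>x. y x - Y x) k = 0" by (simp add: coeffY)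
    qed
    then show ?thesis by simp
  qed
  then show ?thesis
    using uniform_limit_on_subset[OF lim, of "{0..1}"] uniform_limit_cong'[of "{0..1}" S S Y y]
    unfolding S_def by (metis (mono_tags, lifting) top_greatest)
qed

lemma bessel_single:
  assumes "continuous_on {0..1} y"
  shows "(cmod (fourier_coeff (of_real t) y k))\<^sup>2 \<le> integral {0..1} (\<lambda>x. (cmod (y x))\<^sup>2)"
proof -
  have e: "exp (- \<i> * (2 * of_real pi * of_int k + of_real t) * of_real x) = fexp (- t) (- k) x" for x
    unfolding fexp_def by (rule arg_cong[of _ _ exp]) (simp add: algebra_simps)
  have "(cmod (integral {0..1} (\<lambda>x. y x * fexp (- t) (- k) x)))\<^sup>2
      \<le> integral {0..1} (\<lambda>x. (cmod (y x))\<^sup>2) * integral {0..1} (\<lambda>x::real. (cmod (fexp (- t) (- k) x))\<^sup>2)"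
    by (rule cauchy_schwarz_integral[OF assms]) (intro continuous_intros)
  then show ?thesis unfolding fourier_coeff_def e by simp
qed

text \<open>Without conjugation the exponential of index \<open>k\<close> is paired with that of
  index \<open>- k - m\<close>, because the frequencies \<open>2 pi k + pi m\<close> of the two add
  up to zero. So the integral is the limit of the sums of
  \<open>?c k * ?c (- k - m)\<close>.\<close>

lemma integral_square_partial:
  fixes m :: int
  assumes cont: "continuous_on UNIV y" and fl: "\<And>x. y (x + 1) = exp (\<i> * of_real (pi * m)) * y x"
    and dec: "\<And>k. cmod (fourier_coeff (of_real (pi * m)) y k) * 2 ^ nat \<bar>k\<bar> \<le> C"
    and bound: "\<And>N. (\<Sum>k\<in>{- int N..int N}. cmod (fourier_coeff (of_real (pi * m)) y k)
        * cmod (fourier_coeff (of_real (pi * m)) y (- k - m))) \<le> K"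
  shows "cmod (integral {0..1} (\<lambda>x. (y x)\<^sup>2)) \<le> K"
proof -
  let ?t = "pi * m" and ?c = "fourier_coeff (of_real (pi * m)) y"
  define S where "S N x = (\<Sum>k\<in>{- int N..int N}. ?c k * fexp ?t k x)" for N x
  have c01: "continuous_on {0..1} y" by (rule continuous_on_subset[OF cont]) auto
  have contS: "continuous_on A (S N)" for A N
    unfolding S_def by (intro continuous_intros)
  have lim: "uniform_limit {0..1} S y sequentially"
    unfolding S_def[abs_def] by (rule fourier_expansion[OF cont fl dec])
  have bdy: "bounded (y ` {0..1})" by (intro compact_imp_bounded compact_continuous_image c01) auto
  have ul: "uniform_limit {0..1} (\<lambda>N x. S N x * y x) (\<lambda>x. y x * y x) sequentially"
    by (rule bounded_bilinear.bounded_uniform_limit[OF bounded_bilinear_mult lim uniform_limit_const bdy bdy])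
  have cS: "continuous_on {0..1} (\<lambda>x. S N x * y x)" for N by (intro continuous_intros contS c01)
  obtain I J where IJ: "\<And>N. ((\<lambda>x. S N x * y x) has_integral I N) {0..1}"
        "((\<lambda>x. y x * y x) has_integral J) {0..1}" "I \<longlonglongrightarrow> J"
    by (rule uniform_limit_integral[OF ul cS]) auto
  have "cmod (I N) \<le> K" for N
  proof -
    have e: "fexp ?t k x = exp (- \<i> * (2 * of_real pi * of_int (- k - m) + of_real ?t) * of_real x)" for k x
      unfolding fexp_def by (rule arg_cong[of _ _ exp]) (simp add: algebra_simps)
    have "I N = integral {0..1} (\<lambda>x. \<Sum>k\<in>{- int N..int N}. ?c k * (y x * fexp ?t k x))"
      unfolding integral_unique[OF IJ(1)[of N], symmetric] S_def sum_distrib_right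
      by (intro integral_cong sum.cong refl) (simp only: mult_ac)
    also have "\<dots> = (\<Sum>k\<in>{- int N..int N}. integral {0..1} (\<lambda>x. ?c k * (y x * fexp ?t k x)))"
      by (intro integral_sum integrable_continuous_real continuous_intros c01) auto
    also have "\<dots> = (\<Sum>k\<in>{- int N..int N}. ?c k * ?c (- k - m))"
      unfolding integral_mult_right by (simp only: fourier_coeff_def e)
    finally have "cmod (I N) \<le> (\<Sum>k\<in>{- int N..int N}. cmod (?c k * ?c (- k - m)))" by (simp add: norm_sum)
    also have "\<dots> \<le> K" using bound[of N] by (simp add: norm_mult)
    finally show ?thesis .
  qed
  then have "cmod J \<le> K" using IJ(3) by (intro LIMSEQ_le_const2[OF tendsto_norm]) auto
  then show ?thesis using IJ(2) by (simp add: integral_unique power2_eq_square)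
qed

lemma sum_inverse_squares_bounded:
  obtains K :: real where "K > 0" "\<And>N. (\<Sum>k\<in>{- int N..int N}. 1 / (1 + (of_int k)\<^sup>2)) \<le> K"
proof (rule that[of "1 + (\<Sum>j. 2 * inverse ((real (Suc j))^2))"])
  have sm: "summable (\<lambda>j. 2 * inverse ((real (Suc j))^2))"
    by (intro summable_mult inverse_power_summable[THEN summable_Suc_iff[THEN iffD2]]) simp
  then show "0 < 1 + (\<Sum>j. 2 * inverse ((real (Suc j))^2))"
    by (intro add_pos_nonneg suminf_nonneg) auto
  fix N
  have "(\<Sum>k\<in>{- int N..int N}. 1 / (1 + (of_int k)\<^sup>2) :: real)
      = 1 + (\<Sum>j<N. 1 / (1 + (of_int (int j + 1))\<^sup>2) + 1 / (1 + (of_int (- (int j + 1)))\<^sup>2))"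
    by (subst sum_int_interval) simp
  also have "\<dots> \<le> 1 + (\<Sum>j<N. 2 * inverse ((real (Suc j))^2))"
  proof (intro add_left_mono sum_mono)
    fix j
    have "1 / (1 + (real j + 1)\<^sup>2) \<le> 1 / (real j + 1)\<^sup>2" by (intro divide_left_mono mult_pos_pos) (auto simp: add_pos_pos)
    moreover have "(- 1 - real j)\<^sup>2 = (real j + 1)\<^sup>2" by (simp add: power2_eq_square algebra_simps)
    ultimately show "1 / (1 + (of_int (int j + 1))\<^sup>2) + 1 / (1 + (of_int (- (int j + 1)))\<^sup>2) \<le> 2 * inverse ((real (Suc j))\<^sup>2)"
      by (simp add: divide_inverse add.commute)
  qed
  also have "\<dots> \<le> 1 + (\<Sum>j. 2 * inverse ((real (Suc j))^2))"
    using sm by (intro add_left_mono sum_le_suminf) auto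
  finally show "(\<Sum>k\<in>{- int N..int N}. 1 / (1 + (of_int k)\<^sup>2)) \<le> 1 + (\<Sum>j. 2 * inverse ((real (Suc j))^2))" .
qed

text \<open>At a periodic or antiperiodic eigenvalue the symmetrized coefficients \<open>e\<close> are even or odd up to
  a shift of the index, so the largest one, at \<open>n \<ge> 0\<close>, has a mirror image of the same size.\<close>

lemma symmetric_rec_estimate:
  fixes m :: int
  assumes rec: "floquet_rec g g l (of_real (pi * m)) e" and g: "g \<noteq> 0" and m: "m = 0 \<or> m = 1"
    and bdd: "\<And>k. cmod (e k) \<le> B" and nz: "e k0 \<noteq> 0"
  obtains n :: nat where "e n \<noteq> 0" "\<And>k. cmod (e k) \<le> cmod (e n)" "\<And>k. cmod (e (- k - m)) = cmod (e k)"
    "cmod l \<le> 2 * cmod g + 16 * (2 * real n + 1)\<^sup>2"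
    "\<And>k. (1 + (of_int k)\<^sup>2) * cmod (e k) \<le> (1 + 4 * cmod g + 16 * (2 * real n + 1)\<^sup>2) * cmod (e n)"
proof -
  define w :: "int \<Rightarrow> complex" where "w k = 2 * of_real pi * of_int k + of_real (pi * m)" for k :: int
  have w: "(w k)\<^sup>2 = of_real (pi\<^sup>2 * (of_int (2 * k + m))\<^sup>2)" for k
  proof -
    have "w k = of_real (pi * of_int (2 * k + m))" by (simp add: w_def algebra_simps)
    then show ?thesis by (simp only: of_real_power[symmetric] power_mult_distrib)
  qed
  have rec': "(l - (w k)\<^sup>2) * e k = g * e (k + 1) + g * e (k - 1)" for k
    using rec unfolding floquet_rec_def w_def by blast
  \<comment> \<open>The reflection sends the frequency \<open>w k\<close> to its negative and so
    preserves the recurrence. By uniqueness \<open>f = \<tau> * e\<close>, and as the reflection is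
    an involution, \<open>\<tau> * \<tau> = 1\<close>.\<close>
  define f where "f k = e (- k - m)" for k
  have recf: "floquet_rec g g l (of_real (pi * m)) f"
    unfolding floquet_rec_def
  proof
    fix k
    have "w (- k - m) = - w k" by (simp add: w_def algebra_simps)
    then have "(l - (w k)\<^sup>2) * f k = g * e (- k - m + 1) + g * e (- k - m - 1)"
      using rec'[of "- k - m"] by (simp add: f_def)
    moreover have "- k - m + 1 = - (k - 1) - m" "- k - m - 1 = - (k + 1) - m" by auto
    ultimately show "(l - (2 * of_real pi * of_int k + of_real (pi * m))\<^sup>2) * f k = g * f (k + 1) + g * f (k - 1)"
      unfolding f_def w_def by (simp only: add.commute)
  qed
  obtain \<tau> where \<tau>: "\<And>k. f k = \<tau> * e k"
    using floquet_rec_unique[OF rec recf g bdd _ nz] bdd unfolding f_def by metis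
  have "e k0 = f (- k0 - m)" by (simp add: f_def)
  also have "\<dots> = \<tau> * f k0" unfolding \<tau>[of "- k0 - m"] by (simp add: f_def)
  also have "\<dots> = \<tau> * \<tau> * e k0" by (simp add: \<tau>)
  finally have "\<tau> * \<tau> = 1" using nz by simp
  then have "\<tau> = 1 \<or> \<tau> = -1" using square_eq_1_iff by blast
  then have n\<tau>: "cmod \<tau> = 1" by auto
  have refl: "cmod (e (- k - m)) = cmod (e k)" for k
    using \<tau>[of k] n\<tau> by (simp add: f_def norm_mult)
  obtain C where "\<And>k. cmod (e k) * 2 ^ nat \<bar>k\<bar> \<le> C"
    using floquet_rec_decay[OF rec bdd _ g, of 2] by auto
  then obtain n0 where n0: "\<And>k. cmod (e k) \<le> cmod (e n0)" using decaying_attains_max by metis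
  \<comment> \<open>The nonnegative member of the pair \<open>n0\<close>, \<open>- n0 - m\<close>;
    for \<open>m = 0\<close> or \<open>m = 1\<close> there always is one.\<close>
  define n where "n = nat (if n0 \<ge> 0 then n0 else - n0 - m)"
  have n: "int n = n0 \<or> int n = - n0 - m" using m by (auto simp: n_def)
  then have max: "cmod (e k) \<le> cmod (e n)" for k using n0[of k] refl[of n0] by auto
  have en: "e n \<noteq> 0" using max[of k0] nz by auto
  have frq: "cmod (l - (w n)\<^sup>2) \<le> 2 * cmod g"
    using floquet_rec_frequency[OF rec max en] by (simp add: w_def)
  \<comment> \<open>Source of the constant 16: the crude bound \<open>pi < 4\<close>, while
    \<open>2 * n + m\<close> is at most \<open>2 * n + 1\<close>.\<close>
  have pi2: "pi\<^sup>2 \<le> 16" using power_mono[of pi 4 2] pi_less_4 by simp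
  have wn: "cmod ((w n)\<^sup>2) \<le> 16 * (2 * real n + 1)\<^sup>2"
  proof -
    have "(of_int (2 * int n + m))\<^sup>2 \<le> (2 * real n + 1)\<^sup>2" using m by (intro power_mono) auto
    then have "pi\<^sup>2 * (of_int (2 * int n + m))\<^sup>2 \<le> 16 * (2 * real n + 1)\<^sup>2" using pi2 by (intro mult_mono) auto
    then show ?thesis unfolding w norm_of_real by simp
  qed
  have l: "cmod l \<le> 2 * cmod g + 16 * (2 * real n + 1)\<^sup>2"
    using norm_triangle_ineq2[of l "(w n)\<^sup>2"] frq wn by linarith
  \<comment> \<open>The weight \<open>1 + k^2\<close> makes the coefficients summable over
    \<open>k\<close> at the price of a constant that is only quadratic in \<open>n\<close>.\<close>
  have "(1 + (of_int k)\<^sup>2) * cmod (e k) \<le> (1 + 4 * cmod g + 16 * (2 * real n + 1)\<^sup>2) * cmod (e n)" for k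
  proof -
    have "\<bar>k\<bar> \<le> \<bar>2 * k + m\<bar>" using m by auto
    then have "(of_int k)\<^sup>2 \<le> (of_int (2 * k + m) :: real)\<^sup>2" by (metis abs_le_square_iff of_int_abs of_int_le_iff)
    also have "\<dots> \<le> pi\<^sup>2 * (of_int (2 * k + m))\<^sup>2"
      using pi_ge_two power_mono[of 1 pi 2] by (simp add: mult_le_cancel_right1)
    also have "\<dots> = cmod ((w k)\<^sup>2)" unfolding w norm_of_real by simp
    also have "\<dots> \<le> cmod l + cmod (l - (w k)\<^sup>2)"
      using norm_triangle_ineq4[of l "l - (w k)\<^sup>2"] by simp
    finally have k2: "(of_int k)\<^sup>2 \<le> cmod l + cmod (l - (w k)\<^sup>2)" .
    have "cmod (l - (w k)\<^sup>2) * cmod (e k) = cmod (g * e (k + 1) + g * e (k - 1))"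
      unfolding rec'[symmetric] by (simp add: norm_mult)
    also have "\<dots> \<le> cmod g * cmod (e (k + 1)) + cmod g * cmod (e (k - 1))"
      using norm_triangle_ineq[of "g * e (k + 1)" "g * e (k - 1)"] by (simp add: norm_mult)
    also have "\<dots> \<le> cmod g * cmod (e n) + cmod g * cmod (e n)" by (intro add_mono mult_left_mono max) auto
    finally have 1: "cmod (l - (w k)\<^sup>2) * cmod (e k) \<le> 2 * cmod g * cmod (e n)" by simp
    have "(1 + (of_int k)\<^sup>2) * cmod (e k) \<le> (1 + cmod l + cmod (l - (w k)\<^sup>2)) * cmod (e k)"
      using k2 by (intro mult_right_mono) auto
    also have "\<dots> = (1 + cmod l) * cmod (e k) + cmod (l - (w k)\<^sup>2) * cmod (e k)" by (simp add: distrib_right)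
    also have "\<dots> \<le> (1 + cmod l) * cmod (e n) + 2 * cmod g * cmod (e n)"
      using 1 max[of k] by (intro add_mono mult_left_mono) auto
    also have "\<dots> = (1 + cmod l + 2 * cmod g) * cmod (e n)" by (simp add: algebra_simps)
    also have "\<dots> \<le> (1 + 4 * cmod g + 16 * (2 * real n + 1)\<^sup>2) * cmod (e n)"
      using l by (intro mult_right_mono) auto
    finally show ?thesis .
  qed
  then show thesis using that[of n] en max refl l by blast
qed

lemma exponential_beats_quadratic:
  fixes \<sigma> :: real
  assumes "\<sigma> > 1"
  shows "\<forall>\<^sub>F n in sequentially. A * (B + 16 * (2 * real n + 1)\<^sup>2) < \<sigma> ^ (2 * n)"
proof -
  have "(\<lambda>n. A * (B + 16 * (2 * real n + 1)\<^sup>2) / \<sigma> ^ (2 * n)) \<longlonglongrightarrow> 0"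
    using assms by real_asymp
  then have "\<forall>\<^sub>F n in sequentially. A * (B + 16 * (2 * real n + 1)\<^sup>2) / \<sigma> ^ (2 * n) < 1"
    by (rule order_tendstoD) simp
  then show ?thesis
  proof eventually_elim
    case (elim n)
    then show ?case using assms by (simp add: divide_less_eq)
  qed
qed

text \<open>In the products \<open>?c k * ?c (- k - m)\<close> the powers of \<open>s\<close> cancel
  up to \<open>s powi (- m)\<close>, so the integral of \<open>y^2\<close> is controlled by the
  symmetrized coefficients alone. A single coefficient, bounded through Bessel's inequality, keeps
  the full factor \<open>\<sigma> ^ n\<close> and bounds the norm from below.\<close>

lemma mathieu_periodic_estimate:
  assumes a: "a \<noteq> 0" and b: "b \<noteq> 0" and ab: "cmod a \<noteq> cmod b" and L: "0 \<le> L"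
  obtains R where "\<And>l y dy r. R < cmod l \<Longrightarrow> r = 1 \<or> r = -1 \<Longrightarrow> hill_sol (mathieu_potential a b) l y dy \<Longrightarrow>
      y 1 = r * y 0 \<Longrightarrow> dy 1 = r * dy 0 \<Longrightarrow> y 0 \<noteq> 0 \<or> dy 0 \<noteq> 0 \<Longrightarrow>
      L * cmod (integral {0..1} (\<lambda>x. (y x)\<^sup>2)) < integral {0..1} (\<lambda>x. (cmod (y x))\<^sup>2)"
proof -
  obtain s g where s: "s \<noteq> 0" "a * s = g" "b = g * s" "g \<noteq> 0" "cmod s = 1 \<longleftrightarrow> cmod a = cmod b"
    using ex_symmetrizer[OF a b] by metis
  define \<sigma> where "\<sigma> = max (cmod s) (inverse (cmod s))"
  have s0: "0 < cmod s" using s(1) by simp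
  have \<sigma>: "\<sigma> > 1"
  proof (cases "cmod s > 1")
    case False
    then have "cmod s < 1" using s(5) ab by linarith
    then show ?thesis using s0 by (simp add: \<sigma>_def one_less_inverse less_max_iff_disj)
  qed (simp add: \<sigma>_def)
  obtain K :: real where K: "K > 0" "\<And>N. (\<Sum>k\<in>{- int N..int N}. 1 / (1 + (of_int k)\<^sup>2)) \<le> K"
    by (rule sum_inverse_squares_bounded) blast
  obtain n1 where n1: "\<And>n. n \<ge> n1 \<Longrightarrow> (L * \<sigma> * K) * ((1 + 4 * cmod g) + 16 * (2 * real n + 1)\<^sup>2) < \<sigma> ^ (2 * n)"
    using exponential_beats_quadratic[OF \<sigma>, of "L * \<sigma> * K" "1 + 4 * cmod g"] unfolding eventually_sequentially by blast
  show thesis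
  proof (rule that)
    fix l y dy and r :: complex
    assume R: "2 * cmod g + 16 * (2 * real n1 + 1)\<^sup>2 < cmod l" and r: "r = 1 \<or> r = -1"
      and sol: "hill_sol (mathieu_potential a b) l y dy" and fl: "y 1 = r * y 0" "dy 1 = r * dy 0"
      and nz: "y 0 \<noteq> 0 \<or> dy 0 \<noteq> 0"
    define m :: int where "m = (if r = 1 then 0 else 1)"
    have m: "m = 0 \<or> m = 1" by (simp add: m_def)
    have er: "exp (\<i> * of_real (pi * m)) = r" using r by (auto simp: m_def)
    let ?c = "fourier_coeff (of_real (pi * m)) y"
    define e where "e k = ?c k * s powi (- k)" for k
    have cont: "continuous_on S y" for S by (rule mathieu.hill_sol_continuous[OF sol])
    have flx: "y (x + 1) = exp (\<i> * of_real (pi * m)) * y x" for x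
      unfolding er by (rule mathieu.floquet[OF sol fl])
    have rec: "floquet_rec a b l (of_real (pi * m)) ?c"
      by (rule mathieu_fourier_rec[OF sol]) (simp_all only: er fl)
    obtain B where B: "\<And>k. cmod (?c k) \<le> B" using fourier_coeff_bounded[OF cont] by metis
    obtain C where C: "\<And>k. cmod (?c k) * 2 ^ nat \<bar>k\<bar> \<le> C"
      using floquet_rec_decay[OF rec B _ a, of 2] by auto
    obtain B' where B': "\<And>k. cmod (e k) \<le> B'" using symmetrized_bounded[OF rec B a s(1)] unfolding e_def by metis
    have rece: "floquet_rec g g l (of_real (pi * m)) e"
      unfolding e_def by (rule floquet_rec_symmetrize[OF rec s(1-3)])
    obtain k0 where k0: "?c k0 \<noteq> 0"
      using floquet_fourier_complete[OF cont flx] mathieu.hill_sol_nonzero[OF sol nz] by blast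
    then have "e k0 \<noteq> 0" using s by (simp add: e_def)
    from symmetric_rec_estimate[OF rece s(4) m B' this]
    obtain n :: nat where n: "e n \<noteq> 0" "\<And>k. cmod (e k) \<le> cmod (e n)" "\<And>k. cmod (e (- k - m)) = cmod (e k)"
      "cmod l \<le> 2 * cmod g + 16 * (2 * real n + 1)\<^sup>2"
      "\<And>k. (1 + (of_int k)\<^sup>2) * cmod (e k) \<le> (1 + 4 * cmod g + 16 * (2 * real n + 1)\<^sup>2) * cmod (e n)" by blast
    define P where "P = 1 + 4 * cmod g + 16 * (2 * real n + 1)\<^sup>2"
    define E where "E = cmod (e n)"
    have E: "0 < E" using n(1) by (simp add: E_def)
    have P: "0 < P" unfolding P_def by (simp add: add_pos_nonneg)
    have ek: "cmod (e k) \<le> P * E * (1 / (1 + (of_int k)\<^sup>2))" for k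
    proof -
      have "0 < 1 + (real_of_int k)\<^sup>2" by (simp add: add_pos_nonneg)
      then show ?thesis using n(5)[of k] by (simp add: P_def E_def field_simps)
    qed
    have ce: "cmod (?c k) = cmod (e k) * cmod s powi k" for k
    proof -
      have "?c k = e k * s powi k" using s(1) by (simp add: e_def power_int_minus)
      then show ?thesis by (simp only: norm_mult norm_power_int)
    qed
    \<comment> \<open>\<open>cmod l\<close> is bounded by a quadratic in \<open>n\<close>, so a
      large \<open>l\<close> forces a large peak index.\<close>
    have "n1 \<le> n"
    proof (rule ccontr)
      assume "\<not> n1 \<le> n"
      then have "16 * (2 * real n + 1)\<^sup>2 \<le> 16 * (2 * real n1 + 1)\<^sup>2" by (intro mult_left_mono power_mono) auto
      then show False using n(4) R by linarith
    qed
    from n1[OF this] have grow: "L * (\<sigma> * K * P) < \<sigma> ^ (2 * n)" by (simp add: P_def mult_ac add_ac)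
    have sm: "cmod s powi (- m) \<le> \<sigma>" using m \<sigma> by (auto simp: \<sigma>_def power_int_minus)
    have E2: "cmod (e (- k - m)) = cmod (e k)" for k by (rule n(3))
    have eE: "cmod (e k) \<le> E" for k using n(2) by (simp add: E_def)
    have up: "cmod (integral {0..1} (\<lambda>x. (y x)\<^sup>2)) \<le> \<sigma> * (P * E * E) * K"
    proof (rule integral_square_partial[OF cont flx C])
      fix N
      have "(\<Sum>k\<in>{- int N..int N}. cmod (?c k) * cmod (?c (- k - m)))
          \<le> (\<Sum>k\<in>{- int N..int N}. \<sigma> * (P * E * E) * (1 / (1 + (of_int k)\<^sup>2)))"
      proof (intro sum_mono)
        fix k
        have "cmod s powi k * cmod s powi (- k - m) = cmod s powi (- m)"
          using s0 by (simp add: power_int_add[symmetric])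
        then have "cmod (?c k) * cmod (?c (- k - m)) = cmod (e k) * cmod (e k) * cmod s powi (- m)"
          unfolding ce E2 by (simp add: mult_ac)
        also have "\<dots> \<le> (P * E * (1 / (1 + (of_int k)\<^sup>2))) * E * \<sigma>"
          using ek eE sm s0 P E by (intro mult_mono) auto
        finally show "cmod (?c k) * cmod (?c (- k - m)) \<le> \<sigma> * (P * E * E) * (1 / (1 + (of_int k)\<^sup>2))"
          by (simp only: mult_ac)
      qed
      also have "\<dots> = \<sigma> * (P * E * E) * (\<Sum>k\<in>{- int N..int N}. 1 / (1 + (of_int k)\<^sup>2))"
        by (simp only: sum_distrib_left)
      also have "\<dots> \<le> \<sigma> * (P * E * E) * K"
        using \<sigma> P E by (intro mult_left_mono K) auto
      finally show "(\<Sum>k\<in>{- int N..int N}. cmod (?c k) * cmod (?c (- k - m))) \<le> \<sigma> * (P * E * E) * K" .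
    qed
    show "L * cmod (integral {0..1} (\<lambda>x. (y x)\<^sup>2)) < integral {0..1} (\<lambda>x. (cmod (y x))\<^sup>2)"
    proof -
      have "L * cmod (integral {0..1} (\<lambda>x. (y x)\<^sup>2)) \<le> L * (\<sigma> * (P * E * E) * K)"
        by (intro mult_left_mono up L)
      also have "\<dots> = (L * (\<sigma> * K * P)) * E\<^sup>2" by (simp add: power2_eq_square mult_ac)
      also have "\<dots> < \<sigma> ^ (2 * n) * E\<^sup>2" using grow E by (intro mult_strict_right_mono) auto
      also have "\<dots> = (E * \<sigma> ^ n)\<^sup>2" by (simp add: power_mult_distrib power_mult[symmetric] mult.commute)
      also have "\<dots> \<le> integral {0..1} (\<lambda>x. (cmod (y x))\<^sup>2)"
      proof -
        \<comment> \<open>The peak at \<open>n\<close> is the amplified one if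
          \<open>cmod s \<ge> 1\<close>; otherwise it is the mirror image at \<open>- n - m\<close>,
          where the additional factor \<open>\<sigma> powi m\<close> is at least 1.\<close>
        have "\<exists>k. E * \<sigma> ^ n \<le> cmod (?c k)"
        proof (cases "cmod s \<ge> 1")
          case True
          then have "\<sigma> = cmod s" using s0 by (simp add: \<sigma>_def inverse_le_1_iff max_def)
             (metis dual_order.trans inverse_le_1_iff order_antisym)
          then show ?thesis using ce[of n] by (intro exI[of _ "int n"]) (simp add: E_def)
        next
          case False
          then have \<sigma>s: "\<sigma> = inverse (cmod s)" using \<sigma> by (auto simp: \<sigma>_def max_def split: if_splits)
          have "cmod s powi (- int n - m) = \<sigma> ^ n * \<sigma> powi m"
            unfolding \<sigma>s using s0 by (simp add: power_int_diff power_int_minus power_int_inverse power_inverse field_simps)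
          moreover have "1 \<le> \<sigma> powi m" using m \<sigma> by auto
          ultimately have "\<sigma> ^ n * 1 \<le> cmod s powi (- int n - m)"
            using \<sigma> by (simp add: mult_left_mono)
          then have "E * \<sigma> ^ n \<le> E * cmod s powi (- int n - m)" using E by simp
          then show ?thesis using ce[of "- int n - m"] E2[of "int n"] by (intro exI[of _ "- int n - m"]) (simp add: E_def)
        qed
        then obtain k where "E * \<sigma> ^ n \<le> cmod (?c k)" by blast
        then have "(E * \<sigma> ^ n)\<^sup>2 \<le> (cmod (?c k))\<^sup>2" using E \<sigma> by (intro power_mono) auto
        then show ?thesis using bessel_single[OF cont, of "pi * m" k] by linarith
      qed
      finally show ?thesis .
    qed
  qed
qed

section \<open>Passage from the exceptional points to arcs of simple eigenvalues\<close>

section \<open>The Floquet solutions normalized at the origin\<close>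

context hill_potential
begin

definition dPhi :: "real \<Rightarrow> complex \<Rightarrow> real \<Rightarrow> complex" where
  "dPhi t l x = dtheta l x + (cis t - theta q l 1) / phi q l 1 * dphi l x"

lemma Phi_sol: "hill_sol q l (Phi q t l) (dPhi t l)"
  using hill_sol_add[OF theta_sol phi_sol, of l 1 "(cis t - theta q l 1) / phi q l 1"]
  by (simp add: Phi_def[abs_def] dPhi_def[abs_def])

lemma Phi_0 [simp]: "Phi q t l 0 = 1"
  by (simp add: Phi_def)

lemma Phi_1: "phi q l 1 \<noteq> 0 \<Longrightarrow> Phi q t l 1 = cis t"
  by (simp add: Phi_def)

lemma characteristic_equation:
  assumes "hill_F q l = 2 * of_real (cos t)"
  shows "(cis t)\<^sup>2 - hill_F q l * cis t + 1 = 0"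
proof -
  have "hill_F q l = cis t + cis (- t)" unfolding assms by (simp add: complex_eq_iff)
  moreover have "cis (- t) * cis t = 1" by (simp add: cis_mult)
  ultimately show ?thesis by (simp add: power2_eq_square distrib_right)
qed

lemma dPhi_1:
  assumes F: "hill_F q l = 2 * of_real (cos t)" and ph: "phi q l 1 \<noteq> 0"
  shows "dPhi t l 1 = cis t * dPhi t l 0"
proof -
  have c: "cis t * cis t = (theta q l 1 + dphi l 1) * cis t - 1"
    using characteristic_equation[OF F] unfolding hill_F_eq power2_eq_square by algebra
  have "phi q l 1 * dtheta l 1 + (cis t - theta q l 1) * dphi l 1 = cis t * (cis t - theta q l 1)"
    using wronskian[of l 1] c by algebra
  then show ?thesis using ph by (simp add: dPhi_def field_simps)
qed

lemma Phi_floquet: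
  assumes "hill_F q l = 2 * of_real (cos t)" "phi q l 1 \<noteq> 0"
  shows "Phi q t l (x + 1) = cis t * Phi q t l x"
  by (rule floquet[OF Phi_sol]) (use Phi_1 dPhi_1 assms in auto)

lemma Phi_unique:
  assumes y: "hill_sol q l y dy" "y 1 = cis t * y 0" and ph: "phi q l 1 \<noteq> 0"
  shows "y x = y 0 * Phi q t l x"
proof -
  have "y 0 * theta q l 1 + dy 0 * phi q l 1 = cis t * y 0" using hill_sol_eq(1)[OF y(1), of 1] y(2) by simp
  then have d: "dy 0 = y 0 * ((cis t - theta q l 1) / phi q l 1)" using ph by (simp add: field_simps)
  have "y x = y 0 * theta q l x + dy 0 * phi q l x" by (rule hill_sol_eq(1)[OF y(1)])
  then show ?thesis unfolding d by (simp add: Phi_def algebra_simps)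
qed

lemma Phi_continuous [continuous_intros]:
  assumes "continuous_on S f" "continuous_on S g" "continuous_on S h" "\<And>p. p \<in> S \<Longrightarrow> phi q (g p) 1 \<noteq> 0"
  shows "continuous_on S (\<lambda>p. Phi q (f p) (g p) (h p))"
  unfolding Phi_def using assms(4)
  by (intro continuous_intros assms(1-3) ballI) auto

text \<open>The solution with initial vector \<open>(M - r) (u, v)\<close>, where \<open>M\<close>
  is the monodromy matrix. In contrast to \<open>Phi\<close> there is no division by
  \<open>phi q l 1\<close>, so it stays continuous where that vanishes.\<close>

definition floquet_vector :: "complex \<Rightarrow> complex \<Rightarrow> complex \<Rightarrow> complex \<Rightarrow> real \<Rightarrow> complex" where
  "floquet_vector u v r l x = ((theta q l 1 - r) * u + phi q l 1 * v) * theta q l x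
     + (dtheta l 1 * u + (dphi l 1 - r) * v) * phi q l x"

definition dfloquet_vector :: "complex \<Rightarrow> complex \<Rightarrow> complex \<Rightarrow> complex \<Rightarrow> real \<Rightarrow> complex" where
  "dfloquet_vector u v r l x = ((theta q l 1 - r) * u + phi q l 1 * v) * dtheta l x
     + (dtheta l 1 * u + (dphi l 1 - r) * v) * dphi l x"

lemma floquet_vector_sol: "hill_sol q l (floquet_vector u v r l) (dfloquet_vector u v r l)"
  using hill_sol_add[OF theta_sol phi_sol] by (simp add: floquet_vector_def[abs_def] dfloquet_vector_def[abs_def])

text \<open>Cayley-Hamilton: the image of \<open>M - r\<close> is the eigenspace of the monodromy matrix \<open>M\<close> for the
  multiplier \<open>1 / r\<close>.\<close>

lemma floquet_vector_multiplier:
  assumes "r * r' = 1" "hill_F q l = r + r'"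
  shows "floquet_vector u v r l 1 = r' * floquet_vector u v r l 0"
    and "dfloquet_vector u v r l 1 = r' * dfloquet_vector u v r l 0"
proof -
  have W: "theta q l 1 * dphi l 1 - dtheta l 1 * phi q l 1 = 1" by (rule wronskian)
  have F: "theta q l 1 + dphi l 1 = r + r'" using assms(2) unfolding hill_F_eq .
  show "floquet_vector u v r l 1 = r' * floquet_vector u v r l 0"
    unfolding floquet_vector_def init using W F assms(1) by algebra
  show "dfloquet_vector u v r l 1 = r' * dfloquet_vector u v r l 0"
    unfolding dfloquet_vector_def init using W F assms(1) by algebra
qed

lemma floquet_vector_continuous [continuous_intros]:
  assumes "continuous_on S f" "continuous_on S g" "continuous_on S h"
  shows "continuous_on S (\<lambda>p. floquet_vector u v (f p) (g p) (h p))"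
  unfolding floquet_vector_def by (intro continuous_intros assms)

end

lemma entire_zeros_isolated:
  assumes "f holomorphic_on UNIV" "f w \<noteq> 0"
  shows "\<exists>r>0. \<forall>z\<in>ball \<xi> r - {\<xi>}. f z \<noteq> (0::complex)"
proof (cases "f \<xi> = 0")
  case True
  then show ?thesis using isolated_zeros[OF assms(1) open_UNIV connected_UNIV UNIV_I True UNIV_I assms(2)] by metis
next
  case False
  have "isCont f \<xi>" using assms(1) holomorphic_on_imp_continuous_on continuous_on_eq_continuous_at by blast
  from continuous_at_avoid[OF this False] obtain e where "0 < e" "\<forall>y. dist \<xi> y < e \<longrightarrow> f y \<noteq> 0" by auto
  then show ?thesis by (intro exI[of _ e]) auto
qed

lemma mathieu_deriv_F_nonzero:
  assumes "a \<noteq> 0" shows "\<exists>w. deriv (hill_F (mathieu_potential a b)) w \<noteq> 0"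
proof (rule ccontr)
  let ?F = "hill_F (mathieu_potential a b)"
  assume "\<not> ?thesis"
  then have "(?F has_field_derivative 0) (at z)" for z
    using holomorphic_derivI[OF mathieu.hill_F_holomorphic[of a b UNIV] open_UNIV UNIV_I, of z] by metis
  then obtain c where c: "\<And>z. ?F z = c"
    using has_field_derivative_zero_constant[of UNIV ?F] by (metis UNIV_I convex_UNIV has_field_derivative_at_within)
  have "cmod c + 1 \<le> cmod (?F (of_real (- (cmod a + cmod b) - (cmod c + 1)\<^sup>2)))"
    by (rule mathieu_unbounded_left[OF assms]) auto
  then show False by (simp add: c)
qed

lemma norm_mathieu_potential: "cmod (mathieu_potential a b x) \<le> cmod a + cmod b"
  unfolding mathieu_potential_def
  by (rule order_trans[OF norm_triangle_ineq]) (simp add: norm_mult norm_exp_eq_Re)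

text \<open>For \<open>l\<close> to the left of the range of \<open>q\<close> the real part of \<open>\<phi>' cnj \<phi>\<close> is increasing.\<close>

lemma mathieu_phi_nonzero: "phi (mathieu_potential a b) (of_real (- (cmod a + cmod b))) 1 \<noteq> 0"
proof
  define l :: complex where "l = of_real (- (cmod a + cmod b))"
  let ?q = "mathieu_potential a b"
  let ?ph = "phi ?q l" and ?d = "mathieu.dphi a b l"
  assume "phi ?q (of_real (- (cmod a + cmod b))) 1 = 0"
  then have z: "?ph 1 = 0" by (simp add: l_def)
  define E where "E x = Re (?d x * cnj (?ph x))" for x
  define E' where "E' x = (cmod (?d x))\<^sup>2 + Re (?q x - l) * (cmod (?ph x))\<^sup>2" for x
  have d1: "(?ph has_vector_derivative ?d x) (at x)" and d2: "(?d has_vector_derivative (?q x - l) * ?ph x) (at x)" for x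
    using mathieu.phi_sol[of a b l] unfolding hill_sol_def by auto
  have dE: "(E has_real_derivative E' x) (at x)" for x
  proof -
    have "((\<lambda>x. ?d x * cnj (?ph x)) has_vector_derivative (?d x * cnj (?d x) + (?q x - l) * ?ph x * cnj (?ph x))) (at x)"
      by (intro has_vector_derivative_mult has_vector_derivative_cnj d1 d2)
    then have "((\<lambda>x. Re (?d x * cnj (?ph x))) has_vector_derivative Re (?d x * cnj (?d x) + (?q x - l) * ?ph x * cnj (?ph x))) (at x)"
      by (rule bounded_linear.has_vector_derivative[OF bounded_linear_Re])
    moreover have "Re (?d x * cnj (?d x) + (?q x - l) * ?ph x * cnj (?ph x)) = E' x"
      unfolding E'_def mult.assoc complex_norm_square[symmetric] by simp
    ultimately show ?thesis unfolding E_def[abs_def] by (simp add: has_real_derivative_iff_has_vector_derivative)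
  qed
  have nonneg: "0 \<le> E' x" for x
  proof -
    have "\<bar>Re (?q x)\<bar> \<le> cmod a + cmod b" using abs_Re_le_cmod norm_mathieu_potential order_trans by blast
    then have "0 \<le> Re (?q x - l)" by (simp add: l_def)
    then show ?thesis by (simp add: E'_def)
  qed
  have "0 < E' 0" by (simp add: E'_def)
  from DERIV_pos_inc_right[OF dE this] obtain e where e: "e > 0" "\<And>h. 0 < h \<Longrightarrow> h < e \<Longrightarrow> E 0 < E (0 + h)" by blast
  define h where "h = min (e / 2) 1"
  have h: "0 < h" "h < e" "h \<le> 1" using e(1) by (auto simp: h_def)
  have "E 0 < E h" using e(2)[OF h(1,2)] by simp
  also have "E h \<le> E 1" by (rule DERIV_nonneg_imp_nondecreasing[OF h(3)]) (use dE nonneg in blast)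
  finally show False by (simp add: E_def z)
qed

section \<open>Regular arcs with nearly orthogonal eigenfunctions\<close>

text \<open>One object for both conclusions. The last inequality is what makes the projections have
  norm at least \<open>L\<close>; it is free of quotients and square roots. A single
  \<open>Q\<close> isolates the eigenvalue for all \<open>t\<close> of the interval at once, since
  an essential supremum sees only sets of positive measure.\<close>

definition isolating_arc ::
  "(real \<Rightarrow> complex) \<Rightarrow> real \<Rightarrow> real \<Rightarrow> (complex \<Rightarrow> complex) \<Rightarrow> real \<Rightarrow> real \<Rightarrow> complex set \<Rightarrow> bool" where
  "isolating_arc q L R lam \<alpha> \<beta> Q \<longleftrightarrow>
     regular_spectral_arc q lam \<alpha> \<beta> \<and> 0 < \<alpha> \<and> \<beta> < pi \<and>
     Q \<in> half_closed_rectangles \<and> Q \<subseteq> {z. cmod z > R} \<and>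
     (\<forall>t\<in>{\<alpha>..\<beta>}. lam (of_real t) \<in> Q \<and> (\<forall>z\<in>Q. hill_F q z = 2 * of_real (cos t) \<longrightarrow> z = lam (of_real t)) \<and>
        phi q (lam (of_real t)) 1 \<noteq> 0 \<and>
        (L * cmod (integral {0..1} (\<lambda>x. Phi q t (lam (of_real t)) x * Phi q (- t) (lam (of_real t)) x)))\<^sup>2
          < integral {0..1} (\<lambda>x. (cmod (Phi q t (lam (of_real t)) x))\<^sup>2)
            * integral {0..1} (\<lambda>x. (cmod (Phi q (- t) (lam (of_real t)) x))\<^sup>2))"

lemma half_closed_rectangle_nbhd:
  fixes z :: complex
  assumes "r > 0"
  obtains Q d where "Q \<in> half_closed_rectangles" "Q \<subseteq> ball z r" "d > 0" "ball z d \<subseteq> Q"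
proof (rule that)
  let ?Q = "{w. Re z - r / 4 < Re w \<and> Re w \<le> Re z + r / 4 \<and> Im z - r / 4 < Im w \<and> Im w \<le> Im z + r / 4}"
  show "?Q \<in> half_closed_rectangles" unfolding half_closed_rectangles_def by blast
  show "?Q \<subseteq> ball z r"
  proof
    fix w assume "w \<in> ?Q"
    then have "Re z - r / 4 < Re w \<and> Re w \<le> Re z + r / 4 \<and> Im z - r / 4 < Im w \<and> Im w \<le> Im z + r / 4" by simp
    then have "\<bar>Re (w - z)\<bar> \<le> r / 4" "\<bar>Im (w - z)\<bar> \<le> r / 4" unfolding minus_complex.sel by linarith+
    then have "cmod (w - z) \<le> r / 2" using cmod_le[of "w - z"] by linarith
    then show "w \<in> ball z r" using assms by (simp add: dist_norm norm_minus_commute)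
  qed
  show "0 < r / 4" using assms by simp
  show "ball z (r / 4) \<subseteq> ?Q"
  proof
    fix w assume "w \<in> ball z (r / 4)"
    then have "cmod (w - z) < r / 4" by (simp add: dist_norm norm_minus_commute)
    then have "\<bar>Re (w - z)\<bar> < r / 4" "\<bar>Im (w - z)\<bar> < r / 4"
      using abs_Re_le_cmod[of "w - z"] abs_Im_le_cmod[of "w - z"] by linarith+
    then have "Re z - r / 4 < Re w \<and> Re w \<le> Re z + r / 4 \<and> Im z - r / 4 < Im w \<and> Im w \<le> Im z + r / 4"
      unfolding minus_complex.sel by linarith
    then show "w \<in> ?Q" by simp
  qed
qed

text \<open>The signs are opposite because \<open>M - cis (- t)\<close> maps into the eigenspace of
  \<open>M\<close> for the multiplier \<open>cis t\<close>.\<close>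

lemma (in hill_potential) floquet_vector_eq_Phi:
  assumes F: "hill_F q l = 2 * of_real (cos t)" and ph: "phi q l 1 \<noteq> 0"
  shows "floquet_vector u v (cis (- t)) l x = floquet_vector u v (cis (- t)) l 0 * Phi q t l x"
proof (rule Phi_unique[OF floquet_vector_sol _ ph])
  show "floquet_vector u v (cis (- t)) l 1 = cis t * floquet_vector u v (cis (- t)) l 0"
    by (rule floquet_vector_multiplier) (use F in \<open>simp_all add: cis_mult complex_eq_iff\<close>)
qed

text \<open>Both sides scale by the same factor \<open>(cmod (A * B))^2\<close>. The strict
  inequality in the hypothesis permits its cancellation, although \<open>A\<close> and
  \<open>B\<close> might vanish a priori.\<close>

lemma (in hill_potential) gram_floquet_vector:
  assumes F: "hill_F q l = 2 * of_real (cos t)" and ph: "phi q l 1 \<noteq> 0"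
    and gram: "(L * cmod (integral {0..1} (\<lambda>x. floquet_vector u v (cis (- t)) l x * floquet_vector u v (cis t) l x)))\<^sup>2
      < integral {0..1} (\<lambda>x. (cmod (floquet_vector u v (cis (- t)) l x))\<^sup>2)
        * integral {0..1} (\<lambda>x. (cmod (floquet_vector u v (cis t) l x))\<^sup>2)"
  shows "(L * cmod (integral {0..1} (\<lambda>x. Phi q t l x * Phi q (- t) l x)))\<^sup>2
      < integral {0..1} (\<lambda>x. (cmod (Phi q t l x))\<^sup>2) * integral {0..1} (\<lambda>x. (cmod (Phi q (- t) l x))\<^sup>2)"
proof -
  define A where "A = floquet_vector u v (cis (- t)) l 0"
  define B where "B = floquet_vector u v (cis t) l 0"
  have A: "floquet_vector u v (cis (- t)) l x = A * Phi q t l x" for x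
    unfolding A_def by (rule floquet_vector_eq_Phi[OF F ph])
  have B: "floquet_vector u v (cis t) l x = B * Phi q (- t) l x" for x
    using floquet_vector_eq_Phi[of l "- t" u v x] F ph by (simp add: B_def)
  have "(\<lambda>x. floquet_vector u v (cis (- t)) l x * floquet_vector u v (cis t) l x)
      = (\<lambda>x. (A * B) * (Phi q t l x * Phi q (- t) l x))" unfolding A B by (simp add: mult_ac)
  then have 1: "integral {0..1} (\<lambda>x. floquet_vector u v (cis (- t)) l x * floquet_vector u v (cis t) l x)
      = (A * B) * integral {0..1} (\<lambda>x. Phi q t l x * Phi q (- t) l x)" by (simp only: integral_mult_right)
  let ?G = "integral {0..1} (\<lambda>x. (cmod (Phi q t l x))\<^sup>2) * integral {0..1} (\<lambda>x. (cmod (Phi q (- t) l x))\<^sup>2)"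
  have "(cmod (A * B))\<^sup>2 * (L * cmod (integral {0..1} (\<lambda>x. Phi q t l x * Phi q (- t) l x)))\<^sup>2 < (cmod (A * B))\<^sup>2 * ?G"
    using gram unfolding 1 unfolding A B norm_mult power_mult_distrib integral_mult_right by (simp only: mult_ac)
  then show ?thesis by (rule mult_left_less_imp_less) simp
qed

text \<open>Near an eigenvalue \<open>l0\<close> of large modulus with \<open>F l0 = \<plusminus>2\<close> the ratio of \<open>\<integral>\<Phi>\<^sub>+\<Phi>\<^sub>-\<close> to the norms is small
  by continuity, and \<open>F\<close> is open at \<open>l0\<close>, so it takes values \<open>2 cos t\<close> at points of \<open>F' \<noteq> 0\<close> nearby.\<close>

lemma mathieu_good_point:
  assumes a: "a \<noteq> 0" and b: "b \<noteq> 0" and ab: "cmod a \<noteq> cmod b" and L: "0 \<le> L"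
  obtains U :: "complex set" and T :: "real set" and t1 l1 where
    "open U" "open T" "l1 \<in> U" "t1 \<in> T" "T \<subseteq> {0<..<pi}" "U \<subseteq> {z. cmod z > R}"
    "hill_F (mathieu_potential a b) l1 = 2 * of_real (cos t1)"
    "\<And>l. l \<in> U \<Longrightarrow> deriv (hill_F (mathieu_potential a b)) l \<noteq> 0"
    "\<And>l. l \<in> U \<Longrightarrow> phi (mathieu_potential a b) l 1 \<noteq> 0"
    "\<And>l t. l \<in> U \<Longrightarrow> t \<in> T \<Longrightarrow> hill_F (mathieu_potential a b) l = 2 * of_real (cos t) \<Longrightarrow>
      (L * cmod (integral {0..1} (\<lambda>x. Phi (mathieu_potential a b) t l x * Phi (mathieu_potential a b) (- t) l x)))\<^sup>2
      < integral {0..1} (\<lambda>x. (cmod (Phi (mathieu_potential a b) t l x))\<^sup>2)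
        * integral {0..1} (\<lambda>x. (cmod (Phi (mathieu_potential a b) (- t) l x))\<^sup>2)"
proof -
  let ?q = "mathieu_potential a b"
  let ?F = "hill_F ?q" and ?fv = "hill_potential.floquet_vector ?q (mathieu_coeff a b)"
  obtain R0 where R0: "\<And>l y dy r. R0 < cmod l \<Longrightarrow> r = 1 \<or> r = -1 \<Longrightarrow> hill_sol ?q l y dy \<Longrightarrow>
      y 1 = r * y 0 \<Longrightarrow> dy 1 = r * dy 0 \<Longrightarrow> y 0 \<noteq> 0 \<or> dy 0 \<noteq> 0 \<Longrightarrow>
      L * cmod (integral {0..1} (\<lambda>x. (y x)\<^sup>2)) < integral {0..1} (\<lambda>x. (cmod (y x))\<^sup>2)"
    by (rule mathieu_periodic_estimate[OF a b ab L]) (rule that)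
  obtain l0 where l0: "max R R0 < cmod l0" "?F l0 = 2 \<or> ?F l0 = -2"
    using mathieu_large_eigenvalue[OF a, of "max R R0" b] by blast
  define t0 where "t0 = (if ?F l0 = 2 then 0 else pi)"
  define r where "r = cis t0"
  have r: "r = 1 \<or> r = -1" "cis (- t0) = r" "r * r = 1" "?F l0 = r + r"
    using l0(2) by (auto simp: t0_def r_def complex_eq_iff)
  have F0: "?F l0 = 2 * of_real (cos t0)" using l0(2) by (auto simp: t0_def)
  define y where "y u v = ?fv u v r l0" for u v
  define dy where "dy u v = hill_potential.dfloquet_vector ?q (mathieu_coeff a b) u v r l0" for u v
  \<comment> \<open>If \<open>M - r\<close> annihilated every vector, \<open>M\<close> would be
    \<open>r\<close> times the identity: coexistence.\<close>
  have "\<exists>u v. y u v 0 \<noteq> 0 \<or> dy u v 0 \<noteq> 0"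
  proof (rule ccontr)
    assume "\<not> ?thesis"
    then have *: "y u v 0 = 0" "dy u v 0 = 0" for u v by auto
    show False
      using mathieu_no_coexistence[OF a b, of r l0] r(1) *(1)[of 1 0] *(1)[of 0 1] *(2)[of 1 0] *(2)[of 0 1]
      by (auto simp: y_def dy_def mathieu.floquet_vector_def mathieu.dfloquet_vector_def)
  qed
  then obtain u v where uv: "y u v 0 \<noteq> 0 \<or> dy u v 0 \<noteq> 0" by blast
  have est: "L * cmod (integral {0..1} (\<lambda>x. (y u v x)\<^sup>2)) < integral {0..1} (\<lambda>x. (cmod (y u v x))\<^sup>2)"
  proof (rule R0[where l = l0 and r = r and dy = "dy u v"])
    show "r = 1 \<or> r = - 1" "y u v 0 \<noteq> 0 \<or> dy u v 0 \<noteq> 0" by (rule r(1) uv)+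
    show "R0 < cmod l0" using l0 by simp
    show "hill_sol ?q l0 (y u v) (dy u v)" unfolding y_def dy_def by (rule mathieu.floquet_vector_sol)
    show "y u v 1 = r * y u v 0" unfolding y_def by (rule mathieu.floquet_vector_multiplier[OF r(3,4)])
    show "dy u v 1 = r * dy u v 0" unfolding dy_def by (rule mathieu.floquet_vector_multiplier[OF r(3,4)])
  qed
  \<comment> \<open>The difference of the two sides of the desired inequality. At
    \<open>(l0, t0)\<close> both Floquet vectors are \<open>y u v\<close>, so it is positive there
    by the periodic estimate, and then in a neighbourhood by continuity.\<close>
  define G where "G p = integral {0..1} (\<lambda>x. (cmod (?fv u v (cis (- snd p)) (fst p) x))\<^sup>2)
        * integral {0..1} (\<lambda>x. (cmod (?fv u v (cis (snd p)) (fst p) x))\<^sup>2)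
      - (L * cmod (integral {0..1} (\<lambda>x. ?fv u v (cis (- snd p)) (fst p) x * ?fv u v (cis (snd p)) (fst p) x)))\<^sup>2" for p
  have contG: "continuous_on UNIV G"
  proof -
    have 1: "continuous_on (UNIV \<times> cbox 0 1) (\<lambda>(p, x). (cmod (?fv u v (cis (c * snd p)) (fst p) x))\<^sup>2)" for c
      unfolding split_def by (intro continuous_intros)
    have 2: "continuous_on (UNIV \<times> cbox 0 1) (\<lambda>(p, x). ?fv u v (cis (- snd p)) (fst p) x * ?fv u v (cis (snd p)) (fst p) x)"
      unfolding split_def by (intro continuous_intros)
    note I = integral_continuous_on_param[OF 1, of "-1", simplified] integral_continuous_on_param[OF 1, of 1, simplified]
      integral_continuous_on_param[OF 2, simplified]
    show ?thesis unfolding G_def[abs_def] by (intro continuous_intros I)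
  qed
  have G0: "0 < G (l0, t0)"
  proof -
    have "(L * cmod (integral {0..1} (\<lambda>x. (y u v x)\<^sup>2)))\<^sup>2 < (integral {0..1} (\<lambda>x. (cmod (y u v x))\<^sup>2))\<^sup>2"
      using L by (intro power_strict_mono est) auto
    then show ?thesis by (simp add: G_def y_def r(2) r_def[symmetric] power2_eq_square)
  qed
  have oG: "open {p. 0 < G p}" by (intro open_Collect_less contG continuous_on_const)
  obtain A T0 where AT': "open A" "open T0" "(l0, t0) \<in> A \<times> T0" "A \<times> T0 \<subseteq> {p. 0 < G p}"
    by (rule open_prod_elim[OF oG, of "(l0, t0)"]) (use G0 in simp, rule that)
  then have AT: "open A" "open T0" "l0 \<in> A" "t0 \<in> T0" "A \<times> T0 \<subseteq> {p. 0 < G p}" by auto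
  obtain w where w: "deriv ?F w \<noteq> 0" using mathieu_deriv_F_nonzero[OF a] by blast
  then obtain r1 where r1: "r1 > 0" "\<And>z. z \<in> ball l0 r1 - {l0} \<Longrightarrow> deriv ?F z \<noteq> 0"
    using entire_zeros_isolated[OF holomorphic_deriv[OF mathieu.hill_F_holomorphic open_UNIV] w, of l0] by blast
  obtain r2 where r2: "r2 > 0" "\<And>z. z \<in> ball l0 r2 - {l0} \<Longrightarrow> phi ?q z 1 \<noteq> 0"
    using entire_zeros_isolated[OF mathieu.sol_holomorphic(2) mathieu_phi_nonzero, of l0 a b] by blast
  have oR: "open {z::complex. R < cmod z}" by (intro open_Collect_less continuous_intros)
  define V where "V = A \<inter> {z. R < cmod z} \<inter> ball l0 r1 \<inter> ball l0 r2"
  have V: "open V" "l0 \<in> V" using AT oR l0 r1(1) r2(1) by (auto simp: V_def)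
  obtain r3 where r3: "r3 > 0" "ball l0 r3 \<subseteq> V" using V open_contains_ball by blast
  have "open (?F ` ball l0 r3)"
  proof (rule open_mapping_thm[of _ UNIV])
    show "?F holomorphic_on UNIV" by (rule mathieu.hill_F_holomorphic)
    show "\<not> ?F constant_on UNIV"
    proof
      assume "?F constant_on UNIV"
      then obtain c where "\<And>z. ?F z = c" unfolding constant_on_def by auto
      then have "?F = (\<lambda>z. c)" by auto
      then show False using w by simp
    qed
  qed auto
  moreover have "continuous_on UNIV (\<lambda>t. 2 * complex_of_real (cos t))" by (intro continuous_intros)
  ultimately have "open ((\<lambda>t. 2 * complex_of_real (cos t)) -` (?F ` ball l0 r3))"
    using open_vimage by blast
  moreover have "t0 \<in> (\<lambda>t. 2 * complex_of_real (cos t)) -` (?F ` ball l0 r3)"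
    using F0 r3(1) by (auto intro!: image_eqI[of _ _ l0])
  ultimately obtain d where d: "d > 0" "ball t0 d \<subseteq> T0 \<inter> (\<lambda>t. 2 * complex_of_real (cos t)) -` (?F ` ball l0 r3)"
    using AT(2,4) by (metis IntI open_Int open_contains_ball)
  \<comment> \<open>A step from the endpoint 0 or \<open>pi\<close> into the open interval. There
    \<open>cos t1 \<noteq> cos t0\<close>, which keeps \<open>l1\<close> away from
    \<open>l0\<close>, where \<open>F'\<close> or \<open>phi ?q l 1\<close> may vanish.\<close>
  define t1 where "t1 = (if t0 = 0 then min (d/2) 1 else pi - min (d/2) 1)"
  have t1: "0 < t1" "t1 < pi" "t1 \<in> ball t0 d"
    using d(1) pi_gt3 by (auto simp: t1_def t0_def dist_real_def split: if_splits)
  obtain l1 where l1: "l1 \<in> ball l0 r3" "?F l1 = 2 * of_real (cos t1)" using d(2) t1(3) by force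
  have "l1 \<noteq> l0"
  proof
    assume "l1 = l0"
    then have "cos t1 = cos t0" using l1(2) F0 by simp
    then have "t1 = t0" using t1 by (intro cos_inj_pi[of t1 t0]) (auto simp: t0_def)
    then show False using t1 by (auto simp: t0_def split: if_splits)
  qed
  show thesis
  proof (rule that[of "V - {l0}" "T0 \<inter> {0<..<pi}" l1 t1])
    show "open (V - {l0})" using V by (simp add: open_delete)
    show "open (T0 \<inter> {0<..<pi})" using AT by auto
    show "l1 \<in> V - {l0}" using l1 r3 \<open>l1 \<noteq> l0\<close> by auto
    show "t1 \<in> T0 \<inter> {0<..<pi}" using t1 d(2) by auto
    show "?F l1 = 2 * of_real (cos t1)" by (rule l1)
    fix l assume l: "l \<in> V - {l0}"
    show "deriv ?F l \<noteq> 0" by (rule r1) (use l in \<open>auto simp: V_def\<close>)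
    show ph: "phi ?q l 1 \<noteq> 0" by (rule r2) (use l in \<open>auto simp: V_def\<close>)
    fix t assume t: "t \<in> T0 \<inter> {0<..<pi}" and F: "?F l = 2 * of_real (cos t)"
    have "(l, t) \<in> A \<times> T0" using l t by (auto simp: V_def)
    then have "0 < G (l, t)" using AT(5) by blast
    then show "(L * cmod (integral {0..1} (\<lambda>x. Phi ?q t l x * Phi ?q (- t) l x)))\<^sup>2
      < integral {0..1} (\<lambda>x. (cmod (Phi ?q t l x))\<^sup>2) * integral {0..1} (\<lambda>x. (cmod (Phi ?q (- t) l x))\<^sup>2)"
      by (intro mathieu.gram_floquet_vector[OF F ph, of L u v]) (simp add: G_def)
  qed (auto simp: V_def)
qed

text \<open>The arc is \<open>2 * cos\<close> followed by a local inverse of \<open>F\<close> at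
  \<open>l1\<close>. The rectangle lies in a disc on which \<open>F\<close> is injective, which
  gives the uniqueness in \<open>Q\<close>, and it contains a smaller disc which the arc does not
  leave.\<close>

lemma mathieu_isolating_arc:
  assumes a: "a \<noteq> 0" and b: "b \<noteq> 0" and ab: "cmod a \<noteq> cmod b" and L: "0 \<le> L"
  obtains lam \<alpha> \<beta> Q where "isolating_arc (mathieu_potential a b) L R lam \<alpha> \<beta> Q"
proof -
  let ?q = "mathieu_potential a b"
  let ?F = "hill_F ?q"
  obtain U :: "complex set" and T :: "real set" and t1 l1 where
    UT: "open U" "open T" "l1 \<in> U" "t1 \<in> T" "T \<subseteq> {0<..<pi}" "U \<subseteq> {z. cmod z > R}"
    and F1: "?F l1 = 2 * of_real (cos t1)"
    and dF: "\<And>l. l \<in> U \<Longrightarrow> deriv ?F l \<noteq> 0"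
    and ph: "\<And>l. l \<in> U \<Longrightarrow> phi ?q l 1 \<noteq> 0"
    and gram: "\<And>l t. l \<in> U \<Longrightarrow> t \<in> T \<Longrightarrow> ?F l = 2 * of_real (cos t) \<Longrightarrow>
      (L * cmod (integral {0..1} (\<lambda>x. Phi ?q t l x * Phi ?q (- t) l x)))\<^sup>2
      < integral {0..1} (\<lambda>x. (cmod (Phi ?q t l x))\<^sup>2) * integral {0..1} (\<lambda>x. (cmod (Phi ?q (- t) l x))\<^sup>2)"
    by (rule mathieu_good_point[OF a b ab L, of R]) (rule that)
  have hol: "?F holomorphic_on S" for S by (rule mathieu.hill_F_holomorphic)
  obtain r where r: "r > 0" "ball l1 r \<subseteq> U" "open (?F ` ball l1 r)" "inj_on ?F (ball l1 r)"
    using has_complex_derivative_locally_invertible[OF hol UT(3,1) dF[OF UT(3)]] by blast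
  obtain g where g: "g holomorphic_on (?F ` ball l1 r)" "\<And>z. z \<in> ball l1 r \<Longrightarrow> g (?F z) = z"
    using holomorphic_has_inverse[OF hol open_ball r(4)] by metis
  obtain Q d where Q: "Q \<in> half_closed_rectangles" "Q \<subseteq> ball l1 r" "d > 0" "ball l1 d \<subseteq> Q"
    using half_closed_rectangle_nbhd[OF r(1)] by metis
  have dr: "ball l1 d \<subseteq> ball l1 r" using Q by blast
  have oF: "open (?F ` ball l1 d)"
    by (rule open_mapping_thm3[OF hol open_ball inj_on_subset[OF r(4) dr]])
  have imF: "?F ` ball l1 d \<subseteq> ?F ` ball l1 r" using dr by blast
  define lam where "lam z = g (2 * cos z)" for z
  have "open ((\<lambda>t. 2 * complex_of_real (cos t)) -` (?F ` ball l1 d))"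
    by (intro open_vimage oF continuous_intros)
  then have "open (T \<inter> (\<lambda>t. 2 * complex_of_real (cos t)) -` (?F ` ball l1 d))" using UT by auto
  moreover have "t1 \<in> T \<inter> (\<lambda>t. 2 * complex_of_real (cos t)) -` (?F ` ball l1 d)"
    using UT F1 Q(3) by (auto intro!: image_eqI[of _ _ l1])
  ultimately obtain e where e: "e > 0" "cball t1 e \<subseteq> T \<inter> (\<lambda>t. 2 * complex_of_real (cos t)) -` (?F ` ball l1 d)"
    using open_contains_cball by meson
  define \<alpha> where "\<alpha> = t1 - e"
  define \<beta> where "\<beta> = t1 + e"
  have ab: "\<alpha> < \<beta>" "{\<alpha>..\<beta>} = cball t1 e" using e(1) by (auto simp: \<alpha>_def \<beta>_def cball_eq_atLeastAtMost)
  have mem: "t \<in> T" "2 * complex_of_real (cos t) \<in> ?F ` ball l1 d" if "t \<in> {\<alpha>..\<beta>}" for t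
    using e(2) that unfolding ab(2) by auto
  have lam: "lam (of_real t) \<in> ball l1 d" "?F (lam (of_real t)) = 2 * of_real (cos t)" if t: "t \<in> {\<alpha>..\<beta>}" for t
  proof -
    obtain z where z: "z \<in> ball l1 d" "2 * complex_of_real (cos t) = ?F z" using mem(2)[OF t] by blast
    then have "lam (of_real t) = z" using g(2)[of z] dr by (auto simp: lam_def cos_of_real)
    then show "lam (of_real t) \<in> ball l1 d" "?F (lam (of_real t)) = 2 * of_real (cos t)" using z by auto
  qed
  \<comment> \<open>An open set of complex parameters, since analyticity on the real segment means
    holomorphy in a complex neighbourhood of it.\<close>
  define W where "W = (\<lambda>z. 2 * cos z) -` (?F ` ball l1 r)"
  have W: "open W" unfolding W_def by (intro open_vimage r continuous_intros)
  have lamh: "lam holomorphic_on W"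
  proof -
    have "g \<circ> (\<lambda>z. 2 * cos z) holomorphic_on W"
      by (rule holomorphic_on_compose_gen[OF _ g(1)]) (auto simp: W_def intro!: holomorphic_intros)
    then show ?thesis by (simp add: lam_def[abs_def] o_def)
  qed
  have FW: "?F (lam z) = 2 * cos z" if "z \<in> W" for z
    using that g(2) by (auto simp: W_def lam_def)
  have im: "complex_of_real ` {\<alpha>..\<beta>} \<subseteq> W"
  proof
    fix z assume "z \<in> complex_of_real ` {\<alpha>..\<beta>}"
    then obtain t where t: "t \<in> {\<alpha>..\<beta>}" "z = of_real t" by blast
    have "2 * complex_of_real (cos t) \<in> ?F ` ball l1 r" using mem(2)[OF t(1)] imF by blast
    then show "z \<in> W" by (simp add: W_def t(2) cos_of_real)
  qed
  have pos: "0 < t" "t < pi" if "t \<in> {\<alpha>..\<beta>}" for t using mem(1)[OF that] UT(5) by auto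
  have arc: "regular_spectral_arc ?q lam \<alpha> \<beta>"
    unfolding regular_spectral_arc_def
  proof (intro conjI ballI)
    show "continuous_on (complex_of_real ` {\<alpha>..\<beta>}) lam"
      by (rule continuous_on_subset[OF holomorphic_on_imp_continuous_on[OF lamh] im])
    show "lam analytic_on (complex_of_real ` {\<alpha>..\<beta>})"
      using W lamh im unfolding analytic_on_holomorphic by blast
    fix t assume t: "t \<in> {\<alpha>..\<beta>}"
    then show "?F (lam (of_real t)) = 2 * of_real (cos t)" by (rule lam)
    show "deriv ?F (lam (of_real t)) \<noteq> 0" using dF lam(1)[OF t] dr r(2) by blast
  next
    fix t assume "t \<in> {\<alpha><..<\<beta>}"
    then have t: "t \<in> {\<alpha>..\<beta>}" by auto
    then have tW: "of_real t \<in> W" using im by blast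
    \<comment> \<open>Differentiating \<open>F (lam z) = 2 * cos z\<close>: a zero of the derivative
      would give \<open>sin t = 0\<close>, impossible for \<open>0 < t < pi\<close>.\<close>
    show "deriv lam (of_real t) \<noteq> 0"
    proof
      assume z: "deriv lam (of_real t) = 0"
      have "(lam has_field_derivative 0) (at (of_real t))"
        using holomorphic_derivI[OF lamh W tW] z by simp
      moreover have "(?F has_field_derivative deriv ?F (lam (of_real t))) (at (lam (of_real t)))"
        by (rule holomorphic_derivI[OF hol[of UNIV]]) auto
      ultimately have "((\<lambda>z. ?F (lam z)) has_field_derivative deriv ?F (lam (of_real t)) * 0) (at (of_real t))"
        by (intro DERIV_chain2)
      then have "((\<lambda>z. ?F (lam z)) has_field_derivative 0) (at (of_real t))" by simp
      then have "((\<lambda>z. 2 * cos z) has_field_derivative 0) (at (of_real t :: complex))"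
        by (rule has_field_derivative_transform_within_open[OF _ W tW]) (rule FW)
      moreover have "((\<lambda>z. 2 * cos z) has_field_derivative - 2 * sin (of_real t)) (at (of_real t :: complex))"
        by (auto intro!: derivative_eq_intros)
      ultimately have "sin (complex_of_real t) = 0" using DERIV_unique by fastforce
      then have "sin t = 0" by (simp add: sin_of_real)
      then show False using pos[OF t] sin_gt_zero by fastforce
    qed
  qed (rule ab)
  have "isolating_arc ?q L R lam \<alpha> \<beta> Q"
    unfolding isolating_arc_def
  proof (intro conjI arc Q(1) ballI impI)
    show "0 < \<alpha>" "\<beta> < pi" by (rule pos, use ab(1) in simp)+
    show "Q \<subseteq> {z. cmod z > R}" using Q r UT by blast
    fix t assume t: "t \<in> {\<alpha>..\<beta>}"
    have lU: "lam (of_real t) \<in> U" using lam(1)[OF t] dr r by blast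
    show "lam (of_real t) \<in> Q" using lam(1)[OF t] Q by blast
    show "phi ?q (lam (of_real t)) 1 \<noteq> 0" by (rule ph[OF lU])
    show "(L * cmod (integral {0..1} (\<lambda>x. Phi ?q t (lam (of_real t)) x * Phi ?q (- t) (lam (of_real t)) x)))\<^sup>2
          < integral {0..1} (\<lambda>x. (cmod (Phi ?q t (lam (of_real t)) x))\<^sup>2)
            * integral {0..1} (\<lambda>x. (cmod (Phi ?q (- t) (lam (of_real t)) x))\<^sup>2)"
      by (rule gram[OF lU mem(1)[OF t] lam(2)[OF t]])
    fix z assume z: "z \<in> Q" "?F z = 2 * of_real (cos t)"
    then have "?F z = ?F (lam (of_real t))" using lam(2)[OF t] by simp
    then show "z = lam (of_real t)" using r(4) z(1) lam(1)[OF t] Q(2) dr by (meson inj_onD subsetD)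
  qed
  then show thesis by (rule that)
qed

section \<open>Lower bound for the norm of the projection of an arc\<close>

section \<open>Square norms of continuous functions\<close>

lemma integrable_lebesgue_on_continuous:
  fixes f :: "real \<Rightarrow> 'a::euclidean_space"
  assumes "continuous_on {u..v} f"
  shows "integrable (lebesgue_on {u..v}) f"
  by (rule continuous_imp_integrable_real[OF assms])

lemma sq_norm_continuous:
  assumes "continuous_on {u..v} f"
  shows "sq_norm (lebesgue_on {u..v}) f = ennreal (integral {u..v} (\<lambda>x. (cmod (f x))\<^sup>2))"
proof -
  have c: "continuous_on {u..v} (\<lambda>x. (cmod (f x))\<^sup>2)" by (intro continuous_intros assms)
  have "sq_norm (lebesgue_on {u..v}) f = ennreal (integral\<^sup>L (lebesgue_on {u..v}) (\<lambda>x. (cmod (f x))\<^sup>2))"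
    unfolding sq_norm_def by (rule nn_integral_eq_integral[OF integrable_lebesgue_on_continuous[OF c]]) auto
  also have "integral\<^sup>L (lebesgue_on {u..v}) (\<lambda>x. (cmod (f x))\<^sup>2) = integral {u..v} (\<lambda>x. (cmod (f x))\<^sup>2)"
    by (rule lebesgue_integral_eq_integral[OF integrable_lebesgue_on_continuous[OF c]]) auto
  finally show ?thesis .
qed

lemma sq_norm_restrict:
  assumes "S \<in> sets lebesgue"
  shows "sq_norm lebesgue (\<lambda>x. if x \<in> S then f x else 0) = sq_norm (lebesgue_on S) f"
  unfolding sq_norm_def using assms
  by (subst nn_integral_restrict_space) (auto intro!: nn_integral_cong simp: indicator_def)

lemma sq_norm_lebesgue_on_le:
  assumes "S \<in> sets lebesgue"
  shows "sq_norm (lebesgue_on S) f \<le> sq_norm lebesgue f"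
  unfolding sq_norm_def using assms
  by (subst nn_integral_restrict_space) (auto intro!: nn_integral_mono simp: indicator_def)

lemma restricted_continuous_L2:
  assumes c: "continuous_on {u..v} f"
  shows "(\<lambda>x. if x \<in> {u..v} then f x else 0) \<in> L2_bounded_support"
proof -
  have "(\<lambda>x. if x \<in> {u..v} then f x else 0) \<in> borel_measurable lebesgue"
    by (intro borel_measurable_if_I borel_measurable_integrable integrable_lebesgue_on_continuous c) auto
  moreover have "integrable lebesgue (\<lambda>x. (cmod (if x \<in> {u..v} then f x else 0))\<^sup>2)"
  proof -
    have "integrable (lebesgue_on {u..v}) (\<lambda>x. (cmod (f x))\<^sup>2)"
      by (intro integrable_lebesgue_on_continuous continuous_intros c)
    then have "integrable lebesgue (\<lambda>x. if x \<in> {u..v} then (cmod (f x))\<^sup>2 else 0)"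
      by (subst Lebesgue_Measure.integrable_restrict_UNIV) auto
    moreover have "(\<lambda>x. (cmod (if x \<in> {u..v} then f x else 0))\<^sup>2) = (\<lambda>x. if x \<in> {u..v} then (cmod (f x))\<^sup>2 else 0)"
      by auto
    ultimately show ?thesis by simp
  qed
  moreover have "bounded {x. (if x \<in> {u..v} then f x else 0) \<noteq> 0}"
    by (rule bounded_subset[of "{u..v}"]) auto
  ultimately show ?thesis by (simp add: L2_bounded_support_def L2_def)
qed

lemma continuous_L2:
  assumes c: "continuous_on {u..v} f"
  shows "f \<in> L2 (lebesgue_on {u..v})"
  unfolding L2_def using assms
  by (auto intro!: borel_measurable_integrable integrable_lebesgue_on_continuous continuous_intros)

text \<open>An infinite constant satisfies the claim trivially, so only real constants
  \<open>k\<close> remain to be tested.\<close>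

lemma op_norm_ge:
  assumes "\<And>k. 0 \<le> k \<Longrightarrow> (\<And>f. f \<in> D \<Longrightarrow> sq_norm M (T f) \<le> (ennreal k)\<^sup>2 * sq_norm M f) \<Longrightarrow> L \<le> k"
  shows "ennreal L \<le> op_norm M D T"
  unfolding op_norm_def
proof (rule Inf_greatest)
  fix K assume "K \<in> {K. \<forall>f\<in>D. sq_norm M (T f) \<le> K\<^sup>2 * sq_norm M f}"
  then show "ennreal L \<le> K" using assms by (cases K) auto
qed

section \<open>Concentration of the Fejer kernel on an interval\<close>

text \<open>The arc shifted by \<open>- t1\<close> lies in \<open>{-pi..pi}\<close>. Extension by 0
  can destroy continuity only at the two ends, away from the point of concentration.\<close>

lemma fejer_limit_interval:
  fixes \<kappa> :: "real \<Rightarrow> complex"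
  assumes c: "continuous_on {\<alpha>..\<beta>} \<kappa>" and t: "\<alpha> < t1" "t1 < \<beta>" "\<beta> - t1 \<le> pi" "t1 - \<alpha> \<le> pi"
  shows "(\<lambda>N. integral {\<alpha>..\<beta>} (\<lambda>t. of_real (fejer N (t - t1)) * \<kappa> t)) \<longlonglongrightarrow> 2 * of_real pi * \<kappa> t1"
proof -
  define h where "h s = (if s \<in> {\<alpha> - t1..\<beta> - t1} then \<kappa> (s + t1) else 0)" for s
  have cs: "continuous_on {\<alpha> - t1..\<beta> - t1} (\<lambda>s. \<kappa> (s + t1))"
    by (rule continuous_on_compose2[OF c]) (auto intro!: continuous_intros)
  have eq: "(\<lambda>s. of_real (fejer N s) * h s)
      = (\<lambda>s. if s \<in> {\<alpha> - t1..\<beta> - t1} then of_real (fejer N s) * \<kappa> (s + t1) else 0)" for N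
    by (auto simp: h_def)
  have ci: "continuous_on {\<alpha> - t1..\<beta> - t1} (\<lambda>s. of_real (fejer N s) * \<kappa> (s + t1))" for N
    by (intro continuous_intros cs)
  have hi: "((\<lambda>s. of_real (fejer N s) * h s) has_integral integral {\<alpha> - t1..\<beta> - t1} (\<lambda>s. of_real (fejer N s) * \<kappa> (s + t1))) {-pi..pi}" for N
    unfolding eq using t
    by (subst has_integral_restrict) (auto intro!: integrable_integral integrable_continuous_real ci)
  have shift: "integral {\<alpha> - t1..\<beta> - t1} (\<lambda>s. of_real (fejer N s) * \<kappa> (s + t1))
      = integral {\<alpha>..\<beta>} (\<lambda>t. of_real (fejer N (t - t1)) * \<kappa> t)" for N
    using integral_shift_Icc_real[of "\<alpha> - t1" "\<beta> - t1" "\<lambda>t. of_real (fejer N (t - t1)) * \<kappa> t" t1]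
    by (simp add: o_def add.commute)
  obtain B where B: "\<And>s. s \<in> {\<alpha>..\<beta>} \<Longrightarrow> cmod (\<kappa> s) \<le> B"
    using compact_imp_bounded[OF compact_continuous_image[OF c compact_Icc]] by (meson bounded_iff image_eqI)
  have B0: "0 \<le> B" by (rule order_trans[OF norm_ge_zero B[of t1]]) (use t in auto)
  have "(\<lambda>N. integral {-pi..pi} (\<lambda>s. of_real (fejer N s) * h s)) \<longlonglongrightarrow> 2 * of_real pi * h 0"
  proof (rule fejer_limit)
    show "(\<lambda>s. of_real (fejer N s) * h s) integrable_on {-pi..pi}" for N using hi by blast
    show "cmod (h s) \<le> B" for s using B[of "s + t1"] B0 by (auto simp: h_def)
    have "continuous_on {\<alpha> - t1<..<\<beta> - t1} h"
      by (rule continuous_on_eq[OF continuous_on_subset[OF cs]]) (auto simp: h_def)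
    then show "isCont h 0" using t by (auto simp: continuous_on_eq_continuous_at)
  qed
  moreover have "h 0 = \<kappa> t1" using t by (simp add: h_def)
  ultimately show ?thesis using integral_unique[OF hi] by (simp add: shift)
qed

text \<open>For the cross term of the arc projection: the kernel centred at \<open>- t1\<close> is
  of order \<open>1 / N\<close> on an interval that avoids \<open>- t1\<close> modulo
  \<open>2 * pi\<close>.\<close>

lemma fejer_vanish_interval:
  fixes \<kappa> :: "real \<Rightarrow> complex"
  assumes c: "continuous_on {\<alpha>..\<beta>} \<kappa>" and t: "\<alpha> \<le> \<beta>" and ne: "\<And>t. t \<in> {\<alpha>..\<beta>} \<Longrightarrow> cos (t + t1) \<noteq> 1"
  shows "(\<lambda>N. integral {\<alpha>..\<beta>} (\<lambda>t. of_real (fejer N (t + t1)) * \<kappa> t)) \<longlonglongrightarrow> 0"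
proof -
  have "continuous_on {\<alpha>..\<beta>} (\<lambda>t. 4 / (2 - 2 * cos (t + t1)) * cmod (\<kappa> t))"
    using ne by (intro continuous_intros c) auto
  then obtain B where B: "\<And>t. t \<in> {\<alpha>..\<beta>} \<Longrightarrow> norm (4 / (2 - 2 * cos (t + t1)) * cmod (\<kappa> t)) \<le> B"
    using compact_imp_bounded[OF compact_continuous_image[OF _ compact_Icc]] by (meson bounded_iff image_eqI)
  have "norm (integral {\<alpha>..\<beta>} (\<lambda>t. of_real (fejer N (t + t1)) * \<kappa> t)) \<le> (B * (\<beta> - \<alpha>)) * inverse (real N)" for N
  proof -
    have "norm (integral {\<alpha>..\<beta>} (\<lambda>t. of_real (fejer N (t + t1)) * \<kappa> t)) \<le> B / real N * (\<beta> - \<alpha>)"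
    proof (rule integral_bound[OF t])
      show "continuous_on {\<alpha>..\<beta>} (\<lambda>t. of_real (fejer N (t + t1)) * \<kappa> t)" by (intro continuous_intros c)
      fix s assume s: "s \<in> {\<alpha>..\<beta>}"
      have "fejer N (s + t1) * cmod (\<kappa> s) \<le> 4 / (real N * (2 - 2 * cos (s + t1))) * cmod (\<kappa> s)"
        by (intro mult_right_mono fejer_le ne s) auto
      also have "\<dots> = (4 / (2 - 2 * cos (s + t1)) * cmod (\<kappa> s)) / real N" by simp
      also have "\<dots> \<le> B / real N"
      proof (intro divide_right_mono)
        show "4 / (2 - 2 * cos (s + t1)) * cmod (\<kappa> s) \<le> B" by (rule order_trans[OF abs_ge_self B[OF s, unfolded real_norm_def]])
      qed auto
      finally show "norm (of_real (fejer N (s + t1)) * \<kappa> s) \<le> B / real N"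
        using fejer_nonneg by (simp add: norm_mult)
    qed
    then show ?thesis by (simp add: divide_inverse mult_ac)
  qed
  moreover have "(\<lambda>N. (B * (\<beta> - \<alpha>)) * inverse (real N)) \<longlonglongrightarrow> 0"
    by (intro tendsto_mult_right_zero lim_inverse_n)
  ultimately show ?thesis by (rule Lim_null_comparison[OF always_eventually[OF allI]])
qed

lemma integral_multiplier:
  fixes g :: "real \<Rightarrow> complex"
  assumes c: "continuous_on UNIV g" and g: "\<And>x. g (x + 1) = \<rho> * g x"
  shows "integral {0..real N} g = (\<Sum>k<N. \<rho> ^ k) * integral {0..1} g"
proof (induction N)
  case (Suc N)
  have gk: "g (x + real k) = \<rho> ^ k * g x" for x k
  proof (induction k)
    case (Suc k)
    have "g (x + real (Suc k)) = g (x + real k + 1)" by (simp add: add_ac)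
    then show ?case using Suc g[of "x + real k"] by simp
  qed simp
  have int: "g integrable_on {u..v}" for u v
    by (rule integrable_continuous_real[OF continuous_on_subset[OF c]]) auto
  have "integral {0..real (Suc N)} g = integral {0..real N} g + integral {real N..real (Suc N)} g"
    by (rule Henstock_Kurzweil_Integration.integral_combine[symmetric]) (auto intro: int)
  also have "integral {real N..real (Suc N)} g = integral {0..1} (\<lambda>x. g (x + real N))"
    using integral_shift_Icc_real[of 0 1 g "real N"] by (simp add: o_def add.commute)
  also have "\<dots> = \<rho> ^ N * integral {0..1} g" unfolding gk by simp
  finally show ?case using Suc by (simp add: algebra_simps)
qed simp

section \<open>The derivative of the discriminant\<close>

context hill_potential
begin

lemma lagrange_identity:
  assumes F: "hill_F q l = 2 * of_real (cos t)" and ph: "phi q l 1 \<noteq> 0"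
  shows "hill_F q z - hill_F q l = (l - z) * integral {0..1}
     (\<lambda>x. Phi q t l x * (phi q z 1 * theta q z x + (cis (- t) - theta q z 1) * phi q z x))"
proof -
  \<comment> \<open>At \<open>z = l\<close> this is \<open>phi q l 1 * Phi q (- t) l\<close>.
    Cleared of the denominator it exists for all \<open>z\<close>, and although it is in general no
    Floquet solution for \<open>z \<noteq> l\<close>, the boundary terms combine to the difference
    of the discriminants.\<close>
  define X where "X x = phi q z 1 * theta q z x + (cis (- t) - theta q z 1) * phi q z x" for x
  define dX where "dX x = phi q z 1 * dtheta z x + (cis (- t) - theta q z 1) * dphi z x" for x
  have X: "hill_sol q z X dX"
    unfolding X_def[abs_def] dX_def[abs_def] by (rule hill_sol_add[OF theta_sol phi_sol])
  define H where "H x = Phi q t l x * dX x - dPhi t l x * X x" for x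
  have "((\<lambda>x. (l - z) * (Phi q t l x * X x)) has_integral (H 1 - H 0)) {0..1}"
  proof (rule fundamental_theorem_of_calculus)
    fix x :: real
    have "(H has_vector_derivative (Phi q t l x * ((q x - z) * X x) + dPhi t l x * dX x
        - (dPhi t l x * dX x + (q x - l) * Phi q t l x * X x))) (at x)"
      unfolding H_def using X Phi_sol[of l t] unfolding hill_sol_def
      by (intro has_vector_derivative_diff has_vector_derivative_mult) auto
    then have "(H has_vector_derivative (l - z) * (Phi q t l x * X x)) (at x)" by (simp add: algebra_simps)
    then show "(H has_vector_derivative (l - z) * (Phi q t l x * X x)) (at x within {0..1})"
      by (rule has_vector_derivative_at_within)
  qed auto
  moreover have "H 1 - H 0 = hill_F q z - hill_F q l"
  proof -
    have c: "cis t * cis (- t) = 1" by (simp add: cis_mult)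
    have Fl: "hill_F q l = cis t + cis (- t)" unfolding F by (simp add: complex_eq_iff)
    have W: "theta q z 1 * dphi z 1 - dtheta z 1 * phi q z 1 = 1" by (rule wronskian)
    have "X 1 = cis (- t) * phi q z 1" by (simp add: X_def algebra_simps)
    moreover have "dX 1 = cis (- t) * dphi z 1 - 1" unfolding dX_def using W by algebra
    moreover have "X 0 = phi q z 1" "dX 0 = cis (- t) - theta q z 1" by (simp_all add: X_def dX_def)
    ultimately show ?thesis
      unfolding H_def Phi_1[OF ph] dPhi_1[OF F ph] Phi_0 Fl hill_F_eq[of z] using c by algebra
  qed
  ultimately show ?thesis unfolding X_def by (metis integral_mult_right integral_unique)
qed

text \<open>Lagrange's identity divided by \<open>z - l\<close>, in the limit. It ties the
  simplicity of the eigenvalue to the pairing in the denominator of both projection norms.\<close>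

lemma deriv_hill_F:
  assumes F: "hill_F q l = 2 * of_real (cos t)" and ph: "phi q l 1 \<noteq> 0"
  shows "deriv (hill_F q) l = - phi q l 1 * integral {0..1} (\<lambda>x. Phi q t l x * Phi q (- t) l x)"
proof -
  define I where "I z = integral {0..1}
     (\<lambda>x. Phi q t l x * (phi q z 1 * theta q z x + (cis (- t) - theta q z 1) * phi q z x))" for z
  have "continuous_on (UNIV \<times> cbox 0 1) (\<lambda>(z, x). Phi q t l x * (phi q z 1 * theta q z x + (cis (- t) - theta q z 1) * phi q z x))"
    unfolding split_def using ph by (intro continuous_intros) auto
  then have "continuous_on UNIV I"
    unfolding I_def[abs_def] using integral_continuous_on_param by fastforce
  then have "isCont I l" using continuous_on_eq_continuous_at by blast
  then have "I \<midarrow>l\<rightarrow> I l" by (simp add: isCont_def)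
  then have "(\<lambda>z. - I z) \<midarrow>l\<rightarrow> - I l" by (rule tendsto_minus)
  moreover have "\<forall>\<^sub>F z in at l. - I z = (hill_F q z - hill_F q l) / (z - l)"
  proof -
    have "- I z = (hill_F q z - hill_F q l) / (z - l)" if "z \<noteq> l" for z
      unfolding lagrange_identity[OF F ph, of z] I_def[symmetric] using that by (simp add: field_simps)
    then show ?thesis by (auto simp: eventually_at_filter)
  qed
  ultimately have "((\<lambda>z. (hill_F q z - hill_F q l) / (z - l)) \<longlongrightarrow> - I l) (at l)"
    by (rule Lim_transform_eventually)
  then have "(hill_F q has_field_derivative - I l) (at l)" by (simp add: has_field_derivative_iff)
  moreover have "I l = phi q l 1 * integral {0..1} (\<lambda>x. Phi q t l x * Phi q (- t) l x)"
  proof -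
    have "Phi q t l x * (phi q l 1 * theta q l x + (cis (- t) - theta q l 1) * phi q l x)
       = phi q l 1 * (Phi q t l x * Phi q (- t) l x)" for x
      unfolding Phi_def[of q "- t"] using ph by (simp add: field_simps)
    then show ?thesis by (simp only: I_def integral_mult_right)
  qed
  ultimately show ?thesis by (simp add: DERIV_imp_deriv)
qed

end

section \<open>The norm of the projection of an arc\<close>

lemma fejer_product:
  "(\<Sum>k<N. cis \<theta> ^ k) * (\<Sum>k<N. cis (- \<theta>) ^ k) = of_real (real N * fejer N \<theta>)"
proof (cases "N = 0")
  case False
  have "(\<Sum>k<N. cis \<theta> ^ k) = (\<Sum>k<N. cis (real k * \<theta>))"
    by (intro sum.cong refl) (simp only: Complex.DeMoivre)
  moreover have "(\<Sum>k<N. cis (- \<theta>) ^ k) = cnj (\<Sum>k<N. cis (real k * \<theta>))"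
    unfolding cnj_sum by (intro sum.cong refl) (simp add: Complex.DeMoivre cis_cnj)
  ultimately show ?thesis
    using False complex_norm_square[of "\<Sum>k<N. cis (real k * \<theta>)"] by (simp add: fejer_def)
qed simp

context hill_potential
begin

text \<open>Differentiation of \<open>F (lam t) = 2 * cos t\<close> together with the formula for
  \<open>F'\<close> shows that the density of the arc integral is the reciprocal of the
  pairing.\<close>

lemma arc_weight:
  assumes arc: "regular_spectral_arc q lam \<alpha> \<beta>" and t: "\<alpha> < t" "t < \<beta>"
    and ph: "phi q (lam (of_real t)) 1 \<noteq> 0"
    and w: "w = phi q (lam (of_real t)) 1 / of_real (2 * sin t) * deriv lam (of_real t)" and s: "sin t \<noteq> 0"
  shows "w * integral {0..1} (\<lambda>x. Phi q t (lam (of_real t)) x * Phi q (- t) (lam (of_real t)) x) = 1"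
proof -
  let ?l = "lam (of_real t)"
  have tt: "t \<in> {\<alpha>..\<beta>}" using t by auto
  have F: "hill_F q (lam (of_real u)) = 2 * of_real (cos u)" if "u \<in> {\<alpha>..\<beta>}" for u
    using arc that unfolding regular_spectral_arc_def by blast
  have "lam analytic_on {of_real t}"
    using arc tt unfolding regular_spectral_arc_def by (meson analytic_on_subset empty_subsetI imageI insert_subset)
  then have "lam field_differentiable at (of_real t)" by (rule analytic_on_imp_differentiable_at) auto
  then have dl: "(lam has_field_derivative deriv lam (of_real t)) (at (of_real t))"
    by (simp add: field_differentiable_derivI)
  have "(hill_F q has_field_derivative deriv (hill_F q) ?l) (at ?l)"
    by (rule holomorphic_derivI[OF hill_F_holomorphic[of UNIV]]) auto
  from DERIV_chain2[OF this dl]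
  have "((\<lambda>u. hill_F q (lam (of_real u))) has_vector_derivative deriv (hill_F q) ?l * deriv lam (of_real t)) (at t)"
    by (rule has_vector_derivative_real_field)
  then have 1: "((\<lambda>u. 2 * complex_of_real (cos u)) has_vector_derivative deriv (hill_F q) ?l * deriv lam (of_real t)) (at t)"
    by (rule has_vector_derivative_transform_within_open[where S = "{\<alpha><..<\<beta>}"]) (use t F in auto)
  have "((\<lambda>z. 2 * cos z) has_field_derivative - 2 * sin (of_real t)) (at (of_real t :: complex))"
    by (auto intro!: derivative_eq_intros)
  from has_vector_derivative_real_field[OF this]
  have "((\<lambda>u. 2 * complex_of_real (cos u)) has_vector_derivative - 2 * of_real (sin t)) (at t)"
    by (simp add: cos_of_real sin_of_real)
  from vector_derivative_unique_at[OF 1 this]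
  have "deriv (hill_F q) ?l * deriv lam (of_real t) = - 2 * of_real (sin t)" .
  then have "phi q ?l 1 * integral {0..1} (\<lambda>x. Phi q t ?l x * Phi q (- t) ?l x) * deriv lam (of_real t) = 2 * of_real (sin t)"
    unfolding deriv_hill_F[OF F[OF tt] ph] by simp
  then show ?thesis unfolding w using s by (simp add: field_simps)
qed

text \<open>The projection is tested on the wave packet \<open>cnj \<Phi>\<^sub>-\<close>, cut off to \<open>[0, N]\<close> and taken at \<open>t1\<close>, and the
  result is paired with \<open>cnj \<Phi>\<^sub>+\<close>: this produces a Fejer kernel concentrated at \<open>t1\<close>.\<close>

lemma arc_projection_test:
  assumes arc: "regular_spectral_arc q lam \<alpha> \<beta>" and pos: "0 < \<alpha>" "\<beta> < pi" and t1: "\<alpha> < t1" "t1 < \<beta>"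
    and ph: "\<And>t. t \<in> {\<alpha>..\<beta>} \<Longrightarrow> phi q (lam (of_real t)) 1 \<noteq> 0"
    and k: "0 \<le> k"
    and bound: "\<And>f. f \<in> L2_bounded_support \<Longrightarrow>
      sq_norm lebesgue (arc_projection q lam \<alpha> \<beta> f) \<le> (ennreal k)\<^sup>2 * sq_norm lebesgue f"
  shows "integral {0..1} (\<lambda>x. (cmod (Phi q t1 (lam (of_real t1)) x))\<^sup>2)
      * integral {0..1} (\<lambda>x. (cmod (Phi q (- t1) (lam (of_real t1)) x))\<^sup>2)
    \<le> (k * cmod (integral {0..1} (\<lambda>x. Phi q t1 (lam (of_real t1)) x * Phi q (- t1) (lam (of_real t1)) x)))\<^sup>2"
proof -
  define l where "l t = lam (of_real t)" for t :: real
  define w where "w t = phi q (l t) 1 / of_real (2 * sin t) * deriv lam (of_real t)" for t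
  define P1 where "P1 = Phi q (- t1) (l t1)"
  define P2 where "P2 = Phi q t1 (l t1)"
  define A1 where "A1 = integral {0..1} (\<lambda>x. (cmod (P1 x))\<^sup>2)"
  define A2 where "A2 = integral {0..1} (\<lambda>x. (cmod (P2 x))\<^sup>2)"
  define D where "D = integral {0..1} (\<lambda>x. P2 x * P1 x)"
  define J where "J s t = integral {0..1} (\<lambda>x. cnj (P1 x) * Phi q s (l t) x)" for s t
  define J' where "J' s t = integral {0..1} (\<lambda>x. Phi q s (l t) x * cnj (P2 x))" for s t
  define S where "S N \<theta> = (\<Sum>k<N. cis \<theta> ^ k)" for N :: nat and \<theta>
  \<comment> \<open>Densities of the diagonal term and of the cross term; they will be integrated
    against kernels centred at \<open>t1\<close> and at \<open>- t1\<close>.\<close>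
  define \<kappa>1 where "\<kappa>1 t = J (- t) t * J' t t * w t" for t
  define \<kappa>2 where "\<kappa>2 t = J t t * J' (- t) t * w t" for t
  have t1': "t1 \<in> {\<alpha>..\<beta>}" using t1 by auto
  have phl: "phi q (l t) 1 \<noteq> 0" if "t \<in> {\<alpha>..\<beta>}" for t using ph[OF that] by (simp add: l_def)
  have F: "hill_F q (l t) = 2 * of_real (cos t)" if "t \<in> {\<alpha>..\<beta>}" for t
    using arc that unfolding regular_spectral_arc_def l_def by blast
  have sinp: "0 < sin t" if "t \<in> {\<alpha>..\<beta>}" for t using that pos by (intro sin_gt_zero) auto
  have lc: "continuous_on {\<alpha>..\<beta>} l"
  proof -
    have "continuous_on (complex_of_real ` {\<alpha>..\<beta>}) lam" using arc unfolding regular_spectral_arc_def by blast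
    then show ?thesis unfolding l_def[abs_def]
      by (rule continuous_on_compose2) (auto intro!: continuous_intros)
  qed
  have dc: "continuous_on {\<alpha>..\<beta>} (\<lambda>t. deriv lam (of_real t))"
  proof -
    obtain W where W: "open W" "complex_of_real ` {\<alpha>..\<beta>} \<subseteq> W" "lam holomorphic_on W"
      using arc unfolding regular_spectral_arc_def analytic_on_holomorphic by blast
    have "continuous_on W (deriv lam)"
      by (intro holomorphic_on_imp_continuous_on holomorphic_deriv W)
    then show ?thesis by (rule continuous_on_compose2) (use W in \<open>auto intro!: continuous_intros\<close>)
  qed
  have wc: "continuous_on {\<alpha>..\<beta>} w"
    unfolding w_def using sinp by (intro continuous_intros lc dc) force
  have P1c: "continuous_on X P1" and P2c: "continuous_on X P2" for X
    unfolding P1_def P2_def using phl[OF t1'] by (intro continuous_intros; simp)+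
  have Phc: "continuous_on X (\<lambda>p. Phi q (c * f p) (l (f p)) (g p))"
    if "continuous_on X f" "continuous_on X g" "f ` X \<subseteq> {\<alpha>..\<beta>}" for X :: "'x::topological_space set" and f g c
    by (intro continuous_intros that continuous_on_compose2[OF lc that(1,3)] phl) (use that(3) in blast)
  have Jc: "continuous_on {\<alpha>..\<beta>} (\<lambda>t. J (c * t) t)" "continuous_on {\<alpha>..\<beta>} (\<lambda>t. J' (c * t) t)" for c
  proof -
    have "continuous_on ({\<alpha>..\<beta>} \<times> cbox 0 1) (\<lambda>(t, x). cnj (P1 x) * Phi q (c * t) (l t) x)"
      unfolding split_def by (intro continuous_intros Phc continuous_on_compose2[OF P1c[of UNIV]]) auto
    from integral_continuous_on_param[OF this]
    show "continuous_on {\<alpha>..\<beta>} (\<lambda>t. J (c * t) t)" by (simp add: J_def)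
    have "continuous_on ({\<alpha>..\<beta>} \<times> cbox 0 1) (\<lambda>(t, x). Phi q (c * t) (l t) x * cnj (P2 x))"
      unfolding split_def by (intro continuous_intros Phc continuous_on_compose2[OF P2c[of UNIV]]) auto
    from integral_continuous_on_param[OF this]
    show "continuous_on {\<alpha>..\<beta>} (\<lambda>t. J' (c * t) t)" by (simp add: J'_def)
  qed
  note Jc1 = Jc[of 1, simplified] and Jcm = Jc[of "-1", simplified]
  have Sc: "continuous_on X f \<Longrightarrow> continuous_on X (\<lambda>x. S N (f x))" for N X and f :: "'x::topological_space \<Rightarrow> real"
    unfolding S_def by (intro continuous_intros)
  have \<kappa>c: "continuous_on {\<alpha>..\<beta>} \<kappa>1" "continuous_on {\<alpha>..\<beta>} \<kappa>2"
    unfolding \<kappa>1_def \<kappa>2_def by (intro continuous_intros Jc1 Jcm wc)+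
  have mP1: "P1 (x + 1) = cis (- t1) * P1 x" for x
    unfolding P1_def by (rule Phi_floquet) (use F[OF t1'] phl[OF t1'] in auto)
  have mP2: "P2 (x + 1) = cis t1 * P2 x" for x
    unfolding P2_def by (rule Phi_floquet) (use F[OF t1'] phl[OF t1'] in auto)
  have mPhi: "Phi q s (l t) (x + 1) = cis s * Phi q s (l t) x" if "t \<in> {\<alpha>..\<beta>}" "s = t \<or> s = - t" for s t x
    by (rule Phi_floquet) (use F[OF that(1)] phl[OF that(1)] that(2) in auto)
  have Phs: "continuous_on X (Phi q s (l t))" if "t \<in> {\<alpha>..\<beta>}" for X s t
    using phl[OF that] by (intro continuous_intros) auto
  have normsq: "integral {0..real N} (\<lambda>x. (cmod (g x))\<^sup>2) = real N * integral {0..1} (\<lambda>x. (cmod (g x))\<^sup>2)"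
    if g: "continuous_on UNIV g" "\<And>x. g (x + 1) = cis s * g x" for g :: "real \<Rightarrow> complex" and s N
  proof -
    have c: "continuous_on UNIV (\<lambda>x. complex_of_real ((cmod (g x))\<^sup>2))" by (intro continuous_intros g)
    have i: "((\<lambda>x. complex_of_real ((cmod (g x))\<^sup>2)) has_integral of_real (integral {u..v} (\<lambda>x. (cmod (g x))\<^sup>2))) {u..v}" for u v
      using has_integral_linear[OF integrable_integral[OF integrable_continuous_real] bounded_linear_of_real,
          of u v "\<lambda>x. (cmod (g x))\<^sup>2"]
      by (simp add: o_def continuous_intros continuous_on_subset[OF g(1)])
    have "integral {0..real N} (\<lambda>x. complex_of_real ((cmod (g x))\<^sup>2)) = (\<Sum>k<N. 1 ^ k) * integral {0..1} (\<lambda>x. complex_of_real ((cmod (g x))\<^sup>2))"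
      by (rule integral_multiplier[OF c]) (simp add: g(2) norm_mult)
    then have "complex_of_real (integral {0..real N} (\<lambda>x. (cmod (g x))\<^sup>2)) = complex_of_real (real N * integral {0..1} (\<lambda>x. (cmod (g x))\<^sup>2))"
      unfolding integral_unique[OF i] by simp
    then show ?thesis unfolding of_real_eq_iff .
  qed
  have main: "(cmod (1 / (2 * of_real pi) * integral {\<alpha>..\<beta>} (\<lambda>t. of_real (fejer N (t - t1)) * \<kappa>1 t + of_real (fejer N (t + t1)) * \<kappa>2 t)))\<^sup>2
      \<le> k\<^sup>2 * A1 * A2" if N: "N > 0" for N
  proof -
    define f where "f x = (if x \<in> {0..real N} then cnj (P1 x) else 0)" for x
    have cP1: "continuous_on X (\<lambda>x. cnj (P1 x))" for X by (intro continuous_intros P1c)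
    have fL: "f \<in> L2_bounded_support" unfolding f_def by (rule restricted_continuous_L2[OF cP1])
    have fn: "sq_norm lebesgue f = ennreal (real N * A1)"
      unfolding f_def by (subst sq_norm_restrict) (simp_all add: sq_norm_continuous[OF cP1] normsq[OF P1c mP1] A1_def)
    have Tf: "Phi_transform q s (l t) f = S N (t1 + s) * J s t" if t: "t \<in> {\<alpha>..\<beta>}" "s = t \<or> s = - t" for s t
    proof -
      have c: "continuous_on X (\<lambda>x. cnj (P1 x) * Phi q s (l t) x)" for X
        by (intro continuous_intros P1c Phs t)
      have "Phi_transform q s (l t) f = (LINT x|lebesgue. (if x \<in> {0..real N} then cnj (P1 x) * Phi q s (l t) x else 0))"
        unfolding Phi_transform_def f_def by (intro Bochner_Integration.integral_cong) auto
      also have "\<dots> = integral\<^sup>L (lebesgue_on {0..real N}) (\<lambda>x. cnj (P1 x) * Phi q s (l t) x)"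
        by (rule Lebesgue_Measure.integral_restrict_UNIV) auto
      also have "\<dots> = integral {0..real N} (\<lambda>x. cnj (P1 x) * Phi q s (l t) x)"
        by (rule lebesgue_integral_eq_integral[OF integrable_lebesgue_on_continuous[OF c]]) auto
      also have "\<dots> = (\<Sum>k<N. cis (t1 + s) ^ k) * integral {0..1} (\<lambda>x. cnj (P1 x) * Phi q s (l t) x)"
      proof (rule integral_multiplier[OF c])
        fix x
        have "cnj (cis (- t1)) * cis s = cis (t1 + s)" by (simp add: cis_cnj cis_mult)
        then show "cnj (P1 (x + 1)) * Phi q s (l t) (x + 1) = cis (t1 + s) * (cnj (P1 x) * Phi q s (l t) x)"
          unfolding mP1 mPhi[OF t] complex_cnj_mult by (metis mult.assoc mult.left_commute)
      qed
      finally show ?thesis by (simp add: S_def J_def)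
    qed
    have I': "integral {0..real N} (\<lambda>x. Phi q s (l t) x * cnj (P2 x)) = S N (s - t1) * J' s t" if t: "t \<in> {\<alpha>..\<beta>}" "s = t \<or> s = - t" for s t
    proof -
      have c: "continuous_on UNIV (\<lambda>x. Phi q s (l t) x * cnj (P2 x))" by (intro continuous_intros P2c Phs t)
      have "integral {0..real N} (\<lambda>x. Phi q s (l t) x * cnj (P2 x)) = (\<Sum>k<N. cis (s - t1) ^ k) * integral {0..1} (\<lambda>x. Phi q s (l t) x * cnj (P2 x))"
      proof (rule integral_multiplier[OF c])
        fix x
        have "cis s * cnj (cis t1) = cis (s - t1)" by (simp add: cis_cnj cis_mult)
        then show "Phi q s (l t) (x + 1) * cnj (P2 (x + 1)) = cis (s - t1) * (Phi q s (l t) x * cnj (P2 x))"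
          unfolding mP2 mPhi[OF t] complex_cnj_mult by (metis mult.assoc mult.left_commute)
      qed
      then show ?thesis by (simp add: S_def J'_def)
    qed
    define G where "G x t = (Phi q t (l t) x * (S N (t1 - t) * J (- t) t) + Phi q (- t) (l t) x * (S N (t1 + t) * J t t)) * w t" for x t
    define PF where "PF x = 1 / (2 * of_real pi) * integral {\<alpha>..\<beta>} (G x)" for x
    have Pf: "arc_projection q lam \<alpha> \<beta> f x = PF x" for x
    proof -
      have "(let l = lam (of_real t) in
         (Phi q t l x * Phi_transform q (- t) l f + Phi q (- t) l x * Phi_transform q t l f)
         * (phi q l 1 / hill_p q l) * deriv lam (of_real t)) = G x t" if t: "t \<in> {\<alpha>..\<beta>}" for t
      proof -
        \<comment> \<open>As \<open>sin t > 0\<close> on the arc, the principal square root of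
          \<open>4 * (sin t)^2\<close> is \<open>2 * sin t\<close>.\<close>
        have "4 - (hill_F q (l t))\<^sup>2 = 4 * of_real (1 - (cos t)\<^sup>2)"
          unfolding F[OF t] by (simp add: power_mult_distrib)
        also have "\<dots> = (of_real (2 * sin t))\<^sup>2"
          unfolding sin_squared_eq[symmetric] by (simp add: power_mult_distrib)
        finally have "hill_p q (l t) = of_real (2 * sin t)"
          unfolding hill_p_def using sinp[OF t] by (simp only:) (rule csqrt_square, simp)
        then show ?thesis
          using Tf[OF t, of t] Tf[OF t, of "- t"] unfolding G_def w_def Let_def l_def[symmetric] by (simp add: mult.assoc)
      qed
      then show ?thesis unfolding arc_projection_def PF_def by (metis (no_types, lifting) integral_cong)
    qed
    have Gc: "continuous_on (X \<times> {\<alpha>..\<beta>}) (\<lambda>p. G (fst p) (snd p))" for X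
    proof -
      have 1: "continuous_on (X \<times> {\<alpha>..\<beta>}) (\<lambda>p. h (snd p))" if "continuous_on {\<alpha>..\<beta>} h" for h :: "real \<Rightarrow> complex"
        by (rule continuous_on_compose2[OF that]) (auto intro!: continuous_intros)
      have 2: "continuous_on (X \<times> {\<alpha>..\<beta>}) (\<lambda>p. Phi q (c * snd p) (l (snd p)) (fst p))" for c
        by (intro Phc continuous_intros) auto
      show ?thesis unfolding G_def
        by (intro continuous_on_mult continuous_on_add 2[of 1, simplified] 2[of "-1", simplified]
            1[OF wc] 1[OF Jc1(1)] 1[OF Jcm(1)] Sc) (auto intro!: continuous_intros)
    qed
    have PFc: "continuous_on {0..real N} PF"
    proof -
      have "continuous_on ({0..real N} \<times> cbox \<alpha> \<beta>) (\<lambda>(x, t). G x t)" using Gc by (simp add: split_def)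
      from integral_continuous_on_param[OF this] show ?thesis unfolding PF_def[abs_def] by (intro continuous_intros) simp
    qed
    have "ennreal (integral {0..real N} (\<lambda>x. (cmod (PF x))\<^sup>2)) = sq_norm (lebesgue_on {0..real N}) PF"
      by (rule sq_norm_continuous[OF PFc, symmetric])
    also have "\<dots> \<le> sq_norm lebesgue PF" by (rule sq_norm_lebesgue_on_le) auto
    also have "\<dots> \<le> (ennreal k)\<^sup>2 * sq_norm lebesgue f" using bound[OF fL] Pf by (simp add: ext[of "arc_projection q lam \<alpha> \<beta> f" PF])
    also have "\<dots> = ennreal (k\<^sup>2 * (real N * A1))" unfolding fn using k by (simp add: ennreal_mult' ennreal_power)
    finally have "ennreal (integral {0..real N} (\<lambda>x. (cmod (PF x))\<^sup>2)) \<le> ennreal (k\<^sup>2 * (real N * A1))" .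
    moreover have A1: "0 \<le> A1" unfolding A1_def by (intro integral_nonneg integrable_continuous_real continuous_intros P1c) auto
    ultimately have PFn: "integral {0..real N} (\<lambda>x. (cmod (PF x))\<^sup>2) \<le> k\<^sup>2 * (real N * A1)"
      by (subst (asm) ennreal_le_iff) auto
    have A2: "0 \<le> A2" unfolding A2_def by (intro integral_nonneg integrable_continuous_real continuous_intros P2c) auto
    \<comment> \<open>After the exchange of the integrals over \<open>x\<close> and
      \<open>t\<close>, the test function and the final pairing each contribute a geometric sum,
      with conjugate ratios; their product is \<open>N\<close> times a Fejer kernel.\<close>
    have pair: "integral {0..real N} (\<lambda>x. PF x * cnj (P2 x))
      = of_real (real N) * (1 / (2 * of_real pi) * integral {\<alpha>..\<beta>} (\<lambda>t. of_real (fejer N (t - t1)) * \<kappa>1 t + of_real (fejer N (t + t1)) * \<kappa>2 t))"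
    proof -
      have Hc: "continuous_on (cbox (0, \<alpha>) (real N, \<beta>)) (\<lambda>(x, t). G x t * cnj (P2 x))"
        unfolding split_def cbox_Pair_eq
        by (intro continuous_intros continuous_on_subset[OF Gc[of UNIV]] continuous_on_compose2[OF P2c[of UNIV]]) auto
      have "PF x * cnj (P2 x) = 1 / (2 * of_real pi) * integral {\<alpha>..\<beta>} (\<lambda>t. G x t * cnj (P2 x))" for x
        unfolding PF_def integral_mult_left by (simp only: mult.assoc)
      then have "integral {0..real N} (\<lambda>x. PF x * cnj (P2 x)) = 1 / (2 * of_real pi) * integral {0..real N} (\<lambda>x. integral {\<alpha>..\<beta>} (\<lambda>t. G x t * cnj (P2 x)))"
        by (simp only: integral_mult_right)
      also have "integral {0..real N} (\<lambda>x. integral {\<alpha>..\<beta>} (\<lambda>t. G x t * cnj (P2 x)))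
          = integral {\<alpha>..\<beta>} (\<lambda>t. integral {0..real N} (\<lambda>x. G x t * cnj (P2 x)))"
        using integral_swap_continuous[OF Hc] by simp
      also have "\<dots> = integral {\<alpha>..\<beta>} (\<lambda>t. of_real (real N) * (of_real (fejer N (t - t1)) * \<kappa>1 t + of_real (fejer N (t + t1)) * \<kappa>2 t))"
      proof (rule integral_cong)
        fix t assume t: "t \<in> {\<alpha>..\<beta>}"
        have int: "(\<lambda>x. Phi q s (l t) x * cnj (P2 x)) integrable_on {0..real N}" for s
          by (intro integrable_continuous_real continuous_intros P2c Phs t)
        have "integral {0..real N} (\<lambda>x. G x t * cnj (P2 x))
          = integral {0..real N} (\<lambda>x. (S N (t1 - t) * J (- t) t * w t) * (Phi q t (l t) x * cnj (P2 x))
              + (S N (t1 + t) * J t t * w t) * (Phi q (- t) (l t) x * cnj (P2 x)))"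
          unfolding G_def by (intro integral_cong) (simp add: algebra_simps)
        also have "\<dots> = (S N (t1 - t) * J (- t) t * w t) * (S N (t - t1) * J' t t)
            + (S N (t1 + t) * J t t * w t) * (S N (- t - t1) * J' (- t) t)"
          by (subst integral_add) (auto intro!: integrable_on_mult_right int simp: I'[OF t])
        also have "\<dots> = (S N (t - t1) * S N (- (t - t1))) * \<kappa>1 t + (S N (t + t1) * S N (- (t + t1))) * \<kappa>2 t"
        proof -
          have "- t - t1 = - (t + t1)" "t1 - t = - (t - t1)" "t1 + t = t + t1" by simp_all
          then show ?thesis unfolding \<kappa>1_def \<kappa>2_def by (simp only: mult_ac)
        qed
        also have "\<dots> = of_real (real N) * (of_real (fejer N (t - t1)) * \<kappa>1 t + of_real (fejer N (t + t1)) * \<kappa>2 t)"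
          unfolding S_def fejer_product by (simp add: algebra_simps)
        finally show "integral {0..real N} (\<lambda>x. G x t * cnj (P2 x)) = of_real (real N) * (of_real (fejer N (t - t1)) * \<kappa>1 t + of_real (fejer N (t + t1)) * \<kappa>2 t)" .
      qed
      finally show ?thesis by simp
    qed
    let ?X = "1 / (2 * of_real pi) * integral {\<alpha>..\<beta>} (\<lambda>t. of_real (fejer N (t - t1)) * \<kappa>1 t + of_real (fejer N (t + t1)) * \<kappa>2 t)"
    have "(cmod (of_real (real N) * ?X))\<^sup>2 \<le> integral {0..real N} (\<lambda>x. (cmod (PF x))\<^sup>2) * integral {0..real N} (\<lambda>x. (cmod (cnj (P2 x)))\<^sup>2)"
      unfolding pair[symmetric] by (rule cauchy_schwarz_integral[OF PFc]) (intro continuous_intros P2c)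
    also have "integral {0..real N} (\<lambda>x. (cmod (cnj (P2 x)))\<^sup>2) = real N * A2"
      using normsq[OF P2c mP2] by (simp add: A2_def)
    also have "integral {0..real N} (\<lambda>x. (cmod (PF x))\<^sup>2) * (real N * A2) \<le> k\<^sup>2 * (real N * A1) * (real N * A2)"
      using PFn A2 by (intro mult_right_mono) auto
    also have "\<dots> = (real N)\<^sup>2 * (k\<^sup>2 * A1 * A2)" by (simp add: power2_eq_square mult_ac)
    also have "(cmod (of_real (real N) * X))\<^sup>2 = (real N)\<^sup>2 * (cmod X)\<^sup>2" for X
      by (simp add: norm_mult power_mult_distrib)
    finally have "(real N)\<^sup>2 * (cmod ?X)\<^sup>2 \<le> (real N)\<^sup>2 * (k\<^sup>2 * A1 * A2)" .
    then show ?thesis using N by (simp only: mult_le_cancel_left_pos zero_less_power of_nat_0_less_iff)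
  qed
  have cosne: "cos (t + t1) \<noteq> 1" if "t \<in> {\<alpha>..\<beta>}" for t
  proof
    assume "cos (t + t1) = 1"
    then obtain n :: int where n: "t + t1 = of_int n * 2 * pi" using cos_one_2pi_int by metis
    have "0 < t + t1" "t + t1 < 2 * pi" using that t1 pos by auto
    then have "0 < of_int n * (2 * pi)" "of_int n * (2 * pi) < 1 * (2 * pi)" unfolding n by auto
    then have "0 < real_of_int n" "real_of_int n < 1" by (simp_all add: zero_less_mult_iff)
    then show False by auto
  qed
  have ci: "(\<lambda>t. of_real (fejer N (t - t1)) * \<kappa>1 t) integrable_on {\<alpha>..\<beta>}" "(\<lambda>t. of_real (fejer N (t + t1)) * \<kappa>2 t) integrable_on {\<alpha>..\<beta>}" for N
    by (intro integrable_continuous_real continuous_intros \<kappa>c)+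
  have "(\<lambda>N. 1 / (2 * of_real pi) * (integral {\<alpha>..\<beta>} (\<lambda>t. of_real (fejer N (t - t1)) * \<kappa>1 t) + integral {\<alpha>..\<beta>} (\<lambda>t. of_real (fejer N (t + t1)) * \<kappa>2 t)))
    \<longlonglongrightarrow> 1 / (2 * of_real pi) * (2 * of_real pi * \<kappa>1 t1 + 0)"
    using t1 pos by (intro tendsto_intros fejer_limit_interval fejer_vanish_interval \<kappa>c cosne) auto
  then have "(\<lambda>N. (cmod (1 / (2 * of_real pi) * integral {\<alpha>..\<beta>} (\<lambda>t. of_real (fejer N (t - t1)) * \<kappa>1 t + of_real (fejer N (t + t1)) * \<kappa>2 t)))\<^sup>2)
    \<longlonglongrightarrow> (cmod (\<kappa>1 t1))\<^sup>2"
    unfolding integral_add[OF ci, symmetric] by (intro tendsto_power tendsto_norm) simp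
  then have lim: "(cmod (\<kappa>1 t1))\<^sup>2 \<le> k\<^sup>2 * A1 * A2"
    by (rule LIMSEQ_le_const2) (use main in \<open>auto intro!: exI[of _ 1]\<close>)
  \<comment> \<open>At \<open>t = t1\<close> the two pairings in the diagonal density are those of
    \<open>P1\<close> and \<open>P2\<close> with themselves.\<close>
  have J1: "J (- t1) t1 = of_real A1" "J' t1 t1 = of_real A2"
  proof -
    have i: "integral {0..1} (\<lambda>x. complex_of_real ((cmod (g x))\<^sup>2)) = of_real (integral {0..1} (\<lambda>x. (cmod (g x))\<^sup>2))"
      if "continuous_on UNIV g" for g :: "real \<Rightarrow> complex"
      by (intro integral_unique has_integral_linear[OF integrable_integral[OF integrable_continuous_real] bounded_linear_of_real, unfolded o_def]
          continuous_intros continuous_on_subset[OF that]) auto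
    show "J (- t1) t1 = of_real A1"
      unfolding J_def A1_def P1_def[symmetric] using i[OF P1c] by (simp only: complex_norm_square mult.commute)
    show "J' t1 t1 = of_real A2"
      unfolding J'_def A2_def P2_def[symmetric] using i[OF P2c] by (simp only: complex_norm_square)
  qed
  have wD: "w t1 * D = 1"
    unfolding D_def P1_def P2_def l_def
    by (rule arc_weight[OF arc t1 ph[OF t1']]) (use sinp[OF t1'] in \<open>simp_all add: w_def l_def\<close>)
  have A: "0 \<le> A1" "0 \<le> A2"
    unfolding A1_def A2_def by (intro integral_nonneg integrable_continuous_real continuous_intros P1c P2c; simp)+
  \<comment> \<open>The limit gives \<open>(cmod (A1 * A2 * w t1))^2 \<le> k^2 * A1 * A2\<close>;
    the relation \<open>w t1 * D = 1\<close> replaces the density by the pairing.\<close>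
  have "(A1 * A2)\<^sup>2 = (A1 * A2)\<^sup>2 * (cmod (w t1 * D))\<^sup>2" unfolding wD by simp
  also have "\<dots> = (cmod (\<kappa>1 t1))\<^sup>2 * (cmod D)\<^sup>2"
    unfolding \<kappa>1_def J1 using A by (simp add: norm_mult power_mult_distrib mult_ac)
  also have "\<dots> \<le> (k\<^sup>2 * A1 * A2) * (cmod D)\<^sup>2" by (intro mult_right_mono lim) auto
  finally have "(A1 * A2) * (A1 * A2) \<le> (A1 * A2) * (k * cmod D)\<^sup>2"
    by (simp add: power2_eq_square mult_ac)
  then have "A1 * A2 \<le> (k * cmod D)\<^sup>2"
    using A by (cases "A1 * A2 = 0") (auto simp: mult_le_cancel_left)
  then show ?thesis by (simp add: A1_def A2_def D_def P1_def P2_def l_def mult.commute)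
qed

lemma arc_projection_norm_ge:
  assumes arc: "isolating_arc q L R lam \<alpha> \<beta> Q" and L: "0 \<le> L"
  shows "ennreal L \<le> arc_projection_norm q lam \<alpha> \<beta>"
  unfolding arc_projection_norm_def
proof (rule op_norm_ge)
  fix k :: real assume k: "0 \<le> k"
    and bound: "\<And>f. f \<in> L2_bounded_support \<Longrightarrow>
      sq_norm lebesgue (arc_projection q lam \<alpha> \<beta> f) \<le> (ennreal k)\<^sup>2 * sq_norm lebesgue f"
  have r: "regular_spectral_arc q lam \<alpha> \<beta>" "0 < \<alpha>" "\<beta> < pi" using arc unfolding isolating_arc_def by auto
  then have ab: "\<alpha> < \<beta>" unfolding regular_spectral_arc_def by auto
  define t1 where "t1 = (\<alpha> + \<beta>) / 2"
  have t1: "\<alpha> < t1" "t1 < \<beta>" "t1 \<in> {\<alpha>..\<beta>}" using ab by (auto simp: t1_def)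
  let ?D = "integral {0..1} (\<lambda>x. Phi q t1 (lam (of_real t1)) x * Phi q (- t1) (lam (of_real t1)) x)"
  have ph: "phi q (lam (of_real t)) 1 \<noteq> 0" if "t \<in> {\<alpha>..\<beta>}" for t
    using arc that unfolding isolating_arc_def by blast
  have "(L * cmod ?D)\<^sup>2 < integral {0..1} (\<lambda>x. (cmod (Phi q t1 (lam (of_real t1)) x))\<^sup>2)
      * integral {0..1} (\<lambda>x. (cmod (Phi q (- t1) (lam (of_real t1)) x))\<^sup>2)"
    using arc t1(3) unfolding isolating_arc_def by blast
  also have "\<dots> \<le> (k * cmod ?D)\<^sup>2" by (rule arc_projection_test[OF r t1(1,2) ph k bound])
  finally have "L * cmod ?D < k * cmod ?D" using k by (simp add: power2_less_imp_less)
  then show "L \<le> k" by (simp add: mult_less_cancel_right)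
qed

end

section \<open>Resolvents of the Bloch operators and their residues\<close>

section \<open>The inhomogeneous equation and the spectrum of the Bloch operators\<close>

lemma L2_diff:
  assumes "f \<in> L2 M" "g \<in> L2 M"
  shows "(\<lambda>x. f x - g x) \<in> L2 M"
proof -
  have m: "(\<lambda>x. f x - g x) \<in> borel_measurable M" using assms by (auto simp: L2_def)
  have "integrable M (\<lambda>x. (cmod (f x - g x))\<^sup>2)"
  proof (rule Bochner_Integration.integrable_bound)
    show "integrable M (\<lambda>x. 2 * (cmod (f x))\<^sup>2 + 2 * (cmod (g x))\<^sup>2)" using assms by (auto simp: L2_def)
    show "(\<lambda>x. (cmod (f x - g x))\<^sup>2) \<in> borel_measurable M" using m by measurable
    have "(cmod (a - b))\<^sup>2 \<le> 2 * (cmod a)\<^sup>2 + 2 * (cmod b)\<^sup>2" for a b :: complex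
    proof -
      have "(cmod (a - b))\<^sup>2 \<le> (cmod a + cmod b)\<^sup>2" by (intro power_mono norm_triangle_ineq4) auto
      also have "\<dots> \<le> 2 * (cmod a)\<^sup>2 + 2 * (cmod b)\<^sup>2"
        using zero_le_power2[of "cmod a - cmod b"] by (simp add: power2_eq_square algebra_simps)
      finally show ?thesis .
    qed
    then show "AE x in M. norm ((cmod (f x - g x))\<^sup>2) \<le> norm (2 * (cmod (f x))\<^sup>2 + 2 * (cmod (g x))\<^sup>2)"
      by (intro AE_I2) simp
  qed
  then show ?thesis using m by (simp add: L2_def)
qed

lemma L2_unit_interval:
  assumes f: "f \<in> L2 (lebesgue_on {0..1})"
  obtains g where "0 \<le> g" "f integrable_on {0..1}" "\<And>x. x \<in> {0..1} \<Longrightarrow> cmod (integral {0..x} f) \<le> g"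
    "sq_norm (lebesgue_on {0..1}) f = ennreal (g\<^sup>2)"
proof -
  let ?M = "lebesgue_on {0..1::real}"
  have m: "f \<in> borel_measurable ?M" and i2: "integrable ?M (\<lambda>x. (cmod (f x))\<^sup>2)"
    using f by (auto simp: L2_def)
  have c: "integrable ?M (\<lambda>x. r)" for r :: real
    by (intro integrable_lebesgue_on_continuous continuous_intros)
  have i1: "integrable ?M f"
  proof (rule Bochner_Integration.integrable_bound[OF _ m])
    show "integrable ?M (\<lambda>x. 1 + (cmod (f x))\<^sup>2)" by (intro Bochner_Integration.integrable_add c i2)
    have "r \<le> 1 + r\<^sup>2" if "0 \<le> r" for r :: real
      using zero_le_power2[of "r - 1"] that by (simp add: power2_eq_square algebra_simps)
    then show "AE x in ?M. norm (f x) \<le> norm (1 + (cmod (f x))\<^sup>2)" by (auto intro!: AE_I2)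
  qed
  define m1 where "m1 = integral\<^sup>L ?M (\<lambda>x. cmod (f x))"
  define m2 where "m2 = integral\<^sup>L ?M (\<lambda>x. (cmod (f x))\<^sup>2)"
  have in1: "integrable ?M (\<lambda>x. cmod (f x))" using i1 by (rule integrable_norm)
  have one: "integral\<^sup>L ?M (\<lambda>x. r) = r" for r :: real
  proof -
    have "integral\<^sup>L ?M (\<lambda>x. r) = integral {0..1} (\<lambda>x::real. r)" by (rule lebesgue_integral_eq_integral[OF c]) auto
    then show ?thesis by simp
  qed
  have "measure ?M {0..1} = 1" using one[of 1] by simp
  note one = one this
  \<comment> \<open>Nonnegativity of the variance on the unit interval bounds the L1 norm by the L2
    norm.\<close>
  have "0 \<le> integral\<^sup>L ?M (\<lambda>x. (cmod (f x) - m1)\<^sup>2)" by (intro integral_nonneg_AE AE_I2) auto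
  also have "(\<lambda>x. (cmod (f x) - m1)\<^sup>2) = (\<lambda>x. (cmod (f x))\<^sup>2 - 2 * m1 * cmod (f x) + m1\<^sup>2)"
    by (auto simp: power2_eq_square algebra_simps)
  also have "integral\<^sup>L ?M (\<lambda>x. (cmod (f x))\<^sup>2 - 2 * m1 * cmod (f x) + m1\<^sup>2) = m2 - 2 * m1 * m1 + m1\<^sup>2"
    using i2 in1 c by (simp add: one m1_def[symmetric] m2_def[symmetric])
  finally have m12: "m1\<^sup>2 \<le> m2" by (simp add: power2_eq_square)
  have m1: "0 \<le> m1" unfolding m1_def by (intro integral_nonneg_AE AE_I2) auto
  have m2: "0 \<le> m2" using m12 zero_le_power2[of m1] by linarith
  have int: "f integrable_on {0..1}" by (rule integrable_on_lebesgue_on[OF i1]) auto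
  show thesis
  proof (rule that[of "sqrt m2"])
    show "0 \<le> sqrt m2" using m2 by simp
    show "f integrable_on {0..1}" by (rule int)
    show "sq_norm ?M f = ennreal ((sqrt m2)\<^sup>2)"
      unfolding sq_norm_def using nn_integral_eq_integral[OF i2] m2 by (simp add: m2_def)
    fix x :: real assume x: "x \<in> {0..1}"
    have nint: "(\<lambda>x. cmod (f x)) integrable_on {0..1}" by (rule integrable_on_lebesgue_on[OF in1]) auto
    have "cmod (integral {0..x} f) \<le> integral {0..x} (\<lambda>x. cmod (f x))"
      using x by (intro integral_norm_bound_integral integrable_subinterval_real[OF int] integrable_subinterval_real[OF nint]) auto
    also have "\<dots> \<le> integral {0..1} (\<lambda>x. cmod (f x))"
      using x by (intro integral_subset_le nint integrable_subinterval_real[OF nint]) auto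
    also have "\<dots> = m1" unfolding m1_def by (rule lebesgue_integral_eq_integral[OF in1, symmetric]) auto
    also have "\<dots> \<le> sqrt m2" using m12 m1 by (simp add: real_le_rsqrt)
    finally show "cmod (integral {0..x} f) \<le> sqrt m2" .
  qed
qed

context hill_potential
begin

text \<open>Corrections to the coefficients of \<open>theta\<close> and \<open>phi\<close> under two
  inhomogeneities: \<open>G\<close> carries general square-integrable data through an
  antiderivative, \<open>f\<close> carries continuous data directly.\<close>

definition voc1 :: "complex \<Rightarrow> (real \<Rightarrow> complex) \<Rightarrow> (real \<Rightarrow> complex) \<Rightarrow> real \<Rightarrow> complex" where
  "voc1 z G f x = integral {0..x} (\<lambda>s. f s * phi q z s - G s * dphi z s)"

definition voc2 :: "complex \<Rightarrow> (real \<Rightarrow> complex) \<Rightarrow> (real \<Rightarrow> complex) \<Rightarrow> real \<Rightarrow> complex" where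
  "voc2 z G f x = integral {0..x} (\<lambda>s. G s * dtheta z s - f s * theta q z s)"

lemma sol_derivs:
  "(theta q z has_vector_derivative dtheta z x) (at x within S)"
  "(dtheta z has_vector_derivative (q x - z) * theta q z x) (at x within S)"
  "(phi q z has_vector_derivative dphi z x) (at x within S)"
  "(dphi z has_vector_derivative (q x - z) * phi q z x) (at x within S)"
  using theta_sol[of z] phi_sol[of z] unfolding hill_sol_def
  by (auto intro: has_vector_derivative_at_within)

text \<open>The system \<open>u' = v - G\<close>, \<open>v' = (q - z) u - f\<close>: with \<open>G\<close> an antiderivative of \<open>h\<close> and \<open>f = 0\<close> it is
  \<open>-u'' + q u = z u + h\<close> with \<open>v = u' + G\<close>, and only continuous functions occur.\<close>

lemma variation_of_constants:
  assumes G: "continuous_on {0..1} G" and f: "continuous_on {0..1} f"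
    and u: "\<And>x. x \<in> {0..1} \<Longrightarrow> (u has_vector_derivative v x - G x) (at x within {0..1})"
    and v: "\<And>x. x \<in> {0..1} \<Longrightarrow> (v has_vector_derivative (q x - z) * u x - f x) (at x within {0..1})"
    and x: "x \<in> {0..1}"
  shows "u x = theta q z x * (u 0 + voc1 z G f x) + phi q z x * (v 0 + voc2 z G f x)"
    and "v x = dtheta z x * (u 0 + voc1 z G f x) + dphi z x * (v 0 + voc2 z G f x)"
proof -
  define A where "A x = u x * dphi z x - v x * phi q z x" for x
  define B where "B x = theta q z x * v x - dtheta z x * u x" for x
  have "((\<lambda>s. f s * phi q z s - G s * dphi z s) has_integral (A x - A 0)) {0..x}"
  proof (rule fundamental_theorem_of_calculus)
    fix s assume "s \<in> {0..x}"
    then have s: "s \<in> {0..1}" using x by auto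
    have "(A has_vector_derivative (u s * ((q s - z) * phi q z s) + (v s - G s) * dphi z s
        - (v s * dphi z s + ((q s - z) * u s - f s) * phi q z s))) (at s within {0..1})"
      unfolding A_def by (intro has_vector_derivative_diff has_vector_derivative_mult sol_derivs u v s)
    then have "(A has_vector_derivative (f s * phi q z s - G s * dphi z s)) (at s within {0..1})"
      by (simp add: algebra_simps)
    then show "(A has_vector_derivative (f s * phi q z s - G s * dphi z s)) (at s within {0..x})"
      by (rule has_vector_derivative_within_subset) (use x in auto)
  qed (use x in auto)
  then have A: "u x * dphi z x - v x * phi q z x = u 0 + voc1 z G f x"
    by (simp add: voc1_def integral_unique A_def)
  have "((\<lambda>s. G s * dtheta z s - f s * theta q z s) has_integral (B x - B 0)) {0..x}"
  proof (rule fundamental_theorem_of_calculus)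
    fix s assume "s \<in> {0..x}"
    then have s: "s \<in> {0..1}" using x by auto
    have "(B has_vector_derivative (theta q z s * ((q s - z) * u s - f s) + dtheta z s * v s
        - (dtheta z s * (v s - G s) + ((q s - z) * theta q z s) * u s))) (at s within {0..1})"
      unfolding B_def by (intro has_vector_derivative_diff has_vector_derivative_mult sol_derivs u v s)
    then have "(B has_vector_derivative (G s * dtheta z s - f s * theta q z s)) (at s within {0..1})"
      by (simp add: algebra_simps)
    then show "(B has_vector_derivative (G s * dtheta z s - f s * theta q z s)) (at s within {0..x})"
      by (rule has_vector_derivative_within_subset) (use x in auto)
  qed (use x in auto)
  then have B: "theta q z x * v x - dtheta z x * u x = v 0 + voc2 z G f x"
    by (simp add: voc2_def integral_unique B_def)
  have W: "theta q z x * dphi z x - dtheta z x * phi q z x = 1" by (rule wronskian)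
  show "u x = theta q z x * (u 0 + voc1 z G f x) + phi q z x * (v 0 + voc2 z G f x)"
    unfolding A[symmetric] B[symmetric] using W by algebra
  show "v x = dtheta z x * (u 0 + voc1 z G f x) + dphi z x * (v 0 + voc2 z G f x)"
    unfolding A[symmetric] B[symmetric] using W by algebra
qed

lemma sol_continuous_real:
  "continuous_on S (theta q z)" "continuous_on S (phi q z)" "continuous_on S (dtheta z)" "continuous_on S (dphi z)"
  by (rule continuous_intros)+

lemma variation_of_constants_exists:
  assumes G: "continuous_on {0..1} G" and f: "continuous_on {0..1} f" and x: "x \<in> {0..1}"
  shows "((\<lambda>x. theta q z x * (A + voc1 z G f x) + phi q z x * (B + voc2 z G f x)) has_vector_derivative
      (dtheta z x * (A + voc1 z G f x) + dphi z x * (B + voc2 z G f x)) - G x) (at x within {0..1})"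
    and "((\<lambda>x. dtheta z x * (A + voc1 z G f x) + dphi z x * (B + voc2 z G f x)) has_vector_derivative
      (q x - z) * (theta q z x * (A + voc1 z G f x) + phi q z x * (B + voc2 z G f x)) - f x) (at x within {0..1})"
proof -
  have 1: "((\<lambda>x. A + voc1 z G f x) has_vector_derivative (f x * phi q z x - G x * dphi z x)) (at x within {0..1})"
  proof -
    have "((\<lambda>x. voc1 z G f x) has_vector_derivative (f x * phi q z x - G x * dphi z x)) (at x within {0..1})"
      unfolding voc1_def
      by (rule integral_has_vector_derivative[OF _ x]) (intro continuous_intros f G sol_continuous_real)
    from has_vector_derivative_add[OF has_vector_derivative_const this, of A] show ?thesis by simp
  qed
  have 2: "((\<lambda>x. B + voc2 z G f x) has_vector_derivative (G x * dtheta z x - f x * theta q z x)) (at x within {0..1})"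
  proof -
    have "((\<lambda>x. voc2 z G f x) has_vector_derivative (G x * dtheta z x - f x * theta q z x)) (at x within {0..1})"
      unfolding voc2_def
      by (rule integral_has_vector_derivative[OF _ x]) (intro continuous_intros f G sol_continuous_real)
    from has_vector_derivative_add[OF has_vector_derivative_const this, of B] show ?thesis by simp
  qed
  have W: "theta q z x * dphi z x - dtheta z x * phi q z x = 1" by (rule wronskian)
  let ?a = "A + voc1 z G f x" and ?b = "B + voc2 z G f x"
  have "((\<lambda>x. theta q z x * (A + voc1 z G f x) + phi q z x * (B + voc2 z G f x)) has_vector_derivative
      (theta q z x * (f x * phi q z x - G x * dphi z x) + dtheta z x * ?a
       + (phi q z x * (G x * dtheta z x - f x * theta q z x) + dphi z x * ?b))) (at x within {0..1})"
    by (intro has_vector_derivative_add has_vector_derivative_mult sol_derivs 1 2)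
  moreover have "theta q z x * (f x * phi q z x - G x * dphi z x) + dtheta z x * ?a
       + (phi q z x * (G x * dtheta z x - f x * theta q z x) + dphi z x * ?b) = (dtheta z x * ?a + dphi z x * ?b) - G x"
    using W by algebra
  ultimately show "((\<lambda>x. theta q z x * (A + voc1 z G f x) + phi q z x * (B + voc2 z G f x)) has_vector_derivative
      (dtheta z x * ?a + dphi z x * ?b) - G x) (at x within {0..1})" by simp
  have "((\<lambda>x. dtheta z x * (A + voc1 z G f x) + dphi z x * (B + voc2 z G f x)) has_vector_derivative
      (dtheta z x * (f x * phi q z x - G x * dphi z x) + ((q x - z) * theta q z x) * ?a
       + (dphi z x * (G x * dtheta z x - f x * theta q z x) + ((q x - z) * phi q z x) * ?b))) (at x within {0..1})"
    by (intro has_vector_derivative_add has_vector_derivative_mult sol_derivs 1 2)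
  moreover have "dtheta z x * (f x * phi q z x - G x * dphi z x) + ((q x - z) * theta q z x) * ?a
       + (dphi z x * (G x * dtheta z x - f x * theta q z x) + ((q x - z) * phi q z x) * ?b)
     = (q x - z) * (theta q z x * ?a + phi q z x * ?b) - f x"
    using W by algebra
  ultimately show "((\<lambda>x. dtheta z x * (A + voc1 z G f x) + dphi z x * (B + voc2 z G f x)) has_vector_derivative
      (q x - z) * (theta q z x * ?a + phi q z x * ?b) - f x) (at x within {0..1})" by simp
qed

lemma monodromy_det:
  "(theta q z 1 - cis t) * (dphi z 1 - cis t) - phi q z 1 * dtheta z 1 = cis t * (2 * of_real (cos t) - hill_F q z)"
proof -
  have c: "cis t * cis (- t) = 1" by (simp add: cis_mult)
  have "2 * of_real (cos t) = cis t + cis (- t)" by (simp add: complex_eq_iff)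
  then show ?thesis unfolding hill_F_eq using wronskian[of z 1] c by algebra
qed

text \<open>The unknown \<open>v = u' + G\<close>, with \<open>G\<close> the antiderivative of
  \<open>f\<close>, turns the almost-everywhere equation into a system with derivatives at every
  point: the exceptional null set disappears under the integral. As \<open>G 0 = 0\<close>, only the
  boundary condition at 1 changes.\<close>

lemma bloch_op_smooth:
  assumes f: "f integrable_on {0..1}" and op: "bloch_op q t u (\<lambda>x. f x + z * u x)"
  obtains v where "u 1 = cis t * u 0" "v 1 - integral {0..1} f = cis t * v 0"
    "\<And>x. x \<in> {0..1} \<Longrightarrow> (u has_vector_derivative v x - integral {0..x} f) (at x within {0..1})"
    "\<And>x. x \<in> {0..1} \<Longrightarrow> (v has_vector_derivative (q x - z) * u x) (at x within {0..1})"
    "continuous_on {0..1} u"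
proof -
  obtain du ddu where d: "\<And>x. x \<in> {0..1} \<Longrightarrow> (du has_integral (u x - u 0)) {0..x}"
      "\<And>x. x \<in> {0..1} \<Longrightarrow> (ddu has_integral (du x - du 0)) {0..x}"
    and bc: "u 1 = cis t * u 0" "du 1 = cis t * du 0"
    and ae: "AE x in lebesgue_on {0..1}. f x + z * u x = - ddu x + q x * u x"
    using op unfolding bloch_op_def by blast
  define G where "G x = integral {0..x} f" for x
  have indef: "continuous_on {0..1} w" if "\<And>x. x \<in> {0..1} \<Longrightarrow> (dw has_integral (w x - w 0)) {0..x}" for w dw :: "real \<Rightarrow> complex"
  proof -
    have "continuous_on {0..1} (\<lambda>x. w 0 + integral {0..x} dw)"
      by (intro continuous_intros indefinite_integral_continuous_1) (use that[of 1] in auto)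
    then show ?thesis
    proof (rule continuous_on_eq)
      fix x :: real assume "x \<in> {0..1}"
      from integral_unique[OF that[OF this]] show "w 0 + integral {0..x} dw = w x" by simp
    qed
  qed
  have deriv: "(w has_vector_derivative dw x) (at x within {0..1})"
    if "\<And>x. x \<in> {0..1} \<Longrightarrow> (dw has_integral (w x - w 0)) {0..x}" "continuous_on {0..1} dw" "x \<in> {0..1}" for w dw :: "real \<Rightarrow> complex" and x
  proof -
    have "((\<lambda>x. integral {0..x} dw) has_vector_derivative dw x) (at x within {0..1})"
      by (rule integral_has_vector_derivative[OF that(2,3)])
    then have "((\<lambda>x. integral {0..x} dw + w 0) has_vector_derivative dw x) (at x within {0..1})"
      by (subst has_vector_derivative_add_const)
    then show ?thesis
    proof (rule has_vector_derivative_transform[OF that(3), rotated])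
      fix x :: real assume "x \<in> {0..1}"
      from integral_unique[OF that(1)[OF this]] show "w x = integral {0..x} dw + w 0" by simp
    qed
  qed
  have uc: "continuous_on {0..1} u" and duc: "continuous_on {0..1} du"
    using indef[OF d(1)] indef[OF d(2)] by auto
  define v where "v x = du x + G x" for x
  have G0: "G 0 = 0" by (simp add: G_def)
  have fint: "(f has_integral G x) {0..x}" if "x \<in> {0..1}" for x
    unfolding G_def using that by (intro integrable_integral integrable_subinterval_real[OF f]) auto
  have "AE x in lebesgue. x \<in> {0..1} \<longrightarrow> f x + z * u x = - ddu x + q x * u x"
    using ae by (subst (asm) AE_restrict_space_iff) auto
  then obtain N where N: "N \<in> null_sets lebesgue" "\<And>x. x \<in> {0..1} \<Longrightarrow> x \<notin> N \<Longrightarrow> f x + z * u x = - ddu x + q x * u x"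
    by (auto elim!: AE_E3)
  then have neg: "negligible N" by (simp add: negligible_iff_null_sets)
  have vint: "((\<lambda>x. (q x - z) * u x) has_integral (v x - v 0)) {0..x}" if x: "x \<in> {0..1}" for x
  proof (rule has_integral_spike[OF neg])
    show "((\<lambda>x. ddu x + f x) has_integral (v x - v 0)) {0..x}"
      using has_integral_add[OF d(2)[OF x] fint[OF x]] by (simp add: v_def G0 algebra_simps)
    fix s assume s: "s \<in> {0..x} - N"
    then have "f s + z * u s = - ddu s + q s * u s" using N(2)[of s] x by auto
    then show "(q s - z) * u s = ddu s + f s" by (simp add: algebra_simps)
  qed
  show thesis
  proof (rule that[of v])
    show "u 1 = cis t * u 0" by (rule bc)
    show "v 1 - integral {0..1} f = cis t * v 0" using bc by (simp add: v_def G_def[symmetric] G0)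
    show "continuous_on {0..1} u" by (rule uc)
    fix x :: real assume x: "x \<in> {0..1}"
    show "(u has_vector_derivative v x - integral {0..x} f) (at x within {0..1})"
      using deriv[OF d(1) duc x] by (simp add: v_def G_def)
    show "(v has_vector_derivative (q x - z) * u x) (at x within {0..1})"
      by (rule deriv[OF vint _ x]) (auto intro!: continuous_intros uc q_continuous)
  qed
qed

lemma cramer:
  fixes a11 :: complex
  assumes "a11 * x + a12 * y = r1" "a21 * x + a22 * y = r2" "a11 * a22 - a12 * a21 = d" "d \<noteq> 0"
  shows "x = (a22 * r1 - a12 * r2) / d" "y = (a11 * r2 - a21 * r1) / d"
proof -
  have "x * d = a22 * r1 - a12 * r2" unfolding assms(1-3)[symmetric] by (simp add: algebra_simps)
  moreover have "y * d = a11 * r2 - a21 * r1" unfolding assms(1-3)[symmetric] by (simp add: algebra_simps)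
  ultimately show "x = (a22 * r1 - a12 * r2) / d" "y = (a11 * r2 - a21 * r1) / d" using assms(4) by (simp_all add: field_simps)
qed

lemma cramer_solution:
  fixes a11 :: complex
  assumes "a11 * a22 - a12 * a21 = d" "d \<noteq> 0"
  shows "a11 * ((a22 * r1 - a12 * r2) / d) + a12 * ((a11 * r2 - a21 * r1) / d) = r1"
    and "a21 * ((a22 * r1 - a12 * r2) / d) + a22 * ((a11 * r2 - a21 * r1) / d) = r2"
proof -
  have "a11 * (a22 * r1 - a12 * r2) + a12 * (a11 * r2 - a21 * r1) = r1 * d" unfolding assms(1)[symmetric] by (simp add: algebra_simps)
  moreover have "a21 * (a22 * r1 - a12 * r2) + a22 * (a11 * r2 - a21 * r1) = r2 * d" unfolding assms(1)[symmetric] by (simp add: algebra_simps)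
  ultimately show "a11 * ((a22 * r1 - a12 * r2) / d) + a12 * ((a11 * r2 - a21 * r1) / d) = r1"
    "a21 * ((a22 * r1 - a12 * r2) / d) + a22 * ((a11 * r2 - a21 * r1) / d) = r2"
    using assms(2) by (simp_all only: times_divide_eq_right add_divide_distrib[symmetric] nonzero_mult_div_cancel_right not_False_eq_True)
qed

text \<open>The boundary conditions form a 2 by 2 system for the initial values with determinant
  \<open>cis t * (2 * cos t - F z)\<close>. Cramer's rule gives a solution for each right-hand side
  and the a priori bound for every solution.\<close>

lemma bloch_spectrum_subset:
  assumes F: "hill_F q z \<noteq> 2 * of_real (cos t)"
  shows "z \<notin> bloch_spectrum q t"
proof -
  define det where "det = cis t * (2 * of_real (cos t) - hill_F q z)"
  have det0: "det \<noteq> 0" using F by (simp add: det_def)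
  have det: "(theta q z 1 - cis t) * (dphi z 1 - cis t) - phi q z 1 * dtheta z 1 = det"
    unfolding det_def by (rule monodromy_det)
  have ex: "\<exists>u. bloch_op q t u (\<lambda>x. f x + z * u x)" if f: "f \<in> L2 (lebesgue_on {0..1})" for f
  proof -
    have fi: "f integrable_on {0..1}" using L2_unit_interval[OF f] by metis
    define G where "G x = integral {0..x} f" for x
    have Gc: "continuous_on {0..1} G" unfolding G_def by (rule indefinite_integral_continuous_1[OF fi])
    have zc: "continuous_on {0..1} (\<lambda>x::real. 0 :: complex)" by simp
    let ?I1 = "voc1 z G (\<lambda>x. 0)" and ?I2 = "voc2 z G (\<lambda>x. 0)"
    \<comment> \<open>The defects which the particular solution with zero initial values leaves in
      the two boundary conditions.\<close>
    define r1 where "r1 = - (theta q z 1 * ?I1 1 + phi q z 1 * ?I2 1)"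
    define r2 where "r2 = G 1 - (dtheta z 1 * ?I1 1 + dphi z 1 * ?I2 1)"
    define A where "A = ((dphi z 1 - cis t) * r1 - phi q z 1 * r2) / det"
    define B where "B = ((theta q z 1 - cis t) * r2 - dtheta z 1 * r1) / det"
    have AB: "(theta q z 1 - cis t) * A + phi q z 1 * B = r1" "dtheta z 1 * A + (dphi z 1 - cis t) * B = r2"
      unfolding A_def B_def by (rule cramer_solution[OF det det0])+
    define u where "u x = theta q z x * (A + ?I1 x) + phi q z x * (B + ?I2 x)" for x
    define v where "v x = dtheta z x * (A + ?I1 x) + dphi z x * (B + ?I2 x)" for x
    have du: "(u has_vector_derivative v x - G x) (at x within {0..1})"
      and dv: "(v has_vector_derivative (q x - z) * u x) (at x within {0..1})" if "x \<in> {0..1}" for x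
      using variation_of_constants_exists[OF Gc zc that, of z A B] unfolding u_def[abs_def] v_def[abs_def] by simp_all
    have uc: "continuous_on {0..1} u"
      unfolding continuous_on_eq_continuous_within using du has_vector_derivative_continuous by blast
    have "bloch_op q t u (\<lambda>x. f x + z * u x)"
      unfolding bloch_op_def
    proof (rule exI[of _ "\<lambda>x. v x - G x"], rule exI[of _ "\<lambda>x. (q x - z) * u x - f x"], intro conjI ballI)
      show "(\<lambda>x. (q x - z) * u x - f x) \<in> L2 (lebesgue_on {0..1})"
        by (intro L2_diff f continuous_L2 continuous_intros uc q_continuous)
      fix x :: real assume x: "x \<in> {0..1}"
      show "((\<lambda>x. v x - G x) has_integral u x - u 0) {0..x}"
        by (rule fundamental_theorem_of_calculus) (use x in \<open>auto intro!: has_vector_derivative_within_subset[OF du]\<close>)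
      have "((\<lambda>x. (q x - z) * u x) has_integral v x - v 0) {0..x}"
        by (rule fundamental_theorem_of_calculus) (use x in \<open>auto intro!: has_vector_derivative_within_subset[OF dv]\<close>)
      moreover have "(f has_integral G x) {0..x}"
        unfolding G_def using x by (intro integrable_integral integrable_subinterval_real[OF fi]) auto
      ultimately have "((\<lambda>x. (q x - z) * u x - f x) has_integral (v x - v 0 - G x)) {0..x}" by (rule has_integral_diff)
      then show "((\<lambda>x. (q x - z) * u x - f x) has_integral (v x - G x - (v 0 - G 0))) {0..x}"
        by (simp add: G_def algebra_simps)
    next
      have 0: "u 0 = A" "v 0 = B" "G 0 = 0" by (simp_all add: u_def v_def voc1_def voc2_def G_def)
      have "u 1 - cis t * A = (theta q z 1 - cis t) * A + phi q z 1 * B - r1"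
        by (simp add: u_def r1_def algebra_simps)
      then show "u 1 = cis t * u 0" unfolding AB 0 by simp
      have "v 1 - G 1 - cis t * B = dtheta z 1 * A + (dphi z 1 - cis t) * B - r2"
        by (simp add: v_def r2_def algebra_simps)
      then show "v 1 - G 1 = cis t * (v 0 - G 0)" unfolding AB 0 by simp
      show "AE x in lebesgue_on {0..1}. f x + z * u x = - ((q x - z) * u x - f x) + q x * u x"
        by (intro AE_I2) (simp add: algebra_simps)
    qed
    then show ?thesis by blast
  qed
  obtain b where b: "\<And>w x. w \<in> {theta q z, phi q z, dtheta z, dphi z} \<Longrightarrow> x \<in> {0..1} \<Longrightarrow> cmod (w x) \<le> b" "1 \<le> b"
  proof -
    have ex: "\<exists>b. \<forall>x\<in>{0..1}. cmod (w x) \<le> b" if "continuous_on {0..1} w" for w :: "real \<Rightarrow> complex"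
      using compact_imp_bounded[OF compact_continuous_image[OF that compact_Icc]] by (meson bounded_iff image_eqI)
    obtain b1 where 1: "\<forall>x\<in>{0..1}. cmod (theta q z x) \<le> b1" using ex[OF sol_continuous_real(1)] by blast
    obtain b2 where 2: "\<forall>x\<in>{0..1}. cmod (phi q z x) \<le> b2" using ex[OF sol_continuous_real(2)] by blast
    obtain b3 where 3: "\<forall>x\<in>{0..1}. cmod (dtheta z x) \<le> b3" using ex[OF sol_continuous_real(3)] by blast
    obtain b4 where 4: "\<forall>x\<in>{0..1}. cmod (dphi z x) \<le> b4" using ex[OF sol_continuous_real(4)] by blast
    show thesis
      by (rule that[of "max 1 (max (max b1 b2) (max b3 b4))"]) (use 1 2 3 4 in \<open>auto simp: le_max_iff_disj\<close>)
  qed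
  \<comment> \<open>With \<open>g\<close> the norm of \<open>f\<close>, the matrix entries are at
    most \<open>b + 1\<close> and the right-hand sides at most \<open>(2 * b^2 + 1) * g\<close>, so
    Cramer's rule bounds \<open>u 0\<close> and \<open>v 0\<close> by \<open>c1 * g\<close>. In
    \<open>K\<close> the summand \<open>b\<close> accounts for \<open>voc1\<close> and
    \<open>voc2\<close>.\<close>
  define c1 where "c1 = (2 * (b + 1) * (2 * b\<^sup>2 + 1)) / cmod det"
  define K where "K = 2 * b * (c1 + b)"
  have b0: "0 \<le> b" using b(2) by simp
  have c10: "0 \<le> c1" using b0 by (simp add: c1_def)
  have est: "sq_norm (lebesgue_on {0..1}) u \<le> ennreal (K\<^sup>2) * sq_norm (lebesgue_on {0..1}) f"
    if f: "f \<in> L2 (lebesgue_on {0..1})" and op: "bloch_op q t u (\<lambda>x. f x + z * u x)" for f u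
  proof -
    obtain g where g: "0 \<le> g" "f integrable_on {0..1}" "\<And>x. x \<in> {0..1} \<Longrightarrow> cmod (integral {0..x} f) \<le> g"
      "sq_norm (lebesgue_on {0..1}) f = ennreal (g\<^sup>2)"
      using L2_unit_interval[OF f] by metis
    define G where "G x = integral {0..x} f" for x
    have Gc: "continuous_on {0..1} G" unfolding G_def by (rule indefinite_integral_continuous_1[OF g(2)])
    have Gg: "cmod (G x) \<le> g" if "x \<in> {0..1}" for x unfolding G_def by (rule g(3)[OF that])
    obtain v where v: "u 1 = cis t * u 0" "v 1 - G 1 = cis t * v 0"
      "\<And>x. x \<in> {0..1} \<Longrightarrow> (u has_vector_derivative v x - G x) (at x within {0..1})"
      "\<And>x. x \<in> {0..1} \<Longrightarrow> (v has_vector_derivative (q x - z) * u x) (at x within {0..1})"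
      "continuous_on {0..1} u"
      by (rule bloch_op_smooth[OF g(2) op, folded G_def]) (rule that)
    let ?I1 = "voc1 z G (\<lambda>x. 0)" and ?I2 = "voc2 z G (\<lambda>x. 0)"
    have voc: "u x = theta q z x * (u 0 + ?I1 x) + phi q z x * (v 0 + ?I2 x)"
      "v x = dtheta z x * (u 0 + ?I1 x) + dphi z x * (v 0 + ?I2 x)" if "x \<in> {0..1}" for x
      by (rule variation_of_constants[OF Gc _ v(3) _ that]; use v(4) in simp)+
    have I: "cmod (?I1 x) \<le> b * g" "cmod (?I2 x) \<le> b * g" if x: "x \<in> {0..1}" for x
    proof -
      have "cmod (integral {0..x} (\<lambda>s. G s * w s)) \<le> b * g" if w: "w \<in> {dtheta z, dphi z}" for w
      proof -
        have "continuous_on {0..x} (\<lambda>s. G s * w s)"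
          using w x by (auto intro!: continuous_intros sol_continuous_real continuous_on_subset[OF Gc])
        then have "cmod (integral {0..x} (\<lambda>s. G s * w s)) \<le> g * b * (x - 0)"
          using x w by (intro integral_bound) (auto simp: norm_mult intro!: mult_mono Gg b(1) g(1))
        also have "\<dots> \<le> g * b * 1" using x g(1) b0 by (intro mult_left_mono) auto
        finally show ?thesis by (simp add: mult.commute)
      qed
      then show "cmod (?I1 x) \<le> b * g" "cmod (?I2 x) \<le> b * g"
        unfolding voc1_def voc2_def by (simp_all add: integral_neg)
    qed
    define r1 where "r1 = - (theta q z 1 * ?I1 1 + phi q z 1 * ?I2 1)"
    define r2 where "r2 = G 1 - (dtheta z 1 * ?I1 1 + dphi z 1 * ?I2 1)"
    have two: "cmod (w1 * y1 + w2 * y2) \<le> B1 * c + B1 * c" if "cmod w1 \<le> B1" "cmod w2 \<le> B1" "cmod y1 \<le> c" "cmod y2 \<le> c" for w1 w2 y1 y2 :: complex and B1 c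
    proof -
      have "0 \<le> B1" "0 \<le> c" using that norm_ge_zero order_trans by blast+
      then show ?thesis using that
        by (intro order_trans[OF norm_triangle_ineq] add_mono) (auto simp: norm_mult intro!: mult_mono)
    qed
    have r: "cmod r1 \<le> (2 * b\<^sup>2 + 1) * g" "cmod r2 \<le> (2 * b\<^sup>2 + 1) * g"
    proof -
      have "cmod (theta q z 1 * ?I1 1 + phi q z 1 * ?I2 1) \<le> b * (b * g) + b * (b * g)"
        "cmod (dtheta z 1 * ?I1 1 + dphi z 1 * ?I2 1) \<le> b * (b * g) + b * (b * g)"
        by (rule two; use b(1) I in simp)+
      moreover have "cmod r2 \<le> cmod (G 1) + cmod (dtheta z 1 * ?I1 1 + dphi z 1 * ?I2 1)"
        unfolding r2_def by (rule norm_triangle_ineq4)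
      moreover have "cmod r1 = cmod (theta q z 1 * ?I1 1 + phi q z 1 * ?I2 1)" unfolding r1_def norm_minus_cancel ..
      ultimately show "cmod r1 \<le> (2 * b\<^sup>2 + 1) * g" "cmod r2 \<le> (2 * b\<^sup>2 + 1) * g"
        using Gg[of 1] g(1) by (simp_all add: power2_eq_square algebra_simps)
    qed
    have eq: "(theta q z 1 - cis t) * u 0 + phi q z 1 * v 0 = r1" "dtheta z 1 * u 0 + (dphi z 1 - cis t) * v 0 = r2"
      using voc[of 1] v(1,2) by (simp_all add: r1_def r2_def algebra_simps)
    have cb: "cmod (theta q z 1 - cis t) \<le> b + 1" "cmod (dphi z 1 - cis t) \<le> b + 1" "cmod (- phi q z 1) \<le> b + 1" "cmod (- dtheta z 1) \<le> b + 1"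
      using norm_triangle_ineq4[of "theta q z 1" "cis t"] norm_triangle_ineq4[of "dphi z 1" "cis t"]
        b(1)[of "theta q z" 1] b(1)[of "dphi z" 1] b(1)[of "phi q z" 1] b(1)[of "dtheta z" 1] by simp_all
    have "cmod (u 0) \<le> c1 * g" "cmod (v 0) \<le> c1 * g"
    proof -
      have "cmod ((dphi z 1 - cis t) * r1 + (- phi q z 1) * r2) \<le> (b + 1) * ((2 * b\<^sup>2 + 1) * g) + (b + 1) * ((2 * b\<^sup>2 + 1) * g)"
        "cmod ((theta q z 1 - cis t) * r2 + (- dtheta z 1) * r1) \<le> (b + 1) * ((2 * b\<^sup>2 + 1) * g) + (b + 1) * ((2 * b\<^sup>2 + 1) * g)"
        by (rule two; rule cb r)+
      then have "cmod ((dphi z 1 - cis t) * r1 - phi q z 1 * r2) \<le> 2 * (b + 1) * (2 * b\<^sup>2 + 1) * g"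
        "cmod ((theta q z 1 - cis t) * r2 - dtheta z 1 * r1) \<le> 2 * (b + 1) * (2 * b\<^sup>2 + 1) * g"
        by (simp_all add: algebra_simps)
      then show "cmod (u 0) \<le> c1 * g" "cmod (v 0) \<le> c1 * g"
        unfolding cramer[OF eq det det0] norm_divide c1_def times_divide_eq_left by (simp_all add: divide_right_mono)
    qed
    then have ub: "cmod (u x) \<le> K * g" if x: "x \<in> {0..1}" for x
    proof -
      have "cmod (u 0 + ?I1 x) \<le> (c1 + b) * g" "cmod (v 0 + ?I2 x) \<le> (c1 + b) * g"
        using I[OF x] \<open>cmod (u 0) \<le> c1 * g\<close> \<open>cmod (v 0) \<le> c1 * g\<close>
        by (auto intro: order_trans[OF norm_triangle_ineq] simp: distrib_right)
      then have "cmod (u x) \<le> b * ((c1 + b) * g) + b * ((c1 + b) * g)"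
        unfolding voc(1)[OF x] by (intro two b(1) x) auto
      then show ?thesis by (simp add: K_def mult_ac)
    qed
    have "sq_norm (lebesgue_on {0..1}) u = ennreal (integral {0..1} (\<lambda>x. (cmod (u x))\<^sup>2))" by (rule sq_norm_continuous[OF v(5)])
    also have "\<dots> \<le> ennreal ((K * g)\<^sup>2)"
    proof (intro ennreal_leI)
      have "integral {0..1} (\<lambda>x. (cmod (u x))\<^sup>2) \<le> integral {0..1} (\<lambda>x::real. (K * g)\<^sup>2)"
        by (intro integral_le integrable_continuous_real continuous_intros v(5) power_mono ub) auto
      then show "integral {0..1} (\<lambda>x. (cmod (u x))\<^sup>2) \<le> (K * g)\<^sup>2" by simp
    qed
    also have "\<dots> = ennreal (K\<^sup>2) * sq_norm (lebesgue_on {0..1}) f"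
      unfolding g(4) by (simp add: power_mult_distrib ennreal_mult)
    finally show ?thesis .
  qed
  have "\<exists>K<\<infinity>. \<forall>f\<in>L2 (lebesgue_on {0..1}). \<forall>u. bloch_op q t u (\<lambda>x. f x + z * u x) \<longrightarrow>
        sq_norm (lebesgue_on {0..1}) u \<le> K * sq_norm (lebesgue_on {0..1}) f"
    by (intro exI[of _ "ennreal (K\<^sup>2)"]) (use est in auto)
  then show ?thesis unfolding bloch_spectrum_def using ex by simp
qed

lemma bloch_op_floquet_solution:
  assumes y: "hill_sol q l y dy" "y 1 = cis t * y 0" "dy 1 = cis t * dy 0" and h: "\<And>x. h x = l * y x"
  shows "bloch_op q t y h"
  unfolding bloch_op_def
proof (rule exI[of _ dy], rule exI[of _ "\<lambda>x. (q x - l) * y x"], intro conjI ballI)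
  have d: "(y has_vector_derivative dy x) (at x within S)" "(dy has_vector_derivative (q x - l) * y x) (at x within S)" for x S
    using y(1) unfolding hill_sol_def by (auto intro: has_vector_derivative_at_within)
  show "(\<lambda>x. (q x - l) * y x) \<in> L2 (lebesgue_on {0..1})"
    by (intro continuous_L2 continuous_intros q_continuous hill_sol_continuous(1)[OF y(1)])
  fix x :: real assume "x \<in> {0..1}"
  then show "(dy has_integral y x - y 0) {0..x}" "((\<lambda>x. (q x - l) * y x) has_integral dy x - dy 0) {0..x}"
    by (intro fundamental_theorem_of_calculus d; simp)+
next
  show "AE x in lebesgue_on {0..1}. h x = - ((q x - l) * y x) + q x * y x"
    by (intro AE_I2) (simp add: h algebra_simps)
qed (use y in auto)

text \<open>A Floquet solution solves the problem with right-hand side 0, so the resolvent bound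
  would force it to vanish on \<open>{0..1}\<close>.\<close>

lemma bloch_spectrum_supset:
  assumes F: "hill_F q z = 2 * of_real (cos t)"
  shows "z \<in> bloch_spectrum q t"
proof (rule ccontr)
  assume "z \<notin> bloch_spectrum q t"
  then obtain K where K: "K < \<infinity>" "\<And>f u. f \<in> L2 (lebesgue_on {0..1}) \<Longrightarrow> bloch_op q t u (\<lambda>x. f x + z * u x) \<Longrightarrow>
        sq_norm (lebesgue_on {0..1}) u \<le> K * sq_norm (lebesgue_on {0..1}) f"
    unfolding bloch_spectrum_def by auto
  obtain y dy where y: "hill_sol q z y dy" "y 1 = cis t * y 0" "dy 1 = cis t * dy 0" "y 0 \<noteq> 0 \<or> dy 0 \<noteq> 0"
    using floquet_solution_exists[OF characteristic_equation[OF F]] by metis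
  have yc: "continuous_on S y" for S by (rule hill_sol_continuous(1)[OF y(1)])
  have "sq_norm (lebesgue_on {0..1}) y \<le> K * sq_norm (lebesgue_on {0..1}) (\<lambda>x. 0)"
  proof (rule K(2))
    show "(\<lambda>x. 0) \<in> L2 (lebesgue_on {0..1})" by (rule continuous_L2) simp
    show "bloch_op q t y (\<lambda>x. 0 + z * y x)" by (rule bloch_op_floquet_solution[OF y(1-3)]) simp
  qed
  also have "\<dots> = 0" by (simp add: sq_norm_def)
  finally have "integral {0..1} (\<lambda>x. (cmod (y x))\<^sup>2) \<le> 0" by (simp add: sq_norm_continuous[OF yc] ennreal_eq_0_iff)
  moreover have "0 \<le> integral {0..1} (\<lambda>x. (cmod (y x))\<^sup>2)" by (intro integral_nonneg integrable_continuous_real continuous_intros yc) auto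
  ultimately have "integral {0..1} (\<lambda>x. (cmod (y x))\<^sup>2) = 0" by simp
  then have "((\<lambda>x. (cmod (y x))\<^sup>2) has_integral 0) (cbox 0 1)"
    using integrable_integral[OF integrable_continuous_real, of 0 1 "\<lambda>x. (cmod (y x))\<^sup>2"] by (simp add: continuous_intros yc)
  then have "(cmod (y x))\<^sup>2 = 0" if "x \<in> {0..1}" for x
    using has_integral_0_cbox_imp_0[of 0 1 "\<lambda>x. (cmod (y x))\<^sup>2" x] that by (auto simp: continuous_intros yc)
  then show False using hill_sol_nonzero[OF y(1,4)] by auto
qed

lemma bloch_spectrum_eq: "bloch_spectrum q t = {z. hill_F q z = 2 * of_real (cos t)}"
  using bloch_spectrum_subset bloch_spectrum_supset by blast

end

section \<open>The norm of the spectral projection of a simple eigenvalue\<close>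

context hill_potential
begin

text \<open>\<open>resolvent_numerator t f x z\<close> divided by \<open>2 cos t - F z\<close> is the resolvent of \<open>H\<^sub>t\<close> at \<open>z\<close>, applied to \<open>f\<close>.\<close>

definition resolvent_numerator :: "real \<Rightarrow> (real \<Rightarrow> complex) \<Rightarrow> real \<Rightarrow> complex \<Rightarrow> complex" where
  "resolvent_numerator t f x z =
     theta q z x * ((theta q z 1 - cis (- t)) * voc1 z (\<lambda>x. 0) f 1 + phi q z 1 * voc2 z (\<lambda>x. 0) f 1)
   + phi q z x * (dtheta z 1 * voc1 z (\<lambda>x. 0) f 1 + (dphi z 1 - cis (- t)) * voc2 z (\<lambda>x. 0) f 1)
   + (2 * of_real (cos t) - hill_F q z) * (theta q z x * voc1 z (\<lambda>x. 0) f x + phi q z x * voc2 z (\<lambda>x. 0) f x)"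

lemma voc_holomorphic:
  assumes f: "continuous_on {0..1} f" and x: "x \<in> {0..1}"
  shows "(\<lambda>z. voc1 z (\<lambda>x. 0) f x) holomorphic_on UNIV" "(\<lambda>z. voc2 z (\<lambda>x. 0) f x) holomorphic_on UNIV"
proof -
  have fc: "continuous_on (UNIV \<times> {0..x}) (\<lambda>p::complex \<times> real. f (snd p))"
    by (rule continuous_on_compose2[OF f]) (use x in \<open>auto intro!: continuous_intros\<close>)
  have "(\<lambda>z. integral {0..x} (\<lambda>s. f s * phi q z s)) holomorphic_on UNIV"
    by (rule holomorphic_integral_parameter) (auto intro!: continuous_intros fc holomorphic_intros)
  then show "(\<lambda>z. voc1 z (\<lambda>x. 0) f x) holomorphic_on UNIV" by (simp add: voc1_def)
  have "(\<lambda>z. integral {0..x} (\<lambda>s. - (f s * theta q z s))) holomorphic_on UNIV"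
    by (rule holomorphic_integral_parameter) (auto intro!: continuous_intros fc holomorphic_intros)
  then show "(\<lambda>z. voc2 z (\<lambda>x. 0) f x) holomorphic_on UNIV" by (simp add: voc2_def)
qed

lemma resolvent_numerator_holomorphic:
  assumes f: "continuous_on {0..1} f" and x: "x \<in> {0..1}"
  shows "resolvent_numerator t f x holomorphic_on S"
proof -
  have v: "(\<lambda>z. voc1 z (\<lambda>x. 0) f x) holomorphic_on S" "(\<lambda>z. voc2 z (\<lambda>x. 0) f x) holomorphic_on S"
    if "x \<in> {0..1}" for x
    using voc_holomorphic[OF f that] holomorphic_on_subset by blast+
  show ?thesis
    unfolding resolvent_numerator_def[abs_def] by (intro holomorphic_intros v x) auto
qed

text \<open>Whichever solution \<open>SOME\<close> selects, variation of constants and the boundary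
  conditions determine its initial values, and thereby its values on \<open>{0..1}\<close>.\<close>

lemma bloch_resolvent_eq:
  assumes f: "continuous_on {0..1} f" and F: "hill_F q z \<noteq> 2 * of_real (cos t)" and x: "x \<in> {0..1}"
  shows "bloch_resolvent q t z f x = resolvent_numerator t f x z / (2 * of_real (cos t) - hill_F q z)"
proof -
  define u where "u = bloch_resolvent q t z f"
  define c where "c = 2 * of_real (cos t) - hill_F q z"
  have c0: "c \<noteq> 0" using F by (simp add: c_def)
  have "\<exists>u. bloch_op q t u (\<lambda>x. f x + z * u x)"
    using bloch_spectrum_subset[OF F] continuous_L2[OF f] unfolding bloch_spectrum_def by blast
  then have op: "bloch_op q t u (\<lambda>x. f x + z * u x)"
    unfolding u_def bloch_resolvent_def by (rule someI_ex)
  have fi: "f integrable_on {0..1}" by (rule integrable_continuous_real[OF f])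
  define G where "G x = integral {0..x} f" for x
  obtain v where v: "u 1 = cis t * u 0" "v 1 - G 1 = cis t * v 0"
      "\<And>x. x \<in> {0..1} \<Longrightarrow> (u has_vector_derivative v x - G x) (at x within {0..1})"
      "\<And>x. x \<in> {0..1} \<Longrightarrow> (v has_vector_derivative (q x - z) * u x) (at x within {0..1})"
      "continuous_on {0..1} u"
    by (rule bloch_op_smooth[OF fi op, folded G_def]) (rule that)
  \<comment> \<open>For continuous \<open>f\<close> the auxiliary \<open>G\<close> can be removed
    again: \<open>w\<close> is the classical derivative of \<open>u\<close> and carries
    \<open>f\<close> itself as inhomogeneity.\<close>
  define w where "w x = v x - G x" for x
  have dG: "(G has_vector_derivative f x) (at x within {0..1})" if "x \<in> {0..1}" for x
    unfolding G_def[abs_def] by (rule integral_has_vector_derivative[OF f that])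
  have du: "(u has_vector_derivative w x - 0) (at x within {0..1})" if "x \<in> {0..1}" for x
    using v(3)[OF that] by (simp add: w_def)
  have dw: "(w has_vector_derivative (q x - z) * u x - f x) (at x within {0..1})" if "x \<in> {0..1}" for x
    unfolding w_def[abs_def] by (rule has_vector_derivative_diff[OF v(4)[OF that] dG[OF that]])
  have G0: "G 0 = 0" by (simp add: G_def)
  have bc: "u 1 = cis t * u 0" "w 1 = cis t * w 0" using v(1,2) by (simp_all add: w_def G0)
  let ?I1 = "voc1 z (\<lambda>x. 0) f" and ?I2 = "voc2 z (\<lambda>x. 0) f"
  have voc: "u x = theta q z x * (u 0 + ?I1 x) + phi q z x * (w 0 + ?I2 x)"
    "w x = dtheta z x * (u 0 + ?I1 x) + dphi z x * (w 0 + ?I2 x)" if "x \<in> {0..1}" for x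
    by (rule variation_of_constants[OF continuous_on_const f du dw that]; assumption)+
  have W: "theta q z 1 * dphi z 1 - dtheta z 1 * phi q z 1 = 1" by (rule wronskian)
  have cc: "cis t * cis (- t) = 1" by (simp add: cis_mult)
  have Fc: "c = cis t + cis (- t) - (theta q z 1 + dphi z 1)"
    unfolding c_def hill_F_eq by (simp add: complex_eq_iff)
  have e1: "theta q z 1 * (u 0 + ?I1 1) + phi q z 1 * (w 0 + ?I2 1) = cis t * u 0"
    "dtheta z 1 * (u 0 + ?I1 1) + dphi z 1 * (w 0 + ?I2 1) = cis t * w 0"
    using voc[of 1] bc by simp_all
  have u0: "c * u 0 = (theta q z 1 - cis (- t)) * ?I1 1 + phi q z 1 * ?I2 1"
    using e1 W cc Fc by algebra
  have w0: "c * w 0 = dtheta z 1 * ?I1 1 + (dphi z 1 - cis (- t)) * ?I2 1"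
    using e1 W cc Fc by algebra
  have "c * u x = theta q z x * (c * u 0) + phi q z x * (c * w 0) + c * (theta q z x * ?I1 x + phi q z x * ?I2 x)"
    unfolding voc(1)[OF x] by (simp add: algebra_simps)
  also have "\<dots> = resolvent_numerator t f x z" unfolding u0 w0 resolvent_numerator_def c_def[symmetric] ..
  finally show ?thesis using c0 by (simp add: u_def c_def field_simps)
qed

text \<open>At an eigenvalue the last summand drops out, and \<open>M - cis (- t)\<close> maps into
  the eigenspace of \<open>M\<close> for \<open>cis t\<close>. So the numerator has rank one: a
  multiple of \<open>Phi q t l\<close>, with the pairing of \<open>f\<close> and
  \<open>Phi q (- t) l\<close> as coefficient.\<close>

lemma resolvent_numerator_eigenvalue:
  assumes F: "hill_F q l = 2 * of_real (cos t)" and ph: "phi q l 1 \<noteq> 0" and f: "continuous_on {0..1} f"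
  shows "resolvent_numerator t f x l = - phi q l 1 * integral {0..1} (\<lambda>s. Phi q (- t) l s * f s) * Phi q t l x"
proof -
  let ?I1 = "voc1 l (\<lambda>x. 0) f 1" and ?I2 = "voc2 l (\<lambda>x. 0) f 1"
  define \<rho> where "\<rho> = cis t"
  define \<rho>' where "\<rho>' = cis (- t)"
  define k where "k = (\<rho>' - theta q l 1) / phi q l 1"
  have kp: "k * phi q l 1 = \<rho>' - theta q l 1" using ph by (simp add: k_def)
  have cc: "\<rho> * \<rho>' = 1" by (simp add: \<rho>_def \<rho>'_def cis_mult)
  have Fr: "theta q l 1 + dphi l 1 = \<rho> + \<rho>'"
    using F unfolding hill_F_eq by (simp add: \<rho>_def \<rho>'_def complex_eq_iff)
  have W: "theta q l 1 * dphi l 1 - dtheta l 1 * phi q l 1 = 1" by (rule wronskian)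
  define P where "P = integral {0..1} (\<lambda>s. Phi q (- t) l s * f s)"
  have P: "P = k * ?I1 - ?I2"
  proof -
    have i: "(\<lambda>s. f s * phi q l s) integrable_on {0..1}" "(\<lambda>s. f s * theta q l s) integrable_on {0..1}"
      by (intro integrable_continuous_real continuous_intros f sol_continuous_real)+
    have "P = integral {0..1} (\<lambda>s. k * (f s * phi q l s) + f s * theta q l s)"
      unfolding P_def Phi_def k_def \<rho>'_def by (intro integral_cong) (simp add: algebra_simps)
    also have "\<dots> = k * integral {0..1} (\<lambda>s. f s * phi q l s) + integral {0..1} (\<lambda>s. f s * theta q l s)"
      by (subst integral_add) (auto intro!: integrable_on_mult_right i)
    also have "\<dots> = k * ?I1 - ?I2" by (simp add: voc1_def voc2_def integral_neg)
    finally show ?thesis .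
  qed
  have 1: "(theta q l 1 - \<rho>') * ?I1 + phi q l 1 * ?I2 = - phi q l 1 * P"
    unfolding P using kp by algebra
  have 2: "dtheta l 1 * ?I1 + (dphi l 1 - \<rho>') * ?I2 = - (\<rho> - theta q l 1) * P"
  proof -
    have "phi q l 1 * (dtheta l 1 * ?I1 + (dphi l 1 - \<rho>') * ?I2) = phi q l 1 * (- (\<rho> - theta q l 1) * P)"
      unfolding P using kp cc Fr W by algebra
    then show ?thesis using ph by simp
  qed
  have "resolvent_numerator t f x l = theta q l x * (- phi q l 1 * P) + phi q l x * (- (\<rho> - theta q l 1) * P)"
    unfolding resolvent_numerator_def \<rho>'_def[symmetric] 1 2 F by simp
  also have "\<dots> = - phi q l 1 * P * Phi q t l x"
    using ph unfolding Phi_def \<rho>_def by (simp add: field_simps)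
  finally show ?thesis by (simp add: P_def)
qed

lemma isolating_radius_works:
  assumes F: "hill_F q l = 2 * of_real (cos t)" and dF: "deriv (hill_F q) l \<noteq> 0"
  shows "isolating_radius q t l > 0 \<and> cball l (isolating_radius q t l) \<inter> bloch_spectrum q t = {l}"
proof -
  let ?c = "2 * complex_of_real (cos t)"
  have "\<exists>w. hill_F q w - ?c \<noteq> 0"
  proof (rule ccontr)
    assume "\<not> ?thesis"
    then have "hill_F q = (\<lambda>w. ?c)" by auto
    then show False using dF by simp
  qed
  then obtain w where w: "hill_F q w - ?c \<noteq> 0" by blast
  have "(\<lambda>z. hill_F q z - ?c) holomorphic_on UNIV" by (intro holomorphic_intros)
  from entire_zeros_isolated[OF this w, of l]
  obtain r where r: "r > 0" "\<forall>z\<in>ball l r - {l}. hill_F q z - ?c \<noteq> 0" by blast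
  have "\<exists>r>0. cball l r \<inter> bloch_spectrum q t = {l}"
    unfolding bloch_spectrum_eq using r F by (intro exI[of _ "r / 2"]) auto
  then show ?thesis unfolding isolating_radius_def by (rule someI_ex)
qed

lemma spectral_projection_eq:
  assumes F: "hill_F q l = 2 * of_real (cos t)" and ph: "phi q l 1 \<noteq> 0" and dF: "deriv (hill_F q) l \<noteq> 0"
    and f: "continuous_on {0..1} f" and x: "x \<in> {0..1}" and \<sigma>: "\<sigma> \<inter> bloch_spectrum q t = {l}"
  shows "spectral_projection q t \<sigma> f x = - phi q l 1 / deriv (hill_F q) l * integral {0..1} (\<lambda>s. Phi q (- t) l s * f s) * Phi q t l x"
proof -
  define r where "r = isolating_radius q t l"
  have r: "r > 0" "\<And>z. z \<in> cball l r \<Longrightarrow> z \<noteq> l \<Longrightarrow> hill_F q z \<noteq> 2 * of_real (cos t)"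
    using isolating_radius_works[OF F dF] unfolding r_def bloch_spectrum_eq by blast+
  \<comment> \<open>The difference quotient of \<open>F\<close> splits off the simple zero at
    \<open>l\<close>. It has no zero on the isolating disc, so the resolvent is
    \<open>g z / (z - l)\<close> with \<open>g\<close> holomorphic and Cauchy's formula
    applies.\<close>
  define h where "h z = (if z = l then deriv (hill_F q) l else (hill_F q z - hill_F q l) / (z - l))" for z
  have hh: "h holomorphic_on UNIV"
    unfolding h_def[abs_def] by (rule pole_lemma[OF hill_F_holomorphic]) auto
  have h0: "h z \<noteq> 0" if "z \<in> cball l r" for z
    using r(2)[OF that] dF F by (auto simp: h_def)
  define g where "g z = - resolvent_numerator t f x z / h z" for z
  have gh: "g holomorphic_on cball l r"
    unfolding g_def[abs_def]
    by (intro holomorphic_intros resolvent_numerator_holomorphic[OF f x] holomorphic_on_subset[OF hh] h0) auto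
  have "((\<lambda>z. g z / (z - l)) has_contour_integral (2 * of_real pi * \<i> * g l)) (circlepath l r)"
    by (rule Cauchy_integral_circlepath) (use gh r(1) in \<open>auto intro: holomorphic_on_imp_continuous_on holomorphic_on_subset\<close>)
  moreover have "g z / (z - l) = bloch_resolvent q t z f x" if "z \<in> path_image (circlepath l r)" for z
  proof -
    have z: "z \<in> cball l r" "z \<noteq> l" using that r(1) by (auto simp: dist_norm)
    have "h z * (z - l) = hill_F q z - 2 * of_real (cos t)" using z(2) F by (simp add: h_def)
    then have "g z / (z - l) = - resolvent_numerator t f x z / (hill_F q z - 2 * of_real (cos t))"
      by (simp add: g_def)
    also have "\<dots> = resolvent_numerator t f x z / (2 * of_real (cos t) - hill_F q z)"
      by (metis minus_diff_eq minus_divide_left minus_divide_right)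
    finally show ?thesis using bloch_resolvent_eq[OF f r(2)[OF z] x] by simp
  qed
  ultimately have "((\<lambda>z. bloch_resolvent q t z f x) has_contour_integral (2 * of_real pi * \<i> * g l)) (circlepath l r)"
    by (rule has_contour_integral_eq)
  then have "contour_integral (circlepath l (isolating_radius q t l)) (\<lambda>z. bloch_resolvent q t z f x) = 2 * of_real pi * \<i> * g l"
    unfolding r_def by (rule contour_integral_unique)
  then have "spectral_projection q t \<sigma> f x = - g l"
    unfolding spectral_projection_def \<sigma> by simp
  also have "\<dots> = resolvent_numerator t f x l / deriv (hill_F q) l" by (simp add: g_def h_def)
  finally show ?thesis unfolding resolvent_numerator_eigenvalue[OF F ph f] by simp
qed

text \<open>The projection has rank one, and the conjugate of \<open>Phi q (- t) l\<close> is the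
  extremal test function; it yields \<open>sqrt (A1 * A2) / cmod D\<close> as a lower bound for the
  norm.\<close>

lemma spectral_projection_norm_ge:
  assumes arc: "isolating_arc q L R lam \<alpha> \<beta> Q" and t: "t \<in> {\<alpha>..\<beta>}" and L: "0 \<le> L"
  shows "ennreal L \<le> spectral_projection_norm q t Q"
  unfolding spectral_projection_norm_def
proof (rule op_norm_ge)
  fix k :: real assume k: "0 \<le> k"
    and bound: "\<And>f. f \<in> L2 (lebesgue_on {0..1}) \<Longrightarrow>
      sq_norm (lebesgue_on {0..1}) (spectral_projection q t Q f) \<le> (ennreal k)\<^sup>2 * sq_norm (lebesgue_on {0..1}) f"
  define l where "l = lam (of_real t)"
  have F: "hill_F q l = 2 * of_real (cos t)" and dF: "deriv (hill_F q) l \<noteq> 0"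
    using arc t unfolding isolating_arc_def regular_spectral_arc_def l_def by blast+
  have ph: "phi q l 1 \<noteq> 0" and lQ: "l \<in> Q" and un: "\<And>z. z \<in> Q \<Longrightarrow> hill_F q z = 2 * of_real (cos t) \<Longrightarrow> z = l"
    using arc t unfolding isolating_arc_def l_def by blast+
  define P1 where "P1 = Phi q (- t) l"
  define P2 where "P2 = Phi q t l"
  define A1 where "A1 = integral {0..1} (\<lambda>x. (cmod (P1 x))\<^sup>2)"
  define A2 where "A2 = integral {0..1} (\<lambda>x. (cmod (P2 x))\<^sup>2)"
  define D where "D = integral {0..1} (\<lambda>x. P2 x * P1 x)"
  have gram: "(L * cmod D)\<^sup>2 < A2 * A1"
    using arc t unfolding isolating_arc_def l_def D_def P1_def P2_def A1_def A2_def by blast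
  have P1c: "continuous_on X P1" and P2c: "continuous_on X P2" for X
    unfolding P1_def P2_def using ph by (intro continuous_intros; simp)+
  have fc: "continuous_on X (\<lambda>x. cnj (P1 x))" for X by (intro continuous_intros P1c)
  have A: "0 \<le> A1" "0 \<le> A2"
    unfolding A1_def A2_def by (intro integral_nonneg integrable_continuous_real continuous_intros P1c P2c; simp)+
  have A1p: "0 < A1"
    using gram A zero_le_power2[of "L * cmod D"] by (cases "A1 = 0") auto
  have \<sigma>: "Q \<inter> bloch_spectrum q t = {l}" unfolding bloch_spectrum_eq using lQ un F by blast
  have dD: "deriv (hill_F q) l = - phi q l 1 * D"
    unfolding D_def P1_def P2_def by (rule deriv_hill_F[OF F ph])
  then have D0: "D \<noteq> 0" using dF by auto
  have PA: "integral {0..1} (\<lambda>s. Phi q (- t) l s * cnj (P1 s)) = of_real A1"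
  proof -
    have "((\<lambda>x. complex_of_real ((cmod (P1 x))\<^sup>2)) has_integral of_real A1) {0..1}"
      unfolding A1_def
      by (intro has_integral_linear[OF integrable_integral[OF integrable_continuous_real] bounded_linear_of_real, unfolded o_def]
          continuous_intros P1c)
    then show ?thesis by (simp only: complex_norm_square P1_def integral_unique)
  qed
  have proj: "spectral_projection q t Q (\<lambda>x. cnj (P1 x)) x = of_real A1 / D * P2 x" if "x \<in> {0..1}" for x
    unfolding spectral_projection_eq[OF F ph dF fc that \<sigma>] PA dD P2_def using ph by simp
  have "(cmod (of_real A1 / D * P2 x))\<^sup>2 = (A1 / cmod D)\<^sup>2 * (cmod (P2 x))\<^sup>2" for x
    using A by (simp add: norm_mult norm_divide power_mult_distrib power_divide)
  then have "ennreal ((A1 / cmod D)\<^sup>2 * A2) = ennreal (integral {0..1} (\<lambda>x. (cmod (of_real A1 / D * P2 x))\<^sup>2))"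
    by (simp only: A2_def integral_mult_right)
  also have "\<dots> = sq_norm (lebesgue_on {0..1}) (\<lambda>x. of_real A1 / D * P2 x)"
    by (rule sq_norm_continuous[symmetric]) (intro continuous_intros P2c)
  also have "\<dots> = sq_norm (lebesgue_on {0..1}) (spectral_projection q t Q (\<lambda>x. cnj (P1 x)))"
    unfolding sq_norm_def by (intro nn_integral_cong) (simp add: proj)
  also have "\<dots> \<le> (ennreal k)\<^sup>2 * sq_norm (lebesgue_on {0..1}) (\<lambda>x. cnj (P1 x))"
    by (rule bound[OF continuous_L2[OF fc]])
  also have "\<dots> = ennreal (k\<^sup>2 * A1)"
    unfolding sq_norm_continuous[OF fc] using k by (simp add: A1_def ennreal_mult' ennreal_power)
  finally have "(A1 / cmod D)\<^sup>2 * A2 \<le> k\<^sup>2 * A1" using A by (subst (asm) ennreal_le_iff) auto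
  then have "A1 * (A1 * A2) \<le> A1 * (k * cmod D)\<^sup>2"
    using D0 by (simp add: power_divide power_mult_distrib field_simps power2_eq_square)
  then have "A2 * A1 \<le> (k * cmod D)\<^sup>2" using A1p by (simp add: mult.commute)
  then have "(L * cmod D)\<^sup>2 < (k * cmod D)\<^sup>2" using gram by linarith
  then have "L * cmod D < k * cmod D" using k by (simp add: power2_less_imp_less)
  then show "L \<le> k" by (simp add: mult_less_cancel_right)
qed

end

section \<open>The spectral singularity at infinity\<close>

lemma mathieu_spectral_singularity:
  assumes a: "a \<noteq> 0" and b: "b \<noteq> 0" and ab: "cmod a \<noteq> cmod b"
  shows "spectral_singularity_at_infinity (mathieu_potential a b)"
proof -
  have "\<exists>lam \<alpha> \<beta> Q. isolating_arc (mathieu_potential a b) (real n) (real n) lam \<alpha> \<beta> Q" for n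
    by (rule mathieu_isolating_arc[OF a b ab, of "real n" "real n"]) auto
  then obtain lam \<alpha> \<beta> Q where arc: "\<And>n. isolating_arc (mathieu_potential a b) (real n) (real n) (lam n) (\<alpha> n) (\<beta> n) (Q n)"
    by metis
  show ?thesis
    unfolding spectral_singularity_at_infinity_def
  proof (intro exI conjI allI)
    fix n show "regular_spectral_arc (mathieu_potential a b) (lam n) (\<alpha> n) (\<beta> n)"
      using arc[of n] unfolding isolating_arc_def by blast
  next
    have "real n \<le> infdist 0 ((\<lambda>t. lam n (of_real t)) ` {\<alpha> n..\<beta> n})" for n
    proof -
      have "\<alpha> n < \<beta> n" using arc[of n] unfolding isolating_arc_def regular_spectral_arc_def by blast
      then have ne: "(\<lambda>t. lam n (of_real t)) ` {\<alpha> n..\<beta> n} \<noteq> {}" by auto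
      have "real n \<le> dist 0 z" if "z \<in> (\<lambda>t. lam n (of_real t)) ` {\<alpha> n..\<beta> n}" for z
        using arc[of n] that unfolding isolating_arc_def by fastforce
      then show ?thesis using ne by (simp add: infdist_notempty cINF_greatest)
    qed
    then show "filterlim (\<lambda>n. infdist 0 ((\<lambda>t. lam n (of_real t)) ` {\<alpha> n..\<beta> n})) at_top sequentially"
      by (intro filterlim_at_top_mono[OF filterlim_real_sequentially] always_eventually) auto
    have "of_nat n \<le> arc_projection_norm (mathieu_potential a b) (lam n) (\<alpha> n) (\<beta> n)" for n
      using mathieu.arc_projection_norm_ge[OF arc[of n]] by (simp add: ennreal_of_nat_eq_real_of_nat)
    then show "(\<lambda>n. arc_projection_norm (mathieu_potential a b) (lam n) (\<alpha> n) (\<beta> n)) \<longlonglongrightarrow> \<infinity>"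
      unfolding infinity_ennreal_def
      by (intro tendsto_sandwich[OF _ _ of_nat_tendsto_top_ennreal tendsto_const] always_eventually allI) auto
  qed
qed

lemma AE_lebesgue_on_interval_witness:
  assumes "AE t in lebesgue_on S. P t" "{u..v} \<subseteq> S" "u < v" "S \<in> sets lebesgue"
  shows "\<exists>t\<in>{u..v}. P (t::real)"
proof (rule ccontr)
  assume no: "\<not> ?thesis"
  have "AE t in lebesgue. t \<in> S \<longrightarrow> P t" using assms(1,4) by (subst (asm) AE_restrict_space_iff) auto
  then have "AE t in lebesgue. t \<notin> {u..v}" by eventually_elim (use no assms(2) in auto)
  then have "{u..v} \<in> null_sets lebesgue" by (subst AE_iff_null_sets) auto
  then show False using assms(3) by (auto simp: null_sets_def)
qed

text \<open>Isolating arcs exist beyond every radius, hence beyond the given \<open>C\<close>. One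
  rectangle serves a whole interval of \<open>t\<close>, and no null set covers an interval.\<close>

lemma mathieu_not_asymptotically_spectral:
  assumes a: "a \<noteq> 0" and b: "b \<noteq> 0" and ab: "cmod a \<noteq> cmod b"
  shows "\<not> asymptotically_spectral (mathieu_potential a b)"
proof
  let ?q = "mathieu_potential a b"
  assume "asymptotically_spectral ?q"
  then obtain C where C: "(SUP \<sigma>\<in>rectangle_ring C.
        Inf {m. AE t in lebesgue_on {-pi<..pi}. spectral_projection_norm ?q t \<sigma> \<le> m}) < \<infinity>"
    unfolding asymptotically_spectral_def by blast
  then obtain n where n: "(SUP \<sigma>\<in>rectangle_ring C.
        Inf {m. AE t in lebesgue_on {-pi<..pi}. spectral_projection_norm ?q t \<sigma> \<le> m}) < of_nat n"
    using ennreal_Ex_less_of_nat by (auto simp: infinity_ennreal_def)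
  obtain lam \<alpha> \<beta> Q where arc: "isolating_arc ?q (real n) C lam \<alpha> \<beta> Q"
    by (rule mathieu_isolating_arc[OF a b ab, of "real n" C]) auto
  have Q: "Q \<in> rectangle_ring C"
    unfolding rectangle_ring_def using arc unfolding isolating_arc_def by (intro CollectI exI[of _ "{Q}"]) auto
  have sub: "{\<alpha>..\<beta>} \<subseteq> {-pi<..pi}" "\<alpha> < \<beta>"
    using arc unfolding isolating_arc_def regular_spectral_arc_def by auto
  have "of_nat n \<le> Inf {m. AE t in lebesgue_on {-pi<..pi}. spectral_projection_norm ?q t Q \<le> m}"
  proof (rule Inf_greatest)
    fix m assume "m \<in> {m. AE t in lebesgue_on {-pi<..pi}. spectral_projection_norm ?q t Q \<le> m}"
    then have "AE t in lebesgue_on {-pi<..pi}. spectral_projection_norm ?q t Q \<le> m" by simp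
    from AE_lebesgue_on_interval_witness[OF this sub]
    obtain t where t: "t \<in> {\<alpha>..\<beta>}" "spectral_projection_norm ?q t Q \<le> m" by auto
    show "of_nat n \<le> m"
      using mathieu.spectral_projection_norm_ge[OF arc t(1)] t(2) by (simp add: ennreal_of_nat_eq_real_of_nat)
  qed
  also have "\<dots> \<le> (SUP \<sigma>\<in>rectangle_ring C.
        Inf {m. AE t in lebesgue_on {-pi<..pi}. spectral_projection_norm ?q t \<sigma> \<le> m})"
    by (rule SUP_upper[OF Q])
  finally show False using n by simp
qed

theorem proposition3:
  fixes a b :: complex and q :: "real \<Rightarrow> complex"
  assumes "a \<noteq> 0" and "b \<noteq> 0"
    and "q = (\<lambda>x. a * exp (- \<i> * 2 * of_real pi * of_real x) + b * exp (\<i> * 2 * of_real pi * of_real x))"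
    and "cmod a \<noteq> cmod b"
  shows "spectral_singularity_at_infinity q \<and> \<not> asymptotically_spectral q"
proof -
  have "q = mathieu_potential a b" unfolding assms(3) mathieu_potential_def[abs_def] ..
  then show ?thesis
    using mathieu_spectral_singularity mathieu_not_asymptotically_spectral assms(1,2,4) by blast
qed

end
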